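(* Let $\varphi:T\times\mathbb{R}^n\to\overline{\mathbb{R}}$ be a proper normal integrand on a complete finite measure space $(T,\mathcal{A},\mu)$, let $\bar x\in\operatorname{dom}E_\varphi$, $\bar y\in\partial E_\varphi(\bar x)$, and let $\bar{\mathsf y}\in\mathcal{S}_\varphi(\bar x,\bar y)$. Suppose that there exist $\rho>0$ and $\kappa\in L^1(T,\mathbb{R}_+)$ such that: (a) $\partial E_\varphi(x)=\int_T\partial\varphi_t(x)\,d\mu$ for all $x\in\mathbb{B}_\rho(\bar x)$; (b) $\varphi_t$ is lower regular at every $x\in\mathbb{B}_\rho(\bar x)$ for all $t\in T_{na}$; (c) $\partial\varphi_t(x)\subset\kappa(t)\mathbb{B}$ for all $x\in\mathbb{B}_\rho(\bar x)$ and a.e. $t\in T$. Let $\bar y^*\in\mathbb{R}^n$ and $\bar x^*\in\breve\partial^2E_\varphi(\bar x,\bar y)(\bar y^* )$. Then there exist sequences $\{x_k\}\subset\mathbb{R}^n$, $\{\mathsf{x}_k\}\subset L^\infty(T,\mathbb{R}^n)$, $\{\mathsf{x}_k^*\}\subset L^1(T,\mathbb{R}^n)$, $\{\mathsf{y}_k\}\subset L^1(T,\mathbb{R}^n)$, and $\{\mathsf{y}_k^*\}\subset L^\infty(T,\mathbb{R}^n)$ such that: (i) $\mathsf{x}_k^*(t)\in\breve\partial^2\varphi_t(\mathsf{x}_k(t),\mathsf{y}_k(t))(\mathsf{y}_k^*(t))$ for a.e. $t\in T$ and all $k\in\mathbb{N}$; (ii) $\|\bar x-x_k\|\to0$, $\|\bar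 x-\mathsf{x}_k\|_\infty\to0$, $\|\bar{\mathsf y}-\mathsf{y}_k\|_1\to0$, and $\|\mathsf{y}_k^*-\bar y^*\|_\infty\to0$ as $k\to\infty$; (iii) $\int_T\|\mathsf{x}_k^*(t)\|\cdot\|\mathsf{x}_k(t)-x_k\|d\mu\to0$ and $\int_T\mathsf{x}_k^*(t)d\mu\to\bar x^*$ as $k\to\infty$.
   Context: $\overline{\mathbb{R}}=[-\infty,\infty]$, $\mathbb{R}_+:=\{\alpha\in\mathbb{R}:\alpha>0\}$; $L^p(T,\cdot)$ are the usual Lebesgue spaces; vectors are identified with constant functions; $\mathbb{B}_r(\cdot)$ is the closed ball, $\mathbb{B}$ the closed unit ball. $T=T_{pa}\cup T_{na}$ is the disjoint measurable decomposition of $T$ such that $\mu(\cdot\cap T_{pa})$ is purely atomic and $\mu(\cdot\cap T_{na})$ is nonatomic. $\varphi_t:=\varphi(t,\cdot)$; $\varphi$ is a normal integrand if it is $\mathcal{A}\otimes\mathcal{B}(\mathbb{R}^n)$-measurable with $\varphi_t$ lower semicontinuous for every $t$; it is proper if each $\varphi_t$ is proper. $E_\varphi(x):=\int_T\varphi_t(x)d\mu$ (with the convention $\infty-\infty=\infty$). The (Aumann) integral of $A:T\rightrightarrows\mathbb{R}^d$ is $\int_TA(t)d\mu=\{\int_T\mathsf{v}\,d\mu:\mathsf{v}\in L^1(T,\mathbb{R}^d),\ \mathsf{v}(t)\in A(t)\text{ a.e.}\}$. $\mathcal{S}_\varphi(x,y):=\{\mathsf{y}\in L^1(T,\mathbb{R}^n):\int_T\mathsf{y}\,d\mu=y,\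 \mathsf{y}(t)\in\partial\varphi_t(x)\text{ for a.e. }t\in T\}$. Regular normal cone: $\hat N(\bar z;\Omega)=\{z^*:\limsup_{z\to\bar z,z\in\Omega}\langle z^*,z-\bar z\rangle/\|z-\bar z\|\le0\}$ for $\bar z\in\Omega$, $\emptyset$ otherwise. Limiting normal cone: $N(\bar z;\Omega)=\{z^*:\exists z_k\to\bar z,\ z_k^*\to z^*,\ z_k^*\in\hat N(z_k;\Omega)\}$. For $\psi:\mathbb{R}^n\to\overline{\mathbb{R}}$ finite at $x$: $\hat\partial\psi(x)=\{x^*:(x^*,-1)\in\hat N((x,\psi(x));\operatorname{epi}\psi)\}$, $\partial\psi(x)=\{x^*:(x^*,-1)\in N((x,\psi(x));\operatorname{epi}\psi)\}$ (both empty if $\psi(x)$ is not finite); $\psi$ is lower regular at $x$ if $\psi(x)$ is finite and $\hat\partial\psi(x)=\partial\psi(x)$. Regular coderivative at $(x,y)\in\operatorname{gph}G$: $\hat D^*G(x,y)(y^* )=\{x^*:(x^*,-y^* )\in\hat N((x,y);\operatorname{gph}G)\}$. For $x^*\in\partial\psi(x)$ the combined second-order subdifferential is $\breve\partial^2\psi(x,x^* )(v^* ):=(\hat D^*\partial\psi)(x,x^* )(v^* )$. *)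

theory Defs
  imports "HOL-Analysis.Analysis" "HOL-Probability.Essential_Supremum"
begin

subsection \<open>Measures and Lebesgue spaces\<close>

definition measure_atom :: "'t measure \<Rightarrow> 't set \<Rightarrow> bool" where
  "measure_atom M A \<longleftrightarrow> A \<in> sets M \<and> emeasure M A > 0 \<and>
     (\<forall>B \<in> sets M. B \<subseteq> A \<longrightarrow> emeasure M B = 0 \<or> emeasure M (A - B) = 0)"

definition nonatomic :: "'t measure \<Rightarrow> bool" where
  "nonatomic M \<longleftrightarrow> (\<nexists>A. measure_atom M A)"

definition purely_atomic :: "'t measure \<Rightarrow> bool" where
  "purely_atomic M \<longleftrightarrow> (\<forall>A \<in> sets M. emeasure M A > 0 \<longrightarrow> (\<exists>B \<subseteq> A. measure_atom M B))"

text \<open>By \<open>emeasure_restricted\<close>, \<open>density M (indicator S)\<close> is the measure sending \<open>A\<close> to the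
  \<open>M\<close>-measure of \<open>S \<inter> A\<close>. Such a decomposition is unique only up to null sets.\<close>

definition atomic_decomposition :: "'t measure \<Rightarrow> 't set \<Rightarrow> 't set \<Rightarrow> bool" where
  "atomic_decomposition M Tpa Tna \<longleftrightarrow>
     Tpa \<in> sets M \<and> Tna \<in> sets M \<and> Tpa \<inter> Tna = {} \<and> Tpa \<union> Tna = space M \<and>
     purely_atomic (density M (indicator Tpa)) \<and> nonatomic (density M (indicator Tna))"

text \<open>Elements of the Lebesgue spaces are represented by functions rather than by equivalence
  classes. The value type \<^typ>\<open>ennreal\<close> makes the norm \<open>0\<close> (rather than \<open>-\<infinity>\<close>) on a null space.\<close>

definition Linf_norm :: "'t measure \<Rightarrow> ('t \<Rightarrow> 'b::real_normed_vector) \<Rightarrow> ennreal" where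
  "Linf_norm M f = esssup M (\<lambda>t. ennreal (norm (f t)))"

definition L1 :: "'t measure \<Rightarrow> ('t \<Rightarrow> 'b::{banach, second_countable_topology}) set" where
  "L1 M = {f. integrable M f}"

definition Linf :: "'t measure \<Rightarrow> ('t \<Rightarrow> 'b::real_normed_vector) set" where
  "Linf M = {f. f \<in> borel_measurable M \<and> Linf_norm M f < \<infinity>}"

definition L1_norm :: "'t measure \<Rightarrow> ('t \<Rightarrow> 'b::{banach, second_countable_topology}) \<Rightarrow> real" where
  "L1_norm M f = (\<integral>t. norm (f t) \<partial>M)"

definition aumann_integral ::
  "'t measure \<Rightarrow> ('t \<Rightarrow> 'b::{banach, second_countable_topology} set) \<Rightarrow> 'b set" where
  "aumann_integral M A = {(\<integral>t. v t \<partial>M) | v. v \<in> L1 M \<and> (AE t in M. v t \<in> A t)}"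


subsection \<open>Normal integrands and expectation functionals\<close>

definition lower_semicontinuous :: "('a::topological_space \<Rightarrow> ereal) \<Rightarrow> bool" where
  "lower_semicontinuous f \<longleftrightarrow> (\<forall>x. f x \<le> Liminf (at x) f)"

definition proper_fun :: "('a \<Rightarrow> ereal) \<Rightarrow> bool" where
  "proper_fun f \<longleftrightarrow> (\<forall>x. f x > -\<infinity>) \<and> (\<exists>x. f x < \<infinity>)"

definition eff_dom :: "('a \<Rightarrow> ereal) \<Rightarrow> 'a set" where
  "eff_dom f = {x. f x < \<infinity>}"

definition normal_integrand :: "'t measure \<Rightarrow> ('t \<Rightarrow> 'a::topological_space \<Rightarrow> ereal) \<Rightarrow> bool" where
  "normal_integrand M \<phi> \<longleftrightarrow>
     case_prod \<phi> \<in> borel_measurable (M \<Otimes>\<^sub>M borel) \<and>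
     (\<forall>t \<in> space M. lower_semicontinuous (\<phi> t))"

definition proper_integrand :: "'t measure \<Rightarrow> ('t \<Rightarrow> 'a \<Rightarrow> ereal) \<Rightarrow> bool" where
  "proper_integrand M \<phi> \<longleftrightarrow> (\<forall>t \<in> space M. proper_fun (\<phi> t))"

text \<open>The first and second terms are the integrals of the positive and the negative part, since
  \<open>e2ennreal\<close> sends negative values to \<open>0\<close>. Subtraction on \<^typ>\<open>ereal\<close> satisfies
  \<open>\<infinity> - \<infinity> = \<infinity>\<close>, which is the required convention.\<close>

definition extended_integral :: "'t measure \<Rightarrow> ('t \<Rightarrow> ereal) \<Rightarrow> ereal" where
  "extended_integral M f =
     enn2ereal (\<integral>\<^sup>+t. e2ennreal (f t) \<partial>M) - enn2ereal (\<integral>\<^sup>+t. e2ennreal (- f t) \<partial>M)"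

definition expectation_functional :: "'t measure \<Rightarrow> ('t \<Rightarrow> 'a \<Rightarrow> ereal) \<Rightarrow> 'a \<Rightarrow> ereal" where
  "expectation_functional M \<phi> x = extended_integral M (\<lambda>t. \<phi> t x)"


subsection \<open>Normal cones, subdifferentials, coderivatives\<close>

text \<open>At an isolated point of \<open>\<Omega>\<close> the limit superior is over the trivial filter and equals
  \<open>-\<infinity>\<close>, so the cone is the whole space.\<close>

definition regular_normal_cone :: "'a::real_inner \<Rightarrow> 'a set \<Rightarrow> 'a set" where
  "regular_normal_cone zbar \<Omega> =
     (if zbar \<in> \<Omega> then
        {zs. Limsup (at zbar within \<Omega>) (\<lambda>z. ereal (inner zs (z - zbar) / norm (z - zbar))) \<le> 0}
      else {})"

definition limiting_normal_cone :: "'a::real_inner \<Rightarrow> 'a set \<Rightarrow> 'a set" where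
  "limiting_normal_cone zbar \<Omega> =
     {zs. \<exists>(z :: nat \<Rightarrow> 'a) (w :: nat \<Rightarrow> 'a). z \<longlonglongrightarrow> zbar \<and> w \<longlonglongrightarrow> zs \<and>
        (\<forall>k. w k \<in> regular_normal_cone (z k) \<Omega>)}"

text \<open>The library constant \<open>epigraph\<close> covers only real-valued functions.\<close>

definition epi :: "('a \<Rightarrow> ereal) \<Rightarrow> ('a \<times> real) set" where
  "epi f = {(x, \<alpha>). f x \<le> ereal \<alpha>}"

definition regular_subdiff :: "('a::real_inner \<Rightarrow> ereal) \<Rightarrow> 'a \<Rightarrow> 'a set" where
  "regular_subdiff f x =
     (if \<bar>f x\<bar> \<noteq> \<infinity> then {xs. (xs, -1) \<in> regular_normal_cone (x, real_of_ereal (f x)) (epi f)} else {})"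

definition limiting_subdiff :: "('a::real_inner \<Rightarrow> ereal) \<Rightarrow> 'a \<Rightarrow> 'a set" where
  "limiting_subdiff f x =
     (if \<bar>f x\<bar> \<noteq> \<infinity> then {xs. (xs, -1) \<in> limiting_normal_cone (x, real_of_ereal (f x)) (epi f)} else {})"

definition lower_regular_at :: "('a::real_inner \<Rightarrow> ereal) \<Rightarrow> 'a \<Rightarrow> bool" where
  "lower_regular_at f x \<longleftrightarrow> \<bar>f x\<bar> \<noteq> \<infinity> \<and> regular_subdiff f x = limiting_subdiff f x"

definition graph_of :: "('a \<Rightarrow> 'b set) \<Rightarrow> ('a \<times> 'b) set" where
  "graph_of G = {(x, y). y \<in> G x}"

definition regular_coderivative ::
  "('a::real_inner \<Rightarrow> 'b::real_inner set) \<Rightarrow> 'a \<Rightarrow> 'b \<Rightarrow> 'b \<Rightarrow> 'a set" where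
  "regular_coderivative G x y ys = {xs. (xs, - ys) \<in> regular_normal_cone (x, y) (graph_of G)}"

text \<open>If \<open>xs\<close> is not a limiting subgradient of \<open>f\<close> at \<open>x\<close>, the value is empty.\<close>

definition combined_subdiff2 :: "('a::real_inner \<Rightarrow> ereal) \<Rightarrow> 'a \<Rightarrow> 'a \<Rightarrow> 'a \<Rightarrow> 'a set" where
  "combined_subdiff2 f x xs vs = regular_coderivative (limiting_subdiff f) x xs vs"

definition subgradient_selections ::
  "'t measure \<Rightarrow> ('t \<Rightarrow> 'a::euclidean_space \<Rightarrow> ereal) \<Rightarrow> 'a \<Rightarrow> 'a \<Rightarrow> ('t \<Rightarrow> 'a) set" where
  "subgradient_selections M \<phi> x y =
     {v \<in> L1 M. (\<integral>t. v t \<partial>M) = y \<and> (AE t in M. v t \<in> limiting_subdiff (\<phi> t) x)}"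

end

theory Submission
  imports Defs
begin

text \<open>Write \<open>G t\<close> for the graph of the subdifferential of \<open>\<phi> t\<close>. For \<open>\<epsilon> > 0\<close> we minimise over
  \<open>x\<close> near \<open>xbar\<close> the function
  \<open>- xsbar \<bullet> (x - xbar) + \<epsilon> \<bar>x - xbar\<bar> + (\<integral> m t x)\<close>, where \<open>m t x\<close> is the minimum over \<open>(u, v) \<in> G t\<close> of
  \<open>ysbar \<bullet> (v - yfbar t) + \<epsilon> sqrt (d\<^sup>2 + \<bar>v - yfbar t\<bar>\<^sup>2) + c (\<kappa> t + 1) \<bar>u - x\<bar>\<^sup>2\<close>.
  Since the inner minimisation is pointwise over compact sets, it is attained by a measurable selection.
  The penalty \<open>c\<close> decouples \<open>u\<close> from \<open>x\<close>, and because all terms in \<open>(u, v)\<close> are smooth, minimality yields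
  elements of the regular coderivative; stationarity in \<open>x\<close> makes their integral close to \<open>xsbar\<close>.

  As \<open>c\<close> tends to infinity and \<open>d\<close> to zero, the minimisers converge to \<open>(xbar, yfbar)\<close> provided that
  \<open>(xbar, yfbar)\<close> is a global minimiser of the coupled problem. The coderivative inequality at
  \<open>(xbar, ybar)\<close> gives only a local minimum. On the nonatomic part it is global because the subdifferentials
  at \<open>xbar\<close> are convex; on finitely many atoms carrying most of the integral of \<open>\<kappa>\<close> the constraint
  \<open>\<bar>v - yfbar t\<bar> \<le> \<eta>\<close> is added, which is inactive in the limit.\<close>

subsection \<open>Normal cones and subdifferentials\<close>

text \<open>The given coderivative inequality only sees integrals of selections at one common point
  \<open>x\<close>, whereas the conclusion needs pairs \<open>(u, v)\<close> free at each
  \<open>t\<close>. The weight \<open>\<kappa> t + 1\<close> of the penalty makes this relaxation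
  harmless in two ways. Moving \<open>v\<close> gains at most a multiple of
  \<open>\<kappa> t\<close>, so dividing by the weight bounds \<open>u - x\<close> uniformly in
  \<open>t\<close>. Moreover, the multiplier is the derivative of the penalty, so its norm times
  \<open>norm (u - x)\<close> is twice the penalty, whose integral tends to zero. The parameter
  \<open>d\<close> smooths a norm whose kink sits exactly at \<open>yfbar t\<close>; the gradient of
  the smoothed norm has norm at most \<open>1\<close> for every \<open>d\<close>, which keeps the
  dual functions uniformly near \<open>ysbar\<close>. Convergence comes from a margin: minimality of
  \<open>(xbar, yfbar)\<close> is proved for one value of \<open>\<epsilon>\<close> and the
  penalised problem is solved with twice that value; the surplus bounds the distances. Measurable
  selection requires a measurable graph. Hypothesis (c) makes each \<open>\<phi> t\<close> Lipschitz
  near \<open>xbar\<close> for a.e. \<open>t\<close>, and then limiting subgradients are limits of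
  pairs described by countably many inequalities.\<close>

lemma regular_normal_cone_iff:
  "zs \<in> regular_normal_cone z \<Omega> \<longleftrightarrow>
     z \<in> \<Omega> \<and> (\<forall>e>0. \<exists>d>0. \<forall>w\<in>\<Omega>. dist w z < d \<longrightarrow> inner zs (w - z) \<le> e * norm (w - z))"
proof -
  have "Limsup (at z within \<Omega>) (\<lambda>w. ereal (inner zs (w - z) / norm (w - z))) \<le> 0 \<longleftrightarrow>
      (\<forall>e>0. \<exists>d>0. \<forall>w\<in>\<Omega>. dist w z < d \<longrightarrow> inner zs (w - z) \<le> e * norm (w - z))" (is "?L \<longleftrightarrow> ?R")
  proof
    assume ?L
    show ?R
    proof (intro allI impI)
      fix e :: real assume "e > 0"
      then have "\<forall>\<^sub>F w in at z within \<Omega>. ereal (inner zs (w - z) / norm (w - z)) < ereal e"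
        using \<open>?L\<close> by (intro Limsup_lessD) (auto intro: le_less_trans)
      then obtain d where d: "d > 0"
        "\<forall>w\<in>\<Omega>. w \<noteq> z \<and> dist w z < d \<longrightarrow> inner zs (w - z) / norm (w - z) < e"
        by (auto simp: eventually_at)
      have "inner zs (w - z) \<le> e * norm (w - z)" if "w \<in> \<Omega>" "dist w z < d" for w
      proof (cases "w = z")
        case False
        then have "inner zs (w - z) / norm (w - z) < e" using d(2) that by blast
        then show ?thesis using False by (simp add: pos_divide_less_eq)
      qed simp
      then show "\<exists>d>0. \<forall>w\<in>\<Omega>. dist w z < d \<longrightarrow> inner zs (w - z) \<le> e * norm (w - z)"
        using d(1) by blast
    qed
  next
    assume R: ?R
    have "Limsup (at z within \<Omega>) (\<lambda>w. ereal (inner zs (w - z) / norm (w - z))) \<le> ereal e"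
      if "e > 0" for e
    proof (rule Limsup_bounded)
      obtain d where d: "d > 0" "\<forall>w\<in>\<Omega>. dist w z < d \<longrightarrow> inner zs (w - z) \<le> e * norm (w - z)"
        using R \<open>e > 0\<close> by blast
      show "\<forall>\<^sub>F w in at z within \<Omega>. ereal (inner zs (w - z) / norm (w - z)) \<le> ereal e"
        unfolding eventually_at using d by (intro exI[of _ d]) (simp add: pos_divide_le_eq)
    qed
    then show ?L
      using ereal_le_epsilon2[of _ 0] by simp
  qed
  then show ?thesis by (simp add: regular_normal_cone_def)
qed

lemma regular_normal_cone_subset_limiting: "regular_normal_cone z \<Omega> \<subseteq> limiting_normal_cone z \<Omega>"
proof
  fix w assume "w \<in> regular_normal_cone z \<Omega>"
  then have "(\<lambda>_. z) \<longlonglongrightarrow> z \<and> (\<lambda>_. w) \<longlonglongrightarrow> w \<and> (\<forall>k::nat. w \<in> regular_normal_cone z \<Omega>)"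
    by simp
  then show "w \<in> limiting_normal_cone z \<Omega>"
    unfolding limiting_normal_cone_def by blast
qed

lemma regular_subdiff_subset_limiting: "regular_subdiff f x \<subseteq> limiting_subdiff f x"
  using regular_normal_cone_subset_limiting
  by (auto simp: regular_subdiff_def limiting_subdiff_def)

lemma convex_regular_normal_cone: "convex (regular_normal_cone z \<Omega>)"
proof (rule convexI)
  fix a b :: 'a and s t :: real
  assume ab: "a \<in> regular_normal_cone z \<Omega>" "b \<in> regular_normal_cone z \<Omega>"
    and st: "0 \<le> s" "0 \<le> t" "s + t = 1"
  have "\<exists>d>0. \<forall>w\<in>\<Omega>. dist w z < d \<longrightarrow> inner (s *\<^sub>R a + t *\<^sub>R b) (w - z) \<le> e * norm (w - z)"
    if "e > 0" for e
  proof -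
    obtain d1 d2 where d: "d1 > 0" "\<forall>w\<in>\<Omega>. dist w z < d1 \<longrightarrow> inner a (w - z) \<le> e * norm (w - z)"
      "d2 > 0" "\<forall>w\<in>\<Omega>. dist w z < d2 \<longrightarrow> inner b (w - z) \<le> e * norm (w - z)"
      using ab \<open>e > 0\<close> unfolding regular_normal_cone_iff by blast
    have "inner (s *\<^sub>R a + t *\<^sub>R b) (w - z) \<le> e * norm (w - z)"
      if "w \<in> \<Omega>" "dist w z < min d1 d2" for w
    proof -
      have "inner (s *\<^sub>R a + t *\<^sub>R b) (w - z) = s * inner a (w - z) + t * inner b (w - z)"
        by (simp add: inner_add_left)
      also have "\<dots> \<le> s * (e * norm (w - z)) + t * (e * norm (w - z))"
        using d that st by (intro add_mono mult_left_mono) auto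
      also have "\<dots> = e * norm (w - z)"
        using st by (metis distrib_right mult_1)
      finally show ?thesis .
    qed
    then show ?thesis using d(1,3) by (intro exI[of _ "min d1 d2"]) simp
  qed
  then show "s *\<^sub>R a + t *\<^sub>R b \<in> regular_normal_cone z \<Omega>"
    using ab unfolding regular_normal_cone_iff by blast
qed

text \<open>A limiting subdifferential may fail to be convex. Under lower regularity it equals this
  convex set, which is how the nonatomic part gets convex fibres.\<close>

lemma convex_regular_subdiff: "convex (regular_subdiff f x)"
proof (rule convexI)
  fix a b :: 'a and s t :: real
  assume ab: "a \<in> regular_subdiff f x" "b \<in> regular_subdiff f x"
    and st: "0 \<le> s" "0 \<le> t" "s + t = 1"
  then have fin: "\<bar>f x\<bar> \<noteq> \<infinity>"
    by (auto simp: regular_subdiff_def split: if_splits)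
  then have "s *\<^sub>R (a, -1) + t *\<^sub>R (b, -1) \<in> regular_normal_cone (x, real_of_ereal (f x)) (epi f)"
    using ab st by (intro convexD[OF convex_regular_normal_cone]) (auto simp: regular_subdiff_def)
  moreover have "s *\<^sub>R (a, -1) + t *\<^sub>R (b, -1 :: real) = (s *\<^sub>R a + t *\<^sub>R b, -1)"
    using st by simp
  ultimately show "s *\<^sub>R a + t *\<^sub>R b \<in> regular_subdiff f x"
    using fin by (simp add: regular_subdiff_def)
qed

text \<open>Raising the last coordinate of an epigraph point only lowers its pairing with
  \<open>(v, -1)\<close>, so an estimate on \<open>f\<close> itself controls the whole
  epigraph.\<close>

lemma regular_subdiffI:
  assumes fx: "f x = ereal a"
    and le: "\<And>e. e > 0 \<Longrightarrow> \<exists>d>0. \<forall>z. dist z x < d \<longrightarrow> ereal (a + inner v (z - x) - e * norm (z - x)) \<le> f z"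
  shows "v \<in> regular_subdiff f x"
proof -
  have "\<exists>d>0. \<forall>w\<in>epi f. dist w (x, a) < d \<longrightarrow> inner (v, -1) (w - (x, a)) \<le> e * norm (w - (x, a))"
    if "e > 0" for e
  proof -
    obtain d where d: "d > 0"
      "\<And>z. dist z x < d \<Longrightarrow> ereal (a + inner v (z - x) - e * norm (z - x)) \<le> f z"
      using le[OF \<open>e > 0\<close>] by metis
    have "inner (v, -1) ((z, b) - (x, a)) \<le> e * norm ((z, b) - (x, a))"
      if "(z, b) \<in> epi f" "dist (z, b) (x, a) < d" for z b
    proof -
      have "dist z x < d"
        using dist_fst_le[of "(z, b)" "(x, a)"] that(2) by simp
      then have "ereal (a + inner v (z - x) - e * norm (z - x)) \<le> ereal b"
        using order_trans[OF d(2)[of z], of "ereal b"] that(1) by (simp add: epi_def)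
      then have "inner v (z - x) - (b - a) \<le> e * norm (z - x)" by simp
      also have "\<dots> \<le> e * norm ((z, b) - (x, a))"
        using \<open>e > 0\<close> norm_fst_le[of "(z - x)" "b - a"] by simp
      finally show ?thesis by simp
    qed
    then show ?thesis using d(1) by (intro exI[of _ d]) (simp add: split_paired_all)
  qed
  then have "(v, -1) \<in> regular_normal_cone (x, a) (epi f)"
    unfolding regular_normal_cone_iff by (auto simp: epi_def fx)
  then show ?thesis by (simp add: regular_subdiff_def fx)
qed

lemma lower_semicontinuousD:
  fixes f :: "'a::metric_space \<Rightarrow> ereal"
  assumes "lower_semicontinuous f" "y < f x"
  shows "\<exists>d>0. \<forall>z. dist z x < d \<longrightarrow> y < f z"
proof -
  have "\<forall>\<^sub>F z in at x. y < f z"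
    using assms by (intro less_LiminfD) (auto simp: lower_semicontinuous_def intro: less_le_trans)
  then obtain d where "d > 0" "\<And>z. z \<noteq> x \<Longrightarrow> dist z x < d \<Longrightarrow> y < f z"
    unfolding eventually_at by blast
  then show ?thesis
    using assms(2) by metis
qed

text \<open>Without a minimiser every \<open>x\<close> in \<open>S\<close> has a better point
  \<open>g x\<close>, and \<open>f\<close> exceeds \<open>f (g x)\<close> near \<open>x\<close>.
  Finitely many such neighbourhoods cover \<open>S\<close>; the point \<open>g x\<close> with the
  smallest value among them lies in one of these neighbourhoods, which is contradictory.\<close>

lemma lower_semicontinuous_attains_inf:
  fixes f :: "'a::metric_space \<Rightarrow> ereal"
  assumes "compact S" "S \<noteq> {}" and lsc: "\<And>x y. x \<in> S \<Longrightarrow> y < f x \<Longrightarrow> \<exists>d>0. \<forall>z. dist z x < d \<longrightarrow> y < f z"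
  shows "\<exists>x\<in>S. \<forall>z\<in>S. f x \<le> f z"
proof (rule ccontr)
  assume "\<not> ?thesis"
  then have "\<forall>x\<in>S. \<exists>z\<in>S. f z < f x" by (auto simp: not_le)
  then obtain g where g: "\<And>x. x \<in> S \<Longrightarrow> g x \<in> S \<and> f (g x) < f x" by metis
  then have "\<forall>x\<in>S. \<exists>d>0. \<forall>z. dist z x < d \<longrightarrow> f (g x) < f z" using lsc by blast
  then obtain d where d: "\<And>x. x \<in> S \<Longrightarrow> d x > 0 \<and> (\<forall>z. dist z x < d x \<longrightarrow> f (g x) < f z)" by metis
  have "S \<subseteq> (\<Union>x\<in>S. ball x (d x))" using d by force
  then obtain F where F: "F \<subseteq> S" "finite F" "S \<subseteq> (\<Union>x\<in>F. ball x (d x))"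
    using compactE_image[OF assms(1), of S "\<lambda>x. ball x (d x)"] by auto
  then have "F \<noteq> {}" using assms(2) by auto
  then have "Min ((\<lambda>z. f (g z)) ` F) \<in> (\<lambda>z. f (g z)) ` F" using F(2) by simp
  then obtain x where "x \<in> F" and min: "Min ((\<lambda>z. f (g z)) ` F) = f (g x)" by blast
  have x: "f (g x) \<le> f (g z)" if "z \<in> F" for z
    using \<open>x \<in> F\<close> F(2) that by (auto simp flip: min)
  then have "g x \<in> S" using g F(1) \<open>x \<in> F\<close> by blast
  then obtain z where z: "z \<in> F" "dist (g x) z < d z" using F(3) by (auto simp: dist_commute)
  then have "f (g z) < f (g x)" using d F(1) by blast
  then show False using x[OF z(1)] by simp
qed

text \<open>Concavity of the square root, obtained from the arithmetic-geometric mean inequality for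
  \<open>sqrt (s + 2 * d)\<close> and \<open>sqrt s\<close>.\<close>

lemma sqrt_le_tangent:
  assumes "s > 0" "s + 2 * d \<ge> 0"
  shows "sqrt (s + 2 * d) \<le> sqrt s + d / sqrt s"
proof -
  have p: "sqrt s > 0" using assms by simp
  have "sqrt (s + 2 * d) * sqrt s \<le> (sqrt (s + 2 * d) ^ 2 + sqrt s ^ 2) / 2"
    using sum_squares_bound[of "sqrt (s + 2 * d)" "sqrt s"] by simp
  also have "\<dots> = sqrt s * sqrt s + d" using assms by simp
  finally show ?thesis using p by (simp add: field_simps)
qed

text \<open>The case \<open>s = 0\<close> treats the norm away from the origin, the case
  \<open>s = d ^ 2\<close> the smoothed norm of the penalised problem. The explicit quadratic
  remainder turns minimality into proximal inequalities.\<close>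

lemma norm_add_le_tangent:
  fixes a h :: "'a::real_inner"
  assumes "s \<ge> 0" "s + norm a ^ 2 > 0"
  shows "sqrt (s + norm (a + h) ^ 2) \<le>
    sqrt (s + norm a ^ 2) + (inner a h + norm h ^ 2 / 2) / sqrt (s + norm a ^ 2)"
proof -
  have "s + norm (a + h) ^ 2 = (s + norm a ^ 2) + 2 * (inner a h + norm h ^ 2 / 2)"
    by (simp add: power2_norm_eq_inner inner_add inner_commute)
  moreover have "0 \<le> s + norm (a + h) ^ 2" using assms(1) by simp
  ultimately show ?thesis
    using sqrt_le_tangent[OF assms(2), of "inner a h + norm h ^ 2 / 2"] by metis
qed

text \<open>Penalising with \<open>C * norm (z - x)\<close> for \<open>C\<close> above the bound on the subgradients leaves \<open>x\<close> as
  the only possible interior minimiser; this shows both finiteness and the Lipschitz estimate.\<close>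

lemma bounded_subdiff_imp_lipschitz:
  fixes f :: "'a::euclidean_space \<Rightarrow> ereal"
  assumes lsc: "lower_semicontinuous f" and proper: "\<And>x. f x > -\<infinity>"
    and fin: "\<bar>f x0\<bar> \<noteq> \<infinity>" and "\<rho> > 0"
    and bd: "\<And>x. x \<in> cball x0 \<rho> \<Longrightarrow> limiting_subdiff f x \<subseteq> cball 0 K"
  obtains C where "C \<ge> 0" "\<And>x. x \<in> cball x0 (\<rho>/4) \<Longrightarrow> \<bar>f x\<bar> \<noteq> \<infinity>"
    "\<And>x z. x \<in> cball x0 (\<rho>/4) \<Longrightarrow> z \<in> cball x0 (\<rho>/4) \<Longrightarrow>
      real_of_ereal (f x) \<le> real_of_ereal (f z) + C * norm (z - x)"
proof -
  obtain b where b: "f x0 = ereal b" using fin by auto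
  obtain zm where zm: "zm \<in> cball x0 \<rho>" "\<And>z. z \<in> cball x0 \<rho> \<Longrightarrow> f zm \<le> f z"
    using lower_semicontinuous_attains_inf[of "cball x0 \<rho>" f] lower_semicontinuousD[OF lsc] \<open>\<rho> > 0\<close>
    by auto
  have "f zm \<le> ereal b" using zm(2)[of x0] b \<open>\<rho> > 0\<close> by simp
  then obtain m where m: "f zm = ereal m" using proper[of zm] by (cases "f zm") auto
  \<comment> \<open>Two requirements: \<open>C\<close> exceeds every subgradient norm, and the last
    summand makes the penalty at distance \<open>\<rho>/2\<close> outweigh its value at
    \<open>x0\<close>, at most \<open>C * (\<rho>/4)\<close>, plus the largest possible drop
    \<open>b - m\<close> of \<open>f\<close>.\<close>
  define C where "C = \<bar>K\<bar> + 1 + 4 * \<bar>b - m\<bar> / \<rho>"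
  have C: "C > 0" "C > K" "C * (\<rho>/4) > b - m"
  proof -
    have "\<rho> * (\<bar>K\<bar> + 1) > 0" using \<open>\<rho> > 0\<close> by (intro mult_pos_pos) auto
    then have "4 * (b - m) < \<rho> * (\<bar>K\<bar> + 1) + 4 * \<bar>b - m\<bar>"
      using abs_ge_self[of "b - m"] by simp
    also have "\<dots> = C * \<rho>" using \<open>\<rho> > 0\<close> by (simp add: C_def field_simps)
    finally show "C * (\<rho>/4) > b - m" by simp
    have "4 * \<bar>b - m\<bar> / \<rho> \<ge> 0" using \<open>\<rho> > 0\<close> by simp
    then show "C > 0" "C > K" unfolding C_def by linarith+
  qed
  have main: "\<bar>f x\<bar> \<noteq> \<infinity> \<and> (\<forall>z\<in>cball x (\<rho>/2). f x \<le> f z + ereal (C * norm (z - x)))"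
    if x: "x \<in> cball x0 (\<rho>/4)" for x
  proof -
    define g where "g z = f z + ereal (C * norm (z - x))" for z
    have g_lsc: "\<exists>d>0. \<forall>w. dist w z < d \<longrightarrow> y < g w" if "y < g z" for z y
    proof (cases y)
      case (real y')
      have "ereal (y' - C * norm (z - x)) < f z"
        using that real unfolding g_def by (cases "f z") auto
      then obtain y2 where y2: "y' - C * norm (z - x) < y2" "ereal y2 < f z"
        using ereal_dense2 by (metis less_ereal.simps(1))
      define e where "e = (y2 - (y' - C * norm (z - x))) / C"
      have "e > 0" using y2 C by (simp add: e_def)
      obtain d where d: "d > 0" "\<And>w. dist w z < d \<Longrightarrow> ereal y2 < f w"
        using lower_semicontinuousD[OF lsc y2(2)] by blast
      have "y < g w" if "dist w z < min d e" for w
      proof -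
        have "norm (z - x) \<le> norm (w - x) + dist w z"
          using norm_triangle_ineq[of "w - x" "z - w"] by (simp add: dist_norm norm_minus_commute)
        then have "norm (z - x) < norm (w - x) + e" using that by simp
        then have "C * norm (z - x) < C * (norm (w - x) + e)" using C by simp
        also have "\<dots> = C * norm (w - x) + (y2 - y' + C * norm (z - x))"
          using C by (simp add: e_def field_simps)
        finally have "ereal y' < ereal (y2 + C * norm (w - x))" by simp
        also have "\<dots> \<le> g w"
          using d(2)[of w] that unfolding g_def by (cases "f w") auto
        finally show ?thesis using real by simp
      qed
      then show ?thesis using d(1) \<open>e > 0\<close> by (intro exI[of _ "min d e"]) auto
    next
      case MInf
      have "-\<infinity> < g w" for w using proper[of w] unfolding g_def by (cases "f w") auto
      then show ?thesis using MInf by (intro exI[of _ 1]) auto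
    qed (use that in simp)
    obtain z where z: "z \<in> cball x (\<rho>/2)" "\<And>w. w \<in> cball x (\<rho>/2) \<Longrightarrow> g z \<le> g w"
      using lower_semicontinuous_attains_inf[of "cball x (\<rho>/2)" g] g_lsc \<open>\<rho> > 0\<close> by auto
    have sub: "cball x (\<rho>/2) \<subseteq> cball x0 \<rho>"
    proof
      fix w assume "w \<in> cball x (\<rho>/2)"
      then show "w \<in> cball x0 \<rho>"
        using x dist_triangle[of x0 w x] \<open>\<rho> > 0\<close> by (simp)
    qed
    have x0: "x0 \<in> cball x (\<rho>/2)" using x \<open>\<rho> > 0\<close> by (simp add: dist_commute)
    have "g x0 \<le> ereal (b + C * (\<rho>/4))"
      using x C by (simp add: g_def b dist_norm mult_left_mono)
    then have gz: "g z \<le> ereal (b + C * (\<rho>/4))" using z(2)[OF x0] by simp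
    obtain a where a: "f z = ereal a"
      using gz proper[of z] unfolding g_def by (cases "f z") auto
    have am: "a \<ge> m" using zm(2)[of z] z(1) sub a m by auto
    have "norm (z - x) < \<rho>/2"
    proof (rule ccontr)
      assume "\<not> ?thesis"
      then have "C * (\<rho>/2) \<le> C * norm (z - x)" using C by simp
      then show False using gz am C(3) by (simp add: g_def a)
    qed
    have "z = x"
    proof (rule ccontr)
      assume "z \<noteq> x"
      define n where "n = norm (z - x)"
      have n: "n > 0" using \<open>z \<noteq> x\<close> by (simp add: n_def)
      \<comment> \<open>Minus the gradient of the penalty, which is smooth at \<open>z\<close>
        because \<open>z\<close> differs from \<open>x\<close>. Minimality makes it a regular
        subgradient, yet its norm is \<open>C > K\<close>.\<close>
      define v where "v = - ((C / n) *\<^sub>R (z - x))"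
      have "v \<in> regular_subdiff f z"
      proof (rule regular_subdiffI[where a = a])
        fix e :: real assume "e > 0"
        \<comment> \<open>The first bound keeps \<open>w\<close> in the ball over which
          \<open>z\<close> is minimal; the second absorbs the quadratic remainder into
          \<open>e * norm (w - z)\<close>.\<close>
        define d where "d = min (\<rho>/2 - n) (2 * n * e / C)"
        have "d > 0" using \<open>norm (z - x) < \<rho>/2\<close> n C \<open>e > 0\<close> by (simp add: d_def n_def)
        have "ereal (a + inner v (w - z) - e * norm (w - z)) \<le> f w" if w: "dist w z < d" for w
        proof -
          have "w \<in> cball x (\<rho>/2)"
            using w dist_triangle[of x w z] by (simp add: d_def n_def dist_norm norm_minus_commute)
          then have "g z \<le> g w" using z by blast
          then have *: "ereal (a + C * norm (z - x) - C * norm (w - x)) \<le> f w"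
            by (cases "f w") (auto simp: g_def a)
          have "norm (w - x) \<le> n + (inner (z - x) (w - z) + norm (w - z) ^ 2 / 2) / n"
            using norm_add_le_tangent[of 0 "z - x" "w - z"] n by (simp add: n_def)
          then have "C * norm (w - x) \<le> C * (n + (inner (z - x) (w - z) + norm (w - z) ^ 2 / 2) / n)"
            using C by simp
          also have "\<dots> = C * n - inner v (w - z) + C * norm (w - z) ^ 2 / (2 * n)"
            using n by (simp add: v_def add_divide_distrib distrib_left)
          also have "C * norm (w - z) ^ 2 / (2 * n) \<le> e * norm (w - z)"
          proof -
            have "norm (w - z) \<le> 2 * n * e / C" using w by (simp add: d_def dist_norm)
            then have "C * norm (w - z) \<le> 2 * n * e" using C by (simp add: field_simps)
            then have "C * norm (w - z) * norm (w - z) \<le> 2 * n * e * norm (w - z)"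
              by (intro mult_right_mono) auto
            then show ?thesis using n by (simp add: field_simps power2_eq_square)
          qed
          finally have "a + inner v (w - z) - e * norm (w - z) \<le> a + C * norm (z - x) - C * norm (w - x)"
            by (simp add: n_def)
          then have "ereal (a + inner v (w - z) - e * norm (w - z)) \<le> ereal (a + C * norm (z - x) - C * norm (w - x))"
            by simp
          then show ?thesis using * by (rule order_trans)
        qed
        then show "\<exists>d>0. \<forall>w. dist w z < d \<longrightarrow> ereal (a + inner v (w - z) - e * norm (w - z)) \<le> f w"
          using \<open>d > 0\<close> by blast
      qed (fact a)
      then have "norm v \<le> K"
        using bd[OF subsetD[OF sub z(1)]] regular_subdiff_subset_limiting[of f z] by auto
      moreover have "norm v = C" using n C by (simp add: v_def n_def)
      ultimately show False using C by simp
    qed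
    then show ?thesis using z a by (auto simp: g_def)
  qed
  show ?thesis
  proof
    show "C \<ge> 0" using C by simp
    show "\<bar>f x\<bar> \<noteq> \<infinity>" if "x \<in> cball x0 (\<rho>/4)" for x using main[OF that] by simp
    fix x z assume xz: "x \<in> cball x0 (\<rho>/4)" "z \<in> cball x0 (\<rho>/4)"
    then have "z \<in> cball x (\<rho>/2)" using dist_triangle[of x z x0] by (simp add: dist_commute)
    then have "f x \<le> f z + ereal (C * norm (z - x))" using main xz by blast
    then show "real_of_ereal (f x) \<le> real_of_ereal (f z) + C * norm (z - x)"
      using main[OF xz(1)] main[OF xz(2)] by (cases "f x"; cases "f z") auto
  qed
qed

text \<open>Subgradients with a quadratic error that is uniform over the ball, as opposed to the usual local
  definition of proximal subgradients.\<close>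

definition proximal_on :: "'a::euclidean_space set \<Rightarrow> ('a \<Rightarrow> real) \<Rightarrow> nat \<Rightarrow> ('a \<times> 'a) set" where
  "proximal_on S g L =
     {(u, v). \<forall>z\<in>S. g u + inner v (z - u) - real L * norm (z - u) ^ 2 \<le> g z}"

section \<open>Lipschitz functions on a ball: limiting subgradients as limits of proximal
  ones\<close>

locale finite_lipschitz_on_cball =
  fixes f :: "'a::euclidean_space \<Rightarrow> ereal" and g :: "'a \<Rightarrow> real" and x0 :: 'a and R C :: real
  assumes R_pos: "R > 0" and C_nonneg: "C \<ge> 0"
    and f_eq: "\<And>x. x \<in> cball x0 R \<Longrightarrow> f x = ereal (g x)"
    and lipschitz: "\<And>x z. x \<in> cball x0 R \<Longrightarrow> z \<in> cball x0 R \<Longrightarrow> g x \<le> g z + C * norm (z - x)"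
begin

lemma continuous_on_cball: "continuous_on (cball x0 R) g"
proof (rule lipschitz_on_continuous_on)
  show "C-lipschitz_on (cball x0 R) g"
  proof (rule lipschitz_onI)
    fix x z assume "x \<in> cball x0 R" "z \<in> cball x0 R"
    then have "g x \<le> g z + C * norm (z - x)" "g z \<le> g x + C * norm (x - z)"
      using lipschitz by auto
    then show "dist (g x) (g z) \<le> C * dist x z"
      by (simp add: dist_norm norm_minus_commute)
  qed (fact C_nonneg)
qed

lemma near_ball:
  assumes "u \<in> ball x0 R"
  obtains d where "d > 0" "\<And>z. dist z u < d \<Longrightarrow> z \<in> ball x0 R"
proof -
  obtain d where "d > 0" "ball u d \<subseteq> ball x0 R"
    using assms open_ball[of x0 R] openE by blast
  then have "z \<in> ball x0 R" if "dist z u < d" for z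
    using that by (metis dist_commute mem_ball subsetD)
  then show ?thesis using that \<open>d > 0\<close> by blast
qed

lemma proximal_imp_regular:
  assumes u: "u \<in> ball x0 R" and "(u, v) \<in> proximal_on (cball x0 R) g L"
  shows "v \<in> regular_subdiff f u"
proof (rule regular_subdiffI)
  show "f u = ereal (g u)" using u f_eq by simp
  fix e :: real assume "e > 0"
  obtain d where d: "d > 0" "\<And>z. dist z u < d \<Longrightarrow> z \<in> ball x0 R"
    using near_ball[OF u] by blast
  have "ereal (g u + inner v (z - u) - e * norm (z - u)) \<le> f z"
    if z: "dist z u < min d (e / (real L + 1))" for z
  proof -
    have zR: "z \<in> cball x0 R" using d(2)[of z] z by simp
    have "norm (z - u) * (real L + 1) \<le> e"
      using z by (simp add: dist_norm field_simps)
    then have "norm (z - u) * (real L * norm (z - u)) \<le> norm (z - u) * e"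
      by (intro mult_left_mono) (auto simp: algebra_simps intro: order_trans[rotated])
    then have "real L * norm (z - u) ^ 2 \<le> e * norm (z - u)"
      by (simp add: power2_eq_square algebra_simps)
    moreover have "g u + inner v (z - u) - real L * norm (z - u) ^ 2 \<le> g z"
      using assms(2) zR unfolding proximal_on_def by simp
    ultimately show ?thesis using f_eq[OF zR] by simp
  qed
  then show "\<exists>d>0. \<forall>z. dist z u < d \<longrightarrow> ereal (g u + inner v (z - u) - e * norm (z - u)) \<le> f z"
    using d(1) \<open>e > 0\<close> by (intro exI[of _ "min d (e / (real L + 1))"]) simp
qed

text \<open>A nonvertical normal can be divided by \<open>b\<close>, and by the Lipschitz property
  distances along the graph of \<open>g\<close> are comparable with horizontal ones, so the cone
  inequality becomes one for \<open>g\<close>.\<close>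

lemma regular_normal_imp_subgradient:
  assumes u: "u \<in> ball x0 R" and n: "(a, - b) \<in> regular_normal_cone (u, \<alpha>) (epi f)"
    and "b > 0" "e > 0"
  shows "\<exists>d>0. \<forall>z. dist z u < d \<longrightarrow> g u + inner (a /\<^sub>R b) (z - u) - e * norm (z - u) \<le> g z"
proof -
  have fu: "f u = ereal (g u)" using u f_eq by simp
  have "(u, \<alpha>) \<in> epi f" using n by (simp add: regular_normal_cone_iff)
  then have le: "g u \<le> \<alpha>" by (simp add: epi_def fu)
  \<comment> \<open>Strictly above the graph one can move straight down by \<open>s\<close> inside
    the epigraph, where the pairing with the normal is \<open>b * s\<close>; a regular normal
    forbids such linear growth.\<close>
  have \<alpha>: "\<alpha> = g u"
  proof (rule ccontr)
    assume "\<alpha> \<noteq> g u"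
    then have lt: "g u < \<alpha>" using le by simp
    obtain d where d: "d > 0" "\<forall>w\<in>epi f. dist w (u, \<alpha>) < d \<longrightarrow>
        inner (a, - b) (w - (u, \<alpha>)) \<le> b/2 * norm (w - (u, \<alpha>))"
      using n \<open>b > 0\<close> unfolding regular_normal_cone_iff by (meson half_gt_zero)
    define s where "s = min (d/2) (\<alpha> - g u)"
    have s: "s > 0" "s < d" "g u \<le> \<alpha> - s" using d(1) lt by (auto simp: s_def)
    have "(u, \<alpha> - s) \<in> epi f" using s by (simp add: epi_def fu)
    moreover have "dist (u, \<alpha> - s) (u, \<alpha>) < d" using s by (simp add: dist_Pair_Pair dist_real_def)
    ultimately have "inner (a, - b) ((u, \<alpha> - s) - (u, \<alpha>)) \<le> b/2 * norm ((u, \<alpha> - s) - (u, \<alpha>))"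
      using d(2) by blast
    then have "b * s \<le> b / 2 * s" using s by (simp add: norm_Pair)
    then show False using s \<open>b > 0\<close> by simp
  qed
  \<comment> \<open>The factor \<open>b\<close> anticipates the normalisation, and
    \<open>1 + C\<close> compares a distance along the graph with the horizontal one.\<close>
  define e' where "e' = e * b / (1 + C)"
  have "e' > 0" using \<open>b > 0\<close> \<open>e > 0\<close> C_nonneg by (simp add: e'_def)
  then obtain d where d: "d > 0" "\<forall>w\<in>epi f. dist w (u, \<alpha>) < d \<longrightarrow>
        inner (a, - b) (w - (u, \<alpha>)) \<le> e' * norm (w - (u, \<alpha>))"
    using n unfolding regular_normal_cone_iff by blast
  obtain d' where d': "d' > 0" "\<And>z. dist z u < d' \<Longrightarrow> z \<in> ball x0 R"
    using near_ball[OF u] by blast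
  have "g u + inner (a /\<^sub>R b) (z - u) - e * norm (z - u) \<le> g z"
    if z: "dist z u < min d' (d / (1 + C))" for z
  proof -
    have zR: "z \<in> cball x0 R" using d'(2)[of z] z by simp
    have uR: "u \<in> cball x0 R" using u by simp
    have "\<bar>g z - g u\<bar> \<le> C * norm (z - u)"
      using lipschitz[OF zR uR] lipschitz[OF uR zR] by (simp add: norm_minus_commute abs_le_iff)
    then have "norm (z - u, g z - g u) \<le> norm (z - u) + C * norm (z - u)"
      using norm_Pair_le[of "z - u" "g z - g u"] by simp
    then have n1: "norm ((z, g z) - (u, \<alpha>)) \<le> (1 + C) * norm (z - u)"
      by (simp add: \<alpha> algebra_simps)
    also have "\<dots> < d" using z C_nonneg by (simp add: dist_norm field_simps)
    finally have "dist (z, g z) (u, \<alpha>) < d" by (simp only: dist_norm)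
    moreover have "(z, g z) \<in> epi f" by (simp add: epi_def f_eq[OF zR])
    ultimately have "inner (a, - b) ((z, g z) - (u, \<alpha>)) \<le> e' * norm ((z, g z) - (u, \<alpha>))"
      using d(2) by blast
    also have "\<dots> \<le> e' * ((1 + C) * norm (z - u))"
      using n1 \<open>e' > 0\<close> by (intro mult_left_mono) auto
    also have "\<dots> = b * (e * norm (z - u))" using C_nonneg by (simp add: e'_def)
    finally have "inner a (z - u) \<le> b * (g z - g u + e * norm (z - u))"
      by (simp add: \<alpha> algebra_simps)
    then have "inner a (z - u) / b \<le> g z - g u + e * norm (z - u)"
      using \<open>b > 0\<close> by (simp add: pos_divide_le_eq mult.commute)
    then show ?thesis by (simp add: divide_inverse mult.commute)
  qed
  then show ?thesis
    using d(1) d'(1) C_nonneg by (intro exI[of _ "min d' (d / (1 + C))"]) simp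
qed

text \<open>The proximal subgradient comes from a minimiser of \<open>g z - inner v z + L * norm (z - u) ^ 2\<close>,
  which lies within distance \<open>e / L\<close> of \<open>u\<close> once \<open>L\<close> is large.\<close>

lemma subgradient_approx_proximal:
  assumes u: "u \<in> ball x0 R"
    and sub: "\<And>e. e > 0 \<Longrightarrow> \<exists>d>0. \<forall>z. dist z u < d \<longrightarrow> g u + inner v (z - u) - e * norm (z - u) \<le> g z"
    and "e > 0"
  shows "\<exists>u' v' L. dist u' u < e \<and> dist v' v < e \<and> (u', v') \<in> proximal_on (cball x0 R) g L"
proof -
  have uR: "u \<in> cball x0 R" using u by simp
  obtain d where d: "d > 0" "\<And>z. dist z u < d \<Longrightarrow> g u + inner v (z - u) - e/4 * norm (z - u) \<le> g z"
    using sub[of "e/4"] \<open>e > 0\<close> by auto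
  define B where "B = C + norm v"
  have "B \<ge> 0" using C_nonneg by (simp add: B_def)
  \<comment> \<open>Comparing \<open>w\<close> below with \<open>u\<close> gives
    \<open>norm (w - u) \<le> B / L\<close>, since \<open>B\<close> is a Lipschitz constant of
    \<open>g z - inner v (z - u)\<close>. This \<open>L\<close> puts \<open>w\<close> within
    \<open>min d e\<close> of \<open>u\<close>, where the sharper inequality \<open>sub\<close>
    applies.\<close>
  obtain L :: nat where L: "real L > B / min d e + 1" using reals_Archimedean2 by blast
  have Lpos: "real L > 0" using L \<open>B \<ge> 0\<close> d(1) \<open>e > 0\<close>
    by (smt (verit) divide_nonneg_pos min_def)
  have "B < real L * min d e"
    using L d(1) \<open>e > 0\<close> by (smt (verit) min_def pos_divide_less_eq)
  define h where "h z = g z - inner v (z - u) + real L * norm (z - u) ^ 2" for z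
  have "continuous_on (cball x0 R) h"
    unfolding h_def by (intro continuous_intros continuous_on_cball)
  then have "\<exists>w\<in>cball x0 R. \<forall>z\<in>cball x0 R. h w \<le> h z"
    using R_pos by (intro continuous_attains_inf) auto
  then obtain w where w: "w \<in> cball x0 R" "\<And>z. z \<in> cball x0 R \<Longrightarrow> h w \<le> h z"
    by blast
  define n where "n = norm (w - u)"
  have hw: "real L * n ^ 2 \<le> g u - g w + inner v (w - u)"
    using w(2)[OF uR] by (simp add: h_def n_def)
  also have "\<dots> \<le> C * n + norm v * n"
    using lipschitz[OF uR w(1)] norm_cauchy_schwarz[of v "w - u"] by (simp add: n_def)
  finally have "(real L * n) * n \<le> B * n" by (simp add: B_def algebra_simps power2_eq_square)
  then have "real L * n \<le> B"
    using \<open>B \<ge> 0\<close> by (cases "n = 0") (auto simp: n_def)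
  then have "real L * n < real L * min d e" using \<open>B < real L * min d e\<close> by simp
  then have nde: "n < min d e" using Lpos by simp
  then have "g u + inner v (w - u) - e/4 * n \<le> g w"
    using d(2)[of w] by (simp add: dist_norm n_def)
  \<comment> \<open>The subgradient inequality replaces the crude constant \<open>B\<close> by
    \<open>e/4\<close>, so the shift \<open>2 * L * norm (w - u)\<close> of \<open>v\<close> is at
    most \<open>e / 2\<close>.\<close>
  then have "(real L * n) * n \<le> e/4 * n" using hw by (simp add: power2_eq_square algebra_simps)
  then have Ln: "real L * n \<le> e/4"
    using \<open>e > 0\<close> by (cases "n = 0") (auto simp: n_def)
  \<comment> \<open>The gradient at \<open>w\<close> of
    \<open>inner v (z - u) - L * norm (z - u) ^ 2\<close>. Expanding the square around
    \<open>w\<close> turns minimality into the proximal inequality with the same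
    \<open>L\<close>.\<close>
  define v' where "v' = v - (2 * real L) *\<^sub>R (w - u)"
  have "dist v' v = 2 * (real L * n)" by (simp add: v'_def dist_norm n_def)
  then have "dist v' v < e" using Ln \<open>e > 0\<close> by simp
  moreover have "dist w u < e" using nde by (simp add: dist_norm n_def)
  moreover have "(w, v') \<in> proximal_on (cball x0 R) g L"
  proof -
    have "g w + inner v' (z - w) - real L * norm (z - w) ^ 2 \<le> g z" if "z \<in> cball x0 R" for z
    proof -
      have "z - u = (z - w) + (w - u)" by simp
      then have "norm (z - u) ^ 2 = norm (z - w) ^ 2 + 2 * inner (w - u) (z - w) + norm (w - u) ^ 2"
        by (simp only: power2_norm_eq_inner inner_add) (simp add: inner_commute)
      moreover have "inner v (z - u) = inner v (z - w) + inner v (w - u)"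
        by (simp add: inner_diff_right)
      moreover have "g w - inner v (w - u) + real L * norm (w - u) ^ 2
          \<le> g z - inner v (z - u) + real L * norm (z - u) ^ 2"
        using w(2)[OF that] by (simp add: h_def)
      moreover have "inner v' (z - w) = inner v (z - w) - real L * (2 * inner (w - u) (z - w))"
        by (simp add: v'_def inner_diff_left)
      ultimately show ?thesis
        by (simp only: distrib_left)
    qed
    then show ?thesis by (simp add: proximal_on_def)
  qed
  ultimately show ?thesis by blast
qed

text \<open>By continuity the function values converge with the points, and normals near
  \<open>(v, -1)\<close> are nonvertical, so nothing but the pairs has to be approximated. The
  right-hand side is stable under limits and rests on inequalities over a fixed ball; closedness and
  measurability of the graph come from this.\<close>

lemma limiting_subdiff_iff:
  assumes u: "u \<in> ball x0 R"
  shows "v \<in> limiting_subdiff f u \<longleftrightarrow>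
    (\<forall>e>0. \<exists>u' v' L. dist u' u < e \<and> dist v' v < e \<and> (u', v') \<in> proximal_on (cball x0 R) g L)"
    (is "?L \<longleftrightarrow> ?R")
proof
  have fu: "f u = ereal (g u)" using u f_eq by simp
  assume ?L
  then have "(v, -1) \<in> limiting_normal_cone (u, g u) (epi f)"
    by (simp add: limiting_subdiff_def fu)
  then obtain z w where zw: "z \<longlonglongrightarrow> (u, g u)" "w \<longlonglongrightarrow> (v, -1)"
    "\<And>k::nat. w k \<in> regular_normal_cone (z k) (epi f)"
    unfolding limiting_normal_cone_def by blast
  have z1: "(\<lambda>k. fst (z k)) \<longlonglongrightarrow> u" using tendsto_fst[OF zw(1)] by simp
  have w1: "(\<lambda>k. fst (w k)) \<longlonglongrightarrow> v" "(\<lambda>k. snd (w k)) \<longlonglongrightarrow> -1"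
    using tendsto_fst[OF zw(2)] tendsto_snd[OF zw(2)] by auto
  \<comment> \<open>Dividing by minus the last coordinate, which tends to \<open>1\<close>,
    normalises the normals without changing the limit.\<close>
  have "(\<lambda>k. fst (w k) /\<^sub>R (- snd (w k))) \<longlonglongrightarrow> v /\<^sub>R (- (-1))"
    by (intro tendsto_intros w1) simp
  then have q: "(\<lambda>k. fst (w k) /\<^sub>R (- snd (w k))) \<longlonglongrightarrow> v" by simp
  show ?R
  proof (intro allI impI)
    fix e :: real assume "e > 0"
    have "\<forall>\<^sub>F k in sequentially. dist (fst (z k)) u < e/2 \<and> fst (z k) \<in> ball x0 R \<and>
        dist (fst (w k) /\<^sub>R (- snd (w k))) v < e/2 \<and> snd (w k) < 0"
      by (intro eventually_conj tendstoD[OF z1] tendstoD[OF q] topological_tendstoD[OF z1 open_ball u]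
          order_tendstoD(2)[OF w1(2)]) (use \<open>e > 0\<close> in auto)
    then obtain k where k: "dist (fst (z k)) u < e/2" "fst (z k) \<in> ball x0 R"
        "dist (fst (w k) /\<^sub>R (- snd (w k))) v < e/2" "snd (w k) < 0"
      by (auto dest: eventually_happens)
    have "(fst (w k), - (- snd (w k))) \<in> regular_normal_cone (fst (z k), snd (z k)) (epi f)"
      using zw(3)[of k] by simp
    then have "\<exists>d>0. \<forall>y. dist y (fst (z k)) < d \<longrightarrow> g (fst (z k)) +
        inner (fst (w k) /\<^sub>R (- snd (w k))) (y - fst (z k)) - c * norm (y - fst (z k)) \<le> g y" if "c > 0" for c
      using k(4) by (intro regular_normal_imp_subgradient[OF k(2) _ _ that, of _ _ "snd (z k)"]) simp_all
    from subgradient_approx_proximal[OF k(2) this]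
    obtain u' v' L where "dist u' (fst (z k)) < e/2" "dist v' (fst (w k) /\<^sub>R (- snd (w k))) < e/2"
      "(u', v') \<in> proximal_on (cball x0 R) g L"
      using \<open>e > 0\<close> half_gt_zero by metis
    moreover from this have "dist u' u < e" "dist v' v < e"
      using k(1,3) dist_triangle_half_l[of _ u' e u] dist_triangle[of u' u "fst (z k)"]
        dist_triangle[of v' v "fst (w k) /\<^sub>R (- snd (w k))"] by linarith+
    ultimately show "\<exists>u' v' L. dist u' u < e \<and> dist v' v < e \<and> (u', v') \<in> proximal_on (cball x0 R) g L"
      by blast
  qed
next
  have fu: "f u = ereal (g u)" using u f_eq by simp
  assume R: ?R
  obtain d where d: "d > 0" "\<And>z. dist z u < d \<Longrightarrow> z \<in> ball x0 R"
    using near_ball[OF u] by blast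
  have "\<exists>u' v'. dist u' u < min d (inverse (Suc k)) \<and> dist v' v < inverse (Suc k) \<and> v' \<in> regular_subdiff f u'"
    for k
  proof -
    have "min d (inverse (Suc k)) > 0" using d(1) by simp
    then obtain u' v' L where "dist u' u < min d (inverse (Suc k))" "dist v' v < min d (inverse (Suc k))"
      "(u', v') \<in> proximal_on (cball x0 R) g L"
      using R by blast
    moreover have "u' \<in> ball x0 R" using d(2)[of u'] calculation(1) by simp
    ultimately show ?thesis using proximal_imp_regular by fastforce
  qed
  then obtain a b where ab: "\<And>k. dist (a k) u < min d (inverse (Suc k))"
    "\<And>k. dist (b k) v < inverse (Suc k)" "\<And>k. b k \<in> regular_subdiff f (a k)"
    by metis
  have a_ball: "a k \<in> ball x0 R" for k using d(2) ab(1)[of k] by simp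
  have a: "a \<longlonglongrightarrow> u"
    by (rule metric_tendsto_imp_tendsto[OF LIMSEQ_inverse_real_of_nat])
      (use ab(1) in \<open>auto simp: dist_real_def intro!: always_eventually less_imp_le\<close>)
  have b: "b \<longlonglongrightarrow> v"
    by (rule metric_tendsto_imp_tendsto[OF LIMSEQ_inverse_real_of_nat])
      (use ab(2) in \<open>auto simp: dist_real_def intro!: always_eventually less_imp_le\<close>)
  have "(\<lambda>k. g (a k)) \<longlonglongrightarrow> g u"
    using continuous_on_tendsto_compose[OF continuous_on_cball a] a_ball u
    by (auto intro: less_imp_le always_eventually)
  then have "(\<lambda>k. (a k, g (a k))) \<longlonglongrightarrow> (u, g u)" "(\<lambda>k. (b k, -1::real)) \<longlonglongrightarrow> (v, -1)"
    by (auto intro!: tendsto_intros a b)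
  moreover have "(b k, -1) \<in> regular_normal_cone (a k, g (a k)) (epi f)" for k
    using ab(3)[of k] f_eq[of "a k"] a_ball[of k] by (simp add: regular_subdiff_def)
  ultimately have "(v, -1) \<in> limiting_normal_cone (u, g u) (epi f)"
    unfolding limiting_normal_cone_def by blast
  then show ?L by (simp add: limiting_subdiff_def fu)
qed

text \<open>Approximability by proximal pairs is a closed condition. Halving the radius keeps limit
  points in the open ball where it characterises the subdifferential.\<close>

lemma closed_subdiff_graph: "closed {(u, v). u \<in> cball x0 (R/2) \<and> v \<in> limiting_subdiff f u}"
  unfolding closed_sequential_limits
proof (intro allI impI, elim conjE)
  fix p :: "nat \<Rightarrow> 'a \<times> 'a" and l
  assume p: "\<forall>n. p n \<in> {(u, v). u \<in> cball x0 (R/2) \<and> v \<in> limiting_subdiff f u}" and l: "p \<longlonglongrightarrow> l"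
  have p_in: "fst (p n) \<in> cball x0 (R/2)" "snd (p n) \<in> limiting_subdiff f (fst (p n))" for n
    using p[rule_format, of n] by (auto simp: case_prod_beta)
  have l_in: "fst l \<in> cball x0 (R/2)"
    using closed_sequentially[OF closed_cball p_in(1) tendsto_fst[OF l]] .
  have ball: "u \<in> ball x0 R" if "u \<in> cball x0 (R/2)" for u using that R_pos by simp
  have "snd l \<in> limiting_subdiff f (fst l)"
    unfolding limiting_subdiff_iff[OF ball[OF l_in]]
  proof (intro allI impI)
    fix e :: real assume e: "e > 0"
    then have "e / 2 > 0" by simp
    from eventually_happens'[OF sequentially_bot tendstoD[OF l this]]
    obtain n where n: "dist (p n) l < e / 2" by blast
    obtain u' v' L where *: "dist u' (fst (p n)) < e / 2" "dist v' (snd (p n)) < e / 2"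
      "(u', v') \<in> proximal_on (cball x0 R) g L"
      using p_in(2)[of n] \<open>e / 2 > 0\<close> unfolding limiting_subdiff_iff[OF ball[OF p_in(1)[of n]]] by blast
    have "dist u' (fst l) < e" "dist v' (snd l) < e"
      using * n dist_fst_le[of "p n" l] dist_snd_le[of "p n" l]
        dist_triangle[of u' "fst l" "fst (p n)"] dist_triangle[of v' "snd l" "snd (p n)"] by linarith+
    then show "\<exists>u' v' L. dist u' (fst l) < e \<and> dist v' (snd l) < e \<and> (u', v') \<in> proximal_on (cball x0 R) g L"
      using *(3) by blast
  qed
  then show "l \<in> {(u, v). u \<in> cball x0 (R/2) \<and> v \<in> limiting_subdiff f u}"
    using l_in by (simp add: case_prod_beta)
qed

end

subsection \<open>Measurable multifunctions\<close>

text \<open>Hits of closed sets rather than open ones are required; this strong form passes at once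
  to intersections with closed sets. Empty values are allowed.\<close>

definition measurable_multi :: "'t measure \<Rightarrow> ('t \<Rightarrow> 'b::topological_space set) \<Rightarrow> bool" where
  "measurable_multi M K \<longleftrightarrow> (\<forall>C. closed C \<longrightarrow> {t \<in> space M. K t \<inter> C \<noteq> {}} \<in> sets M)"

definition caratheodory :: "'t measure \<Rightarrow> ('t \<Rightarrow> 'b::topological_space \<Rightarrow> real) \<Rightarrow> bool" where
  "caratheodory M F \<longleftrightarrow> (\<forall>t\<in>space M. continuous_on UNIV (F t)) \<and> (\<forall>z. (\<lambda>t. F t z) \<in> borel_measurable M)"

lemma measurable_multiD: "measurable_multi M K \<Longrightarrow> closed C \<Longrightarrow> {t \<in> space M. K t \<inter> C \<noteq> {}} \<in> sets M"
  by (simp add: measurable_multi_def)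

lemma measurable_multi_const: "measurable_multi M (\<lambda>_. S)"
  by (simp add: measurable_multi_def)

lemma measurable_multi_Int_closed:
  "measurable_multi M K \<Longrightarrow> closed S \<Longrightarrow> measurable_multi M (\<lambda>t. K t \<inter> S)"
  by (simp add: measurable_multi_def Int_assoc closed_Int)

lemma measurable_multi_if:
  assumes A: "A \<in> sets M" and K: "measurable_multi M K" "measurable_multi M K'"
  shows "measurable_multi M (\<lambda>t. if t \<in> A then K t else K' t)"
  unfolding measurable_multi_def
proof (intro allI impI)
  fix C :: "'b set" assume C: "closed C"
  have "{t \<in> space M. (if t \<in> A then K t else K' t) \<inter> C \<noteq> {}} =
      (A \<inter> {t \<in> space M. K t \<inter> C \<noteq> {}}) \<union> ({t \<in> space M. K' t \<inter> C \<noteq> {}} - A)"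
    using sets.sets_into_space[OF A] by auto
  also have "\<dots> \<in> sets M"
    using A measurable_multiD[OF K(1) C] measurable_multiD[OF K(2) C] by auto
  finally show "{t \<in> space M. (if t \<in> A then K t else K' t) \<inter> C \<noteq> {}} \<in> sets M" .
qed

lemma measurable_multi_of_compact:
  fixes K :: "'t \<Rightarrow> 'b::euclidean_space set"
  assumes "\<And>C. compact C \<Longrightarrow> {t \<in> space M. K t \<inter> C \<noteq> {}} \<in> sets M"
  shows "measurable_multi M K"
  unfolding measurable_multi_def
proof (intro allI impI)
  fix C :: "'b set" assume C: "closed C"
  have "\<exists>n. z \<in> cball 0 (real n)" for z :: 'b
    using real_arch_simple[of "norm z"] by simp
  then have "{t \<in> space M. K t \<inter> C \<noteq> {}} = (\<Union>n. {t \<in> space M. K t \<inter> (C \<inter> cball 0 (real n)) \<noteq> {}})"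
    by blast
  also have "\<dots> \<in> sets M"
    by (intro sets.countable_UN image_subsetI assms closed_Int_compact C compact_cball)
  finally show "{t \<in> space M. K t \<inter> C \<noteq> {}} \<in> sets M" .
qed

lemma caratheodory_diff:
  assumes "caratheodory M F" "m \<in> borel_measurable M"
  shows "caratheodory M (\<lambda>t z. F t z - m t)"
  using assms by (auto simp: caratheodory_def intro!: borel_measurable_diff continuous_on_diff continuous_on_const)

text \<open>A strict inequality at \<open>z\<close> persists, with a margin, on a small ball around
  a point \<open>q\<close> of a countable dense set. This separates the condition into a hit of a
  closed ball by \<open>K t\<close> and countably many conditions on \<open>F\<close>.\<close>

lemma sets_exists_less:
  fixes K :: "'t \<Rightarrow> 'b::euclidean_space set"
  assumes K: "measurable_multi M K" and F: "caratheodory M F"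
  shows "{t \<in> space M. \<exists>z\<in>K t. F t z < 0} \<in> sets M"
proof -
  obtain Q :: "'b set" where Q: "countable Q" "\<And>S. open S \<Longrightarrow> S \<noteq> {} \<Longrightarrow> \<exists>q\<in>Q. q \<in> S"
    using countable_dense_exists by blast
  have F_cont: "continuous_on UNIV (F t)" if "t \<in> space M" for t
    using F that by (simp add: caratheodory_def)
  have F_meas: "(\<lambda>t. F t z) \<in> borel_measurable M" for z
    using F by (simp add: caratheodory_def)
  define r where "r n = 1 / real (Suc n)" for n
  have r_pos: "r n > 0" for n by (simp add: r_def)
  define W where "W q n m = {t \<in> space M. K t \<inter> cball q (r n) \<noteq> {}} \<inter>
     {t \<in> space M. \<forall>z\<in>Q \<inter> ball q (r n). F t z \<le> - r m}" for q n m
  have "{t \<in> space M. \<exists>z\<in>K t. F t z < 0} = (\<Union>q\<in>Q. \<Union>n. \<Union>m. W q n m)"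
  proof (intro set_eqI iffI)
    fix t assume "t \<in> {t \<in> space M. \<exists>z\<in>K t. F t z < 0}"
    then obtain z where t: "t \<in> space M" and z: "z \<in> K t" "F t z < 0" by blast
    obtain m where m: "r m < - F t z"
      using reals_Archimedean[of "- F t z"] z(2) by (auto simp: r_def inverse_eq_divide)
    have "isCont (F t) z" using F_cont[OF t] by (simp add: continuous_on_eq_continuous_at)
    then have "\<forall>\<^sub>F y in nhds z. F t y < - r m"
      using m by (intro order_tendstoD) (auto simp: isCont_def tendsto_at_iff_tendsto_nhds)
    then obtain d where d: "d > 0" "\<And>y. dist y z < d \<Longrightarrow> F t y < - r m"
      unfolding eventually_nhds_metric by blast
    obtain n where n: "r n < d / 2"
      using reals_Archimedean[of "d/2"] d(1) by (auto simp: r_def inverse_eq_divide)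
    obtain q where q: "q \<in> Q" "q \<in> ball z (r n)"
      using Q(2)[OF open_ball, of z "r n"] r_pos[of n] by (auto simp del: mem_ball)
    have "F t y \<le> - r m" if "y \<in> ball q (r n)" for y
    proof -
      have "dist y z \<le> dist q y + dist z q" by (metis dist_commute dist_triangle3)
      also have "\<dots> < d" using that q(2) n by simp
      finally show ?thesis using d(2)[of y] by simp
    qed
    moreover have "z \<in> cball q (r n)" using q(2) by (simp add: dist_commute)
    ultimately have "t \<in> W q n m" using t z(1) unfolding W_def by blast
    then show "t \<in> (\<Union>q\<in>Q. \<Union>n. \<Union>m. W q n m)" using q(1) by blast
  next
    fix t assume "t \<in> (\<Union>q\<in>Q. \<Union>n. \<Union>m. W q n m)"
    then obtain q n m where t: "t \<in> space M" and ne: "K t \<inter> cball q (r n) \<noteq> {}"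
      and le: "\<And>z. z \<in> Q \<inter> ball q (r n) \<Longrightarrow> F t z \<le> - r m"
      unfolding W_def by blast
    then obtain z where z: "z \<in> K t" "z \<in> cball q (r n)" by blast
    \<comment> \<open>The point \<open>z\<close> of \<open>K t\<close> need not belong to
      \<open>Q\<close>; by density and continuity the bound extends from
      \<open>Q \<inter> ball q (r n)\<close> to the closed ball containing \<open>z\<close>.\<close>
    have "F t z \<le> - r m"
    proof (rule continuous_le_on_closure[of "Q \<inter> ball q (r n)" "F t"])
      show "continuous_on (closure (Q \<inter> ball q (r n))) (F t)"
        using F_cont[OF t] continuous_on_subset by blast
      have "closure (Q \<inter> ball q (r n)) = closure (ball q (r n))"
      proof (rule closure_unique)
        fix T assume T: "Q \<inter> ball q (r n) \<subseteq> T" "closed T"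
        have "ball q (r n) - T = {}"
        proof (rule ccontr)
          assume "ball q (r n) - T \<noteq> {}"
          then show False using Q(2)[of "ball q (r n) - T"] T open_Diff[OF open_ball T(2)] by blast
        qed
        then show "closure (ball q (r n)) \<subseteq> T" using T(2) by (simp add: closure_minimal)
      qed (use closure_subset[of "ball q (r n)"] in auto)
      then show "z \<in> closure (Q \<inter> ball q (r n))" using z(2) r_pos[of n] by simp
    qed (use le in auto)
    then show "t \<in> {t \<in> space M. \<exists>z\<in>K t. F t z < 0}"
      using t z(1) r_pos[of m] by (auto intro!: bexI[of _ z])
  qed
  also have "\<dots> \<in> sets M"
  proof (intro sets.countable_UN' Q(1) sets.countable_UN image_subsetI)
    fix q n m
    have "countable (Q \<inter> ball q (r n))" using Q(1) by (rule countable_Int1)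
    moreover have "{t \<in> space M. - r m < F t z} \<in> sets M" for z
      using F_meas[of z] by simp
    ultimately have "space M - (\<Union>z\<in>Q \<inter> ball q (r n). {t \<in> space M. - r m < F t z}) \<in> sets M"
      by (intro sets.Diff sets.top sets.countable_UN' image_subsetI)
    also have "space M - (\<Union>z\<in>Q \<inter> ball q (r n). {t \<in> space M. - r m < F t z}) =
        {t \<in> space M. \<forall>z\<in>Q \<inter> ball q (r n). F t z \<le> - r m}"
      by (auto simp del: mem_ball) force
    finally show "W q n m \<in> sets M"
      unfolding W_def using measurable_multiD[OF K closed_cball] by blast
  qed auto
  finally show ?thesis .
qed

text \<open>On the compact set \<open>K t \<inter> C\<close> the minimum is attained, so
  \<open>F t z \<le> 0\<close> is solvable as soon as all strict inequalities
  \<open>F t z < 1 / Suc n\<close> are.\<close>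

lemma measurable_multi_sublevel:
  fixes K :: "'t \<Rightarrow> 'b::euclidean_space set"
  assumes K: "measurable_multi M K" "\<And>t. t \<in> space M \<Longrightarrow> compact (K t)" and F: "caratheodory M F"
  shows "measurable_multi M (\<lambda>t. {z \<in> K t. F t z \<le> 0})"
  unfolding measurable_multi_def
proof (intro allI impI)
  fix C :: "'b set" assume C: "closed C"
  have F_cont: "continuous_on S (F t)" if "t \<in> space M" for t S
    using F that continuous_on_subset by (auto simp: caratheodory_def)
  have "{t \<in> space M. {z \<in> K t. F t z \<le> 0} \<inter> C \<noteq> {}} =
     (\<Inter>n. {t \<in> space M. \<exists>z\<in>K t \<inter> C. F t z - 1 / Suc n < 0})"
  proof (intro set_eqI iffI)
    fix t assume "t \<in> (\<Inter>n. {t \<in> space M. \<exists>z\<in>K t \<inter> C. F t z - 1 / Suc n < 0})"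
    then have t: "t \<in> space M" and ex: "\<And>n. \<exists>z\<in>K t \<inter> C. F t z - 1 / Suc n < 0" by auto
    have "compact (K t \<inter> C)" using K(2)[OF t] C by (rule compact_Int_closed)
    moreover have "K t \<inter> C \<noteq> {}" using ex by blast
    ultimately have "\<exists>z\<in>K t \<inter> C. \<forall>y\<in>K t \<inter> C. F t z \<le> F t y"
      using continuous_attains_inf F_cont[OF t] by blast
    then obtain z where z: "z \<in> K t \<inter> C" "\<And>y. y \<in> K t \<inter> C \<Longrightarrow> F t z \<le> F t y"
      by blast
    have "F t z \<le> 1 / Suc n" for n using ex[of n] z(2) by fastforce
    then have "F t z \<le> 0"
      by (intro LIMSEQ_le_const[OF LIMSEQ_inverse_real_of_nat]) (auto simp: inverse_eq_divide)
    then show "t \<in> {t \<in> space M. {z \<in> K t. F t z \<le> 0} \<inter> C \<noteq> {}}" using z(1) t by blast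
  next
    fix t assume "t \<in> {t \<in> space M. {z \<in> K t. F t z \<le> 0} \<inter> C \<noteq> {}}"
    then obtain z where z: "t \<in> space M" "z \<in> K t" "z \<in> C" "F t z \<le> 0" by blast
    then have "F t z - 1 / Suc n < 0" for n
      using divide_pos_pos[of 1 "real (Suc n)"] by linarith
    then show "t \<in> (\<Inter>n. {t \<in> space M. \<exists>z\<in>K t \<inter> C. F t z - 1 / Suc n < 0})"
      using z by blast
  qed
  also have "\<dots> \<in> sets M"
  proof (intro sets.countable_INT image_subsetI)
    fix n :: nat
    have "caratheodory M (\<lambda>t z. F t z - 1 / Suc n)"
      by (intro caratheodory_diff F borel_measurable_const)
    then show "{t \<in> space M. \<exists>z\<in>K t \<inter> C. F t z - 1 / Suc n < 0} \<in> sets M"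
      by (intro sets_exists_less measurable_multi_Int_closed K(1) C)
  qed auto
  finally show "{t \<in> space M. {z \<in> K t. F t z \<le> 0} \<inter> C \<noteq> {}} \<in> sets M" .
qed

lemma compact_sublevel:
  assumes "compact (K :: 'b::euclidean_space set)" "continuous_on UNIV (f :: 'b \<Rightarrow> real)"
  shows "compact {z \<in> K. f z \<le> 0}"
proof -
  have "closed {z. f z \<le> 0}" using assms(2) by (intro closed_Collect_le) auto
  then have "compact (K \<inter> {z. f z \<le> 0})" using assms(1) by (intro compact_Int_closed)
  also have "K \<inter> {z. f z \<le> 0} = {z \<in> K. f z \<le> 0}" by blast
  finally show ?thesis .
qed

text \<open>Uniformity in the countably many constraints comes from the finite intersection property.\<close>

lemma measurable_multi_countable_sublevel:
  fixes K :: "'t \<Rightarrow> 'b::euclidean_space set" and F :: "nat \<Rightarrow> 't \<Rightarrow> 'b \<Rightarrow> real"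
  assumes K: "measurable_multi M K" "\<And>t. t \<in> space M \<Longrightarrow> compact (K t)"
    and F: "\<And>i. caratheodory M (F i)"
  shows "measurable_multi M (\<lambda>t. {z \<in> K t. \<forall>i. F i t z \<le> 0})"
proof -
  define L where "L n t = {z \<in> K t. \<forall>i<n. F i t z \<le> 0}" for n t
  have F_cont: "continuous_on UNIV (F i t)" if "t \<in> space M" for t i
    using F that by (auto simp: caratheodory_def)
  have L_Suc: "L (Suc n) t = {z \<in> L n t. F n t z \<le> 0}" for n t
    by (auto simp: L_def less_Suc_eq)
  have L: "measurable_multi M (L n) \<and> (\<forall>t\<in>space M. compact (L n t))" for n
  proof (induction n)
    case 0
    then show ?case using K by (simp add: L_def)
  next
    case (Suc n)
    have "measurable_multi M (\<lambda>t. L (Suc n) t)"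
      unfolding L_Suc using Suc F by (intro measurable_multi_sublevel) auto
    moreover have "compact (L (Suc n) t)" if "t \<in> space M" for t
      unfolding L_Suc using Suc F_cont that by (intro compact_sublevel) auto
    ultimately show ?case by blast
  qed
  show ?thesis
    unfolding measurable_multi_def
  proof (intro allI impI)
    fix C :: "'b set" assume C: "closed C"
    have "{z \<in> K t. \<forall>i. F i t z \<le> 0} \<inter> C \<noteq> {} \<longleftrightarrow> (\<forall>n. L n t \<inter> C \<noteq> {})" if t: "t \<in> space M" for t
    proof
      assume ne: "\<forall>n. L n t \<inter> C \<noteq> {}"
      have "\<Inter> (range (\<lambda>n. L n t \<inter> C)) \<noteq> {}"
      proof (rule compact_nest)
        show "compact (L n t \<inter> C)" for n using L t C by (intro compact_Int_closed) auto
        show "L n t \<inter> C \<subseteq> L m t \<inter> C" if "m \<le> n" for m n using that by (auto simp: L_def)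
      qed (use ne in auto)
      moreover have "\<Inter> (range (\<lambda>n. L n t \<inter> C)) \<subseteq> {z \<in> K t. \<forall>i. F i t z \<le> 0} \<inter> C"
        unfolding L_def by blast
      ultimately show "{z \<in> K t. \<forall>i. F i t z \<le> 0} \<inter> C \<noteq> {}" by blast
    qed (auto simp: L_def)
    then have "{t \<in> space M. {z \<in> K t. \<forall>i. F i t z \<le> 0} \<inter> C \<noteq> {}} =
        {t \<in> space M. \<forall>n. L n t \<inter> C \<noteq> {}}"
      by (intro Collect_cong conj_cong refl)
    also have "\<dots> = (\<Inter>n. {t \<in> space M. L n t \<inter> C \<noteq> {}})"
      by blast
    also have "\<dots> \<in> sets M"
      using L C by (intro sets.countable_INT image_subsetI measurable_multiD) auto
    finally show "{t \<in> space M. {z \<in> K t. \<forall>i. F i t z \<le> 0} \<inter> C \<noteq> {}} \<in> sets M" .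
  qed
qed

text \<open>The minimal value \<open>m\<close> is measurable because \<open>m t < a\<close> is a
  strict existence condition; the minimisers are then the sublevel set of
  \<open>F t z - m t\<close>.\<close>

lemma measurable_multi_argmin:
  fixes K :: "'t \<Rightarrow> 'b::euclidean_space set"
  assumes K: "measurable_multi M K" "\<And>t. t \<in> space M \<Longrightarrow> compact (K t)"
    and ne: "\<And>t. t \<in> space M \<Longrightarrow> K t \<noteq> {}" and F: "caratheodory M F"
  obtains K' where "measurable_multi M K'"
    "\<And>t. t \<in> space M \<Longrightarrow> compact (K' t) \<and> K' t \<noteq> {} \<and> K' t \<subseteq> K t"
    "\<And>t z y. t \<in> space M \<Longrightarrow> z \<in> K' t \<Longrightarrow> y \<in> K t \<Longrightarrow> F t z \<le> F t y"
proof -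
  have F_cont: "continuous_on S (F t)" if "t \<in> space M" for t S
    using F that continuous_on_subset by (auto simp: caratheodory_def)
  have "\<exists>z\<in>K t. \<forall>y\<in>K t. F t z \<le> F t y" if t: "t \<in> space M" for t
    using continuous_attains_inf[OF K(2)[OF t] ne[OF t] F_cont[OF t]] .
  then obtain z where z: "\<And>t. t \<in> space M \<Longrightarrow> z t \<in> K t \<and> (\<forall>y\<in>K t. F t (z t) \<le> F t y)" by metis
  define m where "m t = F t (z t)" for t
  have "m \<in> borel_measurable M"
  proof (rule borel_measurableI_less)
    fix a :: real
    have "{t \<in> space M. m t < a} = {t \<in> space M. \<exists>z\<in>K t. F t z - a < 0}"
      using z by (force simp: m_def)
    also have "\<dots> \<in> sets M"
      by (intro sets_exists_less K(1) caratheodory_diff F borel_measurable_const)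
    finally show "{t \<in> space M. m t < a} \<in> sets M" .
  qed
  then have Fm: "caratheodory M (\<lambda>t z. F t z - m t)"
    by (intro caratheodory_diff F)
  show ?thesis
  proof (rule that[of "\<lambda>t. {z \<in> K t. F t z - m t \<le> 0}"])
    show "measurable_multi M (\<lambda>t. {z \<in> K t. F t z - m t \<le> 0})"
      by (intro measurable_multi_sublevel K Fm)
    fix t assume t: "t \<in> space M"
    show "compact {z \<in> K t. F t z - m t \<le> 0} \<and> {z \<in> K t. F t z - m t \<le> 0} \<noteq> {} \<and>
        {z \<in> K t. F t z - m t \<le> 0} \<subseteq> K t"
    proof (intro conjI compact_sublevel K(2)[OF t])
      show "continuous_on UNIV (\<lambda>z. F t z - m t)" using Fm t by (simp add: caratheodory_def)
    qed (use z[OF t] in \<open>auto simp: m_def\<close>)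
    show "F t w \<le> F t y" if "w \<in> {z \<in> K t. F t z - m t \<le> 0}" "y \<in> K t" for w y
      using that z[OF t] by (force simp: m_def)
  qed
qed

text \<open>The selection is the lexicographically smallest element.\<close>

lemma measurable_selection:
  fixes K :: "'t \<Rightarrow> 'b::euclidean_space set"
  assumes K: "measurable_multi M K" "\<And>t. t \<in> space M \<Longrightarrow> compact (K t) \<and> K t \<noteq> {}"
  obtains f where "f \<in> borel_measurable M" "\<And>t. t \<in> space M \<Longrightarrow> f t \<in> K t"
proof -
  have "\<exists>K'. measurable_multi M K' \<and>
      (\<forall>t\<in>space M. compact (K' t) \<and> K' t \<noteq> {} \<and> K' t \<subseteq> K t \<and>
        (\<forall>b\<in>S. \<forall>y\<in>K' t. \<forall>z\<in>K' t. inner y b = inner z b))" if "finite S" for S :: "'b set"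
    using that
  proof induction
    case empty
    then show ?case using K by blast
  next
    case (insert b S)
    then obtain K' where K': "measurable_multi M K'"
      "\<And>t. t \<in> space M \<Longrightarrow> compact (K' t) \<and> K' t \<noteq> {} \<and> K' t \<subseteq> K t \<and>
        (\<forall>b\<in>S. \<forall>y\<in>K' t. \<forall>z\<in>K' t. inner y b = inner z b)" by blast
    have car: "caratheodory M (\<lambda>t z. inner z b)"
      by (auto simp: caratheodory_def intro!: continuous_intros)
    have K'_compact: "compact (K' t)" and K'_ne: "K' t \<noteq> {}" if "t \<in> space M" for t
      using K'(2)[OF that] by auto
    obtain K2 where K2: "measurable_multi M K2"
      "\<And>t. t \<in> space M \<Longrightarrow> compact (K2 t) \<and> K2 t \<noteq> {} \<and> K2 t \<subseteq> K' t"
      "\<And>t z y. t \<in> space M \<Longrightarrow> z \<in> K2 t \<Longrightarrow> y \<in> K' t \<Longrightarrow> inner z b \<le> inner y b"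
      using measurable_multi_argmin[OF K'(1) K'_compact K'_ne car] by metis
    have "inner y c = inner z c" if "t \<in> space M" "c \<in> insert b S" "y \<in> K2 t" "z \<in> K2 t" for t c y z
    proof (cases "c = b")
      case True
      then show ?thesis using K2(2,3)[OF that(1)] that by (meson antisym subsetD)
    next
      case False
      then show ?thesis using K2(2)[OF that(1)] K'(2)[OF that(1)] that by blast
    qed
    moreover have "K2 t \<subseteq> K t" if "t \<in> space M" for t using K2(2)[OF that] K'(2)[OF that] by blast
    ultimately show ?case using K2(1,2) by blast
  qed
  from this[OF finite_Basis] obtain K' where K': "measurable_multi M K'"
      "\<And>t. t \<in> space M \<Longrightarrow> K' t \<noteq> {}" "\<And>t. t \<in> space M \<Longrightarrow> K' t \<subseteq> K t"
      "\<And>t y z. t \<in> space M \<Longrightarrow> y \<in> K' t \<Longrightarrow> z \<in> K' t \<Longrightarrow> (\<forall>b\<in>Basis. inner y b = inner z b)"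
    by blast
  define f where "f t = (SOME z. z \<in> K' t)" for t
  have f: "f t \<in> K' t" if "t \<in> space M" for t
    unfolding f_def using K'(2)[OF that] by (simp add: some_in_eq)
  \<comment> \<open>Minimising every coordinate in turn leaves one point, so the choice in
    \<open>f\<close> is forced and \<open>f\<close> inherits measurability from
    \<open>K'\<close>.\<close>
  have eq: "K' t = {f t}" if "t \<in> space M" for t
    using f[OF that] K'(4)[OF that _ f[OF that]] by (auto intro: euclidean_eqI)
  have "f \<in> borel_measurable M"
  proof (rule borel_measurableI)
    fix S :: "'b set" assume "open S"
    then have "{t \<in> space M. K' t \<inter> - S \<noteq> {}} \<in> sets M"
      by (intro measurable_multiD K'(1)) auto
    then have "space M - {t \<in> space M. K' t \<inter> - S \<noteq> {}} \<in> sets M" by blast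
    also have "space M - {t \<in> space M. K' t \<inter> - S \<noteq> {}} = f -` S \<inter> space M"
      using eq by auto
    finally show "f -` S \<inter> space M \<in> sets M" .
  qed
  then show ?thesis using that f K'(3) by blast
qed

text \<open>Empty values occur for fibres of a graph over a prescribed point. They are replaced by
  \<open>{0}\<close> on a measurable set.\<close>

lemma measurable_argmin_selection:
  fixes K :: "'t \<Rightarrow> 'b::euclidean_space set"
  assumes K: "measurable_multi M K" "\<And>t. t \<in> space M \<Longrightarrow> compact (K t)" and F: "caratheodory M F"
  obtains f where "f \<in> borel_measurable M" "\<And>t. t \<in> space M \<Longrightarrow> K t \<noteq> {} \<Longrightarrow> f t \<in> K t"
    "\<And>t z. t \<in> space M \<Longrightarrow> z \<in> K t \<Longrightarrow> F t (f t) \<le> F t z"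
proof -
  define A where "A = {t \<in> space M. K t \<noteq> {}}"
  have A: "A \<in> sets M" using measurable_multiD[OF K(1) closed_UNIV] by (simp add: A_def)
  define L where "L t = (if t \<in> A then K t else {0})" for t
  have L: "measurable_multi M L"
    unfolding L_def using A K(1) by (intro measurable_multi_if measurable_multi_const)
  have L_compact: "compact (L t)" and L_ne: "L t \<noteq> {}" if "t \<in> space M" for t
    using K(2) that by (auto simp: L_def A_def)
  obtain K' where K': "measurable_multi M K'"
    "\<And>t. t \<in> space M \<Longrightarrow> compact (K' t) \<and> K' t \<noteq> {} \<and> K' t \<subseteq> L t"
    "\<And>t z y. t \<in> space M \<Longrightarrow> z \<in> K' t \<Longrightarrow> y \<in> L t \<Longrightarrow> F t z \<le> F t y"
    using measurable_multi_argmin[OF L L_compact L_ne F] by metis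
  obtain f where f: "f \<in> borel_measurable M" "\<And>t. t \<in> space M \<Longrightarrow> f t \<in> K' t"
    using measurable_selection[of M K'] K' by metis
  show ?thesis
  proof (rule that[OF f(1)])
    show "f t \<in> K t" if "t \<in> space M" "K t \<noteq> {}" for t
      using f(2)[OF that(1)] K'(2)[OF that(1)] that by (auto simp: L_def A_def)
    show "F t (f t) \<le> F t z" if "t \<in> space M" "z \<in> K t" for t z
    proof -
      have "L t = K t" using that by (auto simp: L_def A_def)
      then show ?thesis using K'(3)[OF that(1) f(2)[OF that(1)]] that by blast
    qed
  qed
qed

subsection \<open>Measurability of the subgradient multifunction\<close>

text \<open>A compact set meets the graph of the limiting subdifferential iff each of its neighbourhoods
  contains a proximal subgradient pair, and the latter is a countable family of closed conditions.\<close>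

lemma measurable_multi_limiting_subdiff:
  fixes f :: "'t \<Rightarrow> 'a::euclidean_space \<Rightarrow> ereal"
  assumes lip: "\<And>t. t \<in> space M \<Longrightarrow> finite_lipschitz_on_cball (f t) (g t) x0 R (C t)"
    and meas: "\<And>x. x \<in> cball x0 R \<Longrightarrow> (\<lambda>t. g t x) \<in> borel_measurable M"
    and R: "R > 0"
  shows "measurable_multi M (\<lambda>t. {(u, v). u \<in> cball x0 (R/2) \<and> v \<in> limiting_subdiff (f t) u})"
proof (rule measurable_multi_of_compact)
  fix S :: "('a \<times> 'a) set" assume "compact S"
  define S' where "S' = S \<inter> (cball x0 (R/2) \<times> UNIV)"
  have S': "compact S'"
    unfolding S'_def using \<open>compact S\<close> by (intro compact_Int_closed closed_Times) auto
  show "{t \<in> space M. {(u, v). u \<in> cball x0 (R/2) \<and> v \<in> limiting_subdiff (f t) u} \<inter> S \<noteq> {}} \<in> sets M"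
  proof (cases "S' = {}")
    case True
    then have "{t \<in> space M. {(u, v). u \<in> cball x0 (R/2) \<and> v \<in> limiting_subdiff (f t) u} \<inter> S \<noteq> {}} = {}"
      unfolding S'_def by blast
    then show ?thesis by (metis sets.empty_sets)
  next
    case False
    \<comment> \<open>Shrinking compact neighbourhoods of \<open>S'\<close>. The radius
      \<open>3/4*R\<close> leaves room to move away from \<open>S'\<close>, which lies over radius
      \<open>R/2\<close>, while staying where \<open>g t\<close> is controlled.\<close>
    define N where "N j = {p. infdist p S' \<le> 1 / Suc j} \<inter> (cball x0 (3/4*R) \<times> UNIV)" for j
    have N_compact: "compact (N j)" for j
      unfolding N_def using False S' by (intro compact_Int_closed closed_Times compact_infdist_le) auto
    obtain Z where Z: "countable Z" "Z \<subseteq> cball x0 R" "cball x0 R \<subseteq> closure Z"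
      using separable by blast
    then have "Z \<noteq> {}" using R by auto
    define z where "z = from_nat_into Z"
    have z: "range z = Z" unfolding z_def by (rule range_from_nat_into[OF \<open>Z \<noteq> {}\<close> Z(1)])
    have z_in: "z i \<in> cball x0 R" for i using Z(2) z by blast
    \<comment> \<open>Projection onto the ball: \<open>g t\<close> is continuous only there, and a
      Caratheodory function must be continuous on the whole space.\<close>
    define p where "p = closest_point (cball x0 R)"
    have p: "p u \<in> cball x0 R" for u
      unfolding p_def using R by (intro closest_point_in_set) auto
    have p_id: "p u = u" if "u \<in> cball x0 R" for u
      unfolding p_def using that by (rule closest_point_self)
    have p_cont: "continuous_on A p" for A
      unfolding p_def using R by (intro continuous_on_closest_point) auto
    \<comment> \<open>\<open>F L i t w \<le> 0\<close> is the proximal inequality tested at the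
      \<open>i\<close>-th point of a dense sequence; all \<open>i\<close> together say that
      \<open>w\<close> is a proximal pair with constant \<open>L\<close>.\<close>
    define F where "F L i t w = g t (p (fst w)) + inner (snd w) (z i - fst w)
        - real L * norm (z i - fst w) ^ 2 - g t (z i)" for L i :: nat and t w
    have F_car: "caratheodory M (F L i)" for L i
    proof -
      have "continuous_on UNIV (F L i t)" if "t \<in> space M" for t
      proof -
        have "continuous_on UNIV (\<lambda>w. g t (p (fst w)))"
          by (rule continuous_on_compose2[OF finite_lipschitz_on_cball.continuous_on_cball[OF lip[OF that]]])
            (use p in \<open>auto intro!: continuous_on_compose2[OF p_cont] continuous_intros\<close>)
        then show ?thesis unfolding F_def by (intro continuous_intros)
      qed
      moreover have "(\<lambda>t. F L i t w) \<in> borel_measurable M" for w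
        unfolding F_def by (intro borel_measurable_diff borel_measurable_add meas p z_in) auto
      ultimately show ?thesis by (simp add: caratheodory_def)
    qed
    have F_iff: "(\<forall>i. F L i t (u, v) \<le> 0) \<longleftrightarrow> (u, v) \<in> proximal_on (cball x0 R) (g t) L"
      if t: "t \<in> space M" and u: "u \<in> cball x0 R" for L t u v
    proof
      assume le: "\<forall>i. F L i t (u, v) \<le> 0"
      define h where "h y = g t u + inner v (y - u) - real L * norm (y - u) ^ 2 - g t y" for y
      have "h y \<le> 0" if y: "y \<in> cball x0 R" for y
      proof (rule continuous_le_on_closure[of Z h])
        have "closure Z = cball x0 R"
          using Z(2,3) by (metis closed_cball closure_minimal subset_antisym)
        then show "y \<in> closure Z" "continuous_on (closure Z) h"
          using y unfolding h_def
          by (auto intro!: continuous_intros finite_lipschitz_on_cball.continuous_on_cball[OF lip[OF t]])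
        show "h y \<le> 0" if "y \<in> Z" for y
        proof -
          have "y \<in> range z" using that by (simp only: z)
          then obtain i where "y = z i" by (rule rangeE)
          then show ?thesis using le[rule_format, of i] u by (simp add: F_def h_def p_id)
        qed
      qed
      then show "(u, v) \<in> proximal_on (cball x0 R) (g t) L"
        by (simp add: proximal_on_def h_def)
    next
      assume "(u, v) \<in> proximal_on (cball x0 R) (g t) L"
      then show "\<forall>i. F L i t (u, v) \<le> 0"
        using u z_in by (simp add: proximal_on_def F_def p_id)
    qed
    have hit: "{(u, v). u \<in> cball x0 (R/2) \<and> v \<in> limiting_subdiff (f t) u} \<inter> S \<noteq> {} \<longleftrightarrow>
        (\<forall>j. \<exists>L. {w \<in> N j. \<forall>i. F L i t w \<le> 0} \<inter> UNIV \<noteq> {})" (is "?L \<longleftrightarrow> ?R")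
      if t: "t \<in> space M" for t
    proof
      interpret finite_lipschitz_on_cball "f t" "g t" x0 R "C t" by (rule lip[OF t])
      assume ?L
      then obtain u v where uv: "u \<in> cball x0 (R/2)" "v \<in> limiting_subdiff (f t) u" "(u, v) \<in> S"
        by blast
      then have "(u, v) \<in> S'" by (simp add: S'_def)
      have uR: "u \<in> ball x0 R" using uv(1) R by simp
      show ?R
      proof
        fix j
        define e where "e = min (R/4) (1 / Suc j / 2)"
        have "e > 0" using R by (simp add: e_def)
        then obtain u' v' L where *: "dist u' u < e" "dist v' v < e"
          "(u', v') \<in> proximal_on (cball x0 R) (g t) L"
          using limiting_subdiff_iff[OF uR] uv(2) by blast
        have "infdist (u', v') S' \<le> dist (u', v') (u, v)"
          using \<open>(u, v) \<in> S'\<close> by (rule infdist_le)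
        also have "\<dots> \<le> dist u' u + dist v' v"
          using norm_Pair_le[of "u' - u" "v' - v"] by (simp add: dist_norm)
        also have "\<dots> \<le> e + e" using * by (intro add_mono) auto
        also have "\<dots> \<le> 1 / Suc j / 2 + 1 / Suc j / 2" unfolding e_def by (intro add_mono) auto
        also have "\<dots> = 1 / Suc j" by (rule field_sum_of_halves)
        finally have "infdist (u', v') S' \<le> 1 / Suc j" .
        moreover have u': "u' \<in> cball x0 (3/4*R)"
          using *(1) uv(1) dist_triangle[of x0 u' u] by (simp add: e_def dist_commute)
        ultimately have "(u', v') \<in> N j" by (simp add: N_def)
        moreover have "u' \<in> cball x0 R" using u' R by simp
        ultimately show "\<exists>L. {w \<in> N j. \<forall>i. F L i t w \<le> 0} \<inter> UNIV \<noteq> {}"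
          using F_iff[OF t, of u'] *(3) by blast
      qed
    next
      interpret finite_lipschitz_on_cball "f t" "g t" x0 R "C t" by (rule lip[OF t])
      assume ?R
      \<comment> \<open>The proximal pairs \<open>w j\<close> come within \<open>1 / Suc j\<close>
        of the compact set \<open>S'\<close>. An accumulation point of their nearest points lies in
        \<open>S\<close> and is a limit of proximal pairs, hence in the graph.\<close>
      then have "\<forall>j. \<exists>w L. w \<in> N j \<and> (\<forall>i. F L i t w \<le> 0)" by blast
      then obtain w L where w: "\<And>j. w j \<in> N j" "\<And>j i. F (L j) i t (w j) \<le> 0" by metis
      have w_prox: "w j \<in> proximal_on (cball x0 R) (g t) (L j)" for j
        using F_iff[OF t, of "fst (w j)" "L j" "snd (w j)"] w[of j] R by (auto simp: N_def)
      have "\<exists>q\<in>S'. dist (w j) q \<le> 1 / Suc j" for j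
      proof -
        obtain q where "q \<in> S'" "infdist (w j) S' = dist (w j) q"
          using infdist_attains_inf[OF compact_imp_closed[OF S'] False] by blast
        then show ?thesis using w(1)[of j] by (auto simp: N_def)
      qed
      then obtain q where q: "\<And>j. q j \<in> S'" "\<And>j. dist (w j) (q j) \<le> 1 / Suc j" by metis
      obtain q0 r where q0: "q0 \<in> S'" "strict_mono r" "(q \<circ> r) \<longlonglongrightarrow> q0"
        using S' q(1) unfolding compact_def by metis
      have "(\<lambda>j. dist (w j) (q j)) \<longlonglongrightarrow> 0"
        by (rule tendsto_sandwich[OF _ _ tendsto_const LIMSEQ_inverse_real_of_nat])
          (use q(2) in \<open>auto simp: inverse_eq_divide\<close>)
      then have "(\<lambda>j. dist (w (r j)) (q (r j))) \<longlonglongrightarrow> 0"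
        using LIMSEQ_subseq_LIMSEQ[OF _ q0(2), of "\<lambda>j. dist (w j) (q j)"] by (simp add: o_def)
      moreover have "(\<lambda>j. dist (q (r j)) q0) \<longlonglongrightarrow> 0"
        using tendsto_dist[OF q0(3) tendsto_const[of q0]] by (simp add: o_def)
      ultimately have "(\<lambda>j. dist (w (r j)) (q (r j)) + dist (q (r j)) q0) \<longlonglongrightarrow> 0 + 0"
        by (rule tendsto_add)
      then have w_lim: "(\<lambda>j. dist (w (r j)) q0) \<longlonglongrightarrow> 0"
        by (intro tendsto_sandwich[of "\<lambda>_. 0" "\<lambda>j. dist (w (r j)) q0" sequentially
              "\<lambda>j. dist (w (r j)) (q (r j)) + dist (q (r j)) q0" 0])
          (auto intro!: always_eventually dist_triangle)
      define u v where "u = fst q0" and "v = snd q0"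
      have q0_eq: "q0 = (u, v)" by (simp add: u_def v_def)
      have u: "u \<in> cball x0 (R/2)" "(u, v) \<in> S" using q0(1) by (auto simp: S'_def q0_eq)
      then have uR: "u \<in> ball x0 R" using R by simp
      have "v \<in> limiting_subdiff (f t) u"
        unfolding limiting_subdiff_iff[OF uR]
      proof (intro allI impI)
        fix e :: real assume "e > 0"
        obtain j where j: "dist (w (r j)) q0 < e"
          using eventually_happens'[OF sequentially_bot order_tendstoD(2)[OF w_lim \<open>e > 0\<close>]] by blast
        have "dist (fst (w (r j))) u < e" "dist (snd (w (r j))) v < e"
          using j dist_fst_le[of "w (r j)" q0] dist_snd_le[of "w (r j)" q0] by (auto simp: q0_eq)
        then show "\<exists>u' v' L. dist u' u < e \<and> dist v' v < e \<and> (u', v') \<in> proximal_on (cball x0 R) (g t) L"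
          using w_prox[of "r j"] by (metis prod.collapse)
      qed
      then show ?L using u by blast
    qed
    have "{t \<in> space M. {(u, v). u \<in> cball x0 (R/2) \<and> v \<in> limiting_subdiff (f t) u} \<inter> S \<noteq> {}} =
        {t \<in> space M. \<forall>j. \<exists>L. {w \<in> N j. \<forall>i. F L i t w \<le> 0} \<inter> UNIV \<noteq> {}}"
      by (intro Collect_cong conj_cong refl hit)
    also have "\<dots> = (\<Inter>j. \<Union>L. {t \<in> space M. {w \<in> N j. \<forall>i. F L i t w \<le> 0} \<inter> UNIV \<noteq> {}})"
      by blast
    also have "\<dots> \<in> sets M"
      by (intro sets.countable_INT sets.countable_UN image_subsetI measurable_multiD closed_UNIV
          measurable_multi_countable_sublevel measurable_multi_const N_compact F_car) auto
    finally show ?thesis .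
  qed
qed

subsection \<open>Purely atomic sets\<close>

text \<open>Up to a set on which \<open>k\<close> has small integral, a purely atomic set is a finite union of atoms, and
  there smallness in \<open>L\<^sup>1\<close> implies uniform smallness.\<close>

lemma purely_atomic_exhaustion:
  fixes k :: "'t \<Rightarrow> real"
  assumes "finite_measure M" and P: "P \<in> sets M" "purely_atomic (density M (indicator P))"
    and k: "integrable M k" and "e > 0"
  obtains S c where "S \<in> sets M" "S \<subseteq> P" "c > 0" "(\<integral>t. indicator (P - S) t * \<bar>k t\<bar> \<partial>M) < e"
    "\<And>h :: 't \<Rightarrow> real. integrable M h \<Longrightarrow> (\<And>t. 0 \<le> h t) \<Longrightarrow> AE t in M. t \<in> S \<longrightarrow> c * h t \<le> (\<integral>t. h t \<partial>M)"
proof -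
  interpret finite_measure M by fact
  \<comment> \<open>The sets on which a bound on an integral yields an a.e. bound. They are closed
    under finite unions and contain the atoms, with the mass of the atom as constant.\<close>
  define F where "F = {S \<in> sets M. S \<subseteq> P \<and> (\<exists>c>0. \<forall>h :: 't \<Rightarrow> real. integrable M h \<longrightarrow>
    (\<forall>t. 0 \<le> h t) \<longrightarrow> (AE t in M. t \<in> S \<longrightarrow> c * h t \<le> (\<integral>t. h t \<partial>M)))}"
  have F_empty: "{} \<in> F" unfolding F_def by (auto intro: exI[of _ 1])
  have F_Un: "S \<union> S' \<in> F" if S: "S \<in> F" "S' \<in> F" for S S'
  proof -
    obtain c c' where c: "c > 0" "c' > 0"
      "\<And>h :: 't \<Rightarrow> real. integrable M h \<Longrightarrow> (\<And>t. 0 \<le> h t) \<Longrightarrow> AE t in M. t \<in> S \<longrightarrow> c * h t \<le> (\<integral>t. h t \<partial>M)"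
      "\<And>h :: 't \<Rightarrow> real. integrable M h \<Longrightarrow> (\<And>t. 0 \<le> h t) \<Longrightarrow> AE t in M. t \<in> S' \<longrightarrow> c' * h t \<le> (\<integral>t. h t \<partial>M)"
      using S unfolding F_def by blast
    have "AE t in M. t \<in> S \<union> S' \<longrightarrow> min c c' * h t \<le> (\<integral>t. h t \<partial>M)"
      if h: "integrable M h" "\<forall>t. 0 \<le> h t" for h :: "'t \<Rightarrow> real"
      using c(3)[OF h(1) h(2)[rule_format]] c(4)[OF h(1) h(2)[rule_format]]
    proof eventually_elim
      case (elim t)
      have "min c c' * h t \<le> c * h t" "min c c' * h t \<le> c' * h t"
        using h(2) by (auto intro: mult_right_mono)
      then show ?case using elim by auto
    qed
    moreover have "min c c' > 0" using c by simp
    ultimately show ?thesis using S unfolding F_def by blast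
  qed
  have ed: "emeasure (density M (indicator P)) A = emeasure M (P \<inter> A)" if "A \<in> sets M" for A
    using emeasure_restricted[OF P(1) that] .
  have F_atom: "P \<inter> B \<in> F" and B_pos: "measure M (P \<inter> B) > 0"
    if B: "measure_atom (density M (indicator P)) B" for B
  proof -
    have Bs: "B \<in> sets M" using B by (simp add: measure_atom_def)
    define c where "c = measure M (P \<inter> B)"
    have c: "c > 0" using B ed[OF Bs] by (simp add: measure_atom_def emeasure_eq_measure c_def)
    then show "measure M (P \<inter> B) > 0" by (simp add: c_def)
    have "AE t in M. t \<in> P \<inter> B \<longrightarrow> c * h t \<le> (\<integral>t. h t \<partial>M)"
      if h: "integrable M h" "\<forall>t. 0 \<le> h t" for h :: "'t \<Rightarrow> real"
    proof -
      define a where "a = (\<integral>t. h t \<partial>M)"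
      define A where "A = {t \<in> space M. a < c * h t} \<inter> B"
      have As: "A \<in> sets M" "A \<subseteq> B" using h(1) Bs unfolding A_def by auto
      have B_sp: "B \<subseteq> space M" using sets.sets_into_space[OF Bs] .
      have "emeasure M (P \<inter> A) = 0 \<or> emeasure M (P \<inter> (B - A)) = 0"
        using B As ed[of A] ed[of "B - A"] Bs by (auto simp: measure_atom_def)
      then show ?thesis
      proof
        assume "emeasure M (P \<inter> A) = 0"
        then have "AE t in M. t \<notin> P \<inter> A" using As P(1) by (intro AE_not_in) auto
        then show ?thesis
          using AE_space by eventually_elim (auto simp: A_def a_def)
      next
        assume "emeasure M (P \<inter> (B - A)) = 0"
        then have "AE t in M. t \<notin> P \<inter> (B - A)" using As Bs P(1) by (intro AE_not_in) auto
        then have gt: "AE t in M. t \<in> P \<inter> B \<longrightarrow> a < c * h t"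
          by eventually_elim (use B_sp in \<open>auto simp: A_def\<close>)
        \<comment> \<open>If \<open>c * h > a\<close> held a.e. on the atom, then \<open>w\<close>
          would be positive a.e. there. Its integral is nonpositive, because the integral of
          \<open>h\<close> over the atom is at most \<open>a\<close>; so the atom would be
          null.\<close>
        define w where "w t = indicator (P \<inter> B) t * (c * h t - a)" for t
        have hi: "integrable M (\<lambda>t. indicator (P \<inter> B) t * h t)"
          using integrable_mult_indicator[OF _ h(1), of "P \<inter> B"] Bs P(1) by auto
        have ii: "integrable M (\<lambda>t. indicator (P \<inter> B) t * a)"
          using Bs P(1) by (intro integrable_mult_left integrable_real_indicator) (auto simp: less_top[symmetric])
        have w_eq: "w t = c * (indicator (P \<inter> B) t * h t) - indicator (P \<inter> B) t * a" for t
          by (simp add: w_def algebra_simps)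
        have wi: "integrable M w" unfolding w_eq using hi ii by auto
        have "(\<integral>t. indicator (P \<inter> B) t * h t \<partial>M) \<le> a"
          unfolding a_def using h by (intro integral_mono hi) (auto simp: indicator_def)
        then have "c * (\<integral>t. indicator (P \<inter> B) t * h t \<partial>M) \<le> c * a" using c by simp
        moreover have "(\<integral>t. indicator (P \<inter> B) t * a \<partial>M) = c * a"
          using Bs P(1) sets.sets_into_space[OF P(1)] by (simp add: c_def Int_absorb1 le_infI1)
        moreover have "integral\<^sup>L M w = c * (\<integral>t. indicator (P \<inter> B) t * h t \<partial>M) - (\<integral>t. indicator (P \<inter> B) t * a \<partial>M)"
          unfolding w_eq using hi ii by (subst Bochner_Integration.integral_diff) (auto simp: integral_mult_right_zero)
        ultimately have "integral\<^sup>L M w \<le> 0" by linarith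
        moreover have w_nonneg: "AE t in M. 0 \<le> w t"
          using gt by eventually_elim (auto simp: w_def indicator_def)
        ultimately have "integral\<^sup>L M w = 0" using integral_nonneg_AE[OF w_nonneg] by simp
        then have "AE t in M. w t = 0" using integral_nonneg_eq_0_iff_AE[OF wi w_nonneg] by simp
        with gt have "AE t in M. t \<notin> P \<inter> B"
          by eventually_elim (auto simp: w_def)
        then have "emeasure M (P \<inter> B) = 0"
          using Bs P(1) by (subst (asm) AE_iff_measurable[of "P \<inter> B"]) (use B_sp in auto)
        then show ?thesis using c by (simp add: c_def measure_def)
      qed
    qed
    then show "P \<inter> B \<in> F" unfolding F_def using c Bs P(1) by blast
  qed
  \<comment> \<open>Exhaustion: an atom outside all \<open>U n\<close> could be adjoined to some
    \<open>S n\<close> and push its measure above the supremum. Hence no atom remains, and pure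
    atomicity makes the remainder null.\<close>
  define s where "s = Sup (measure M ` F)"
  have bdd: "bdd_above (measure M ` F)" using bounded_measure by (intro bdd_aboveI2)
  have "\<exists>S\<in>F. s - 1 / Suc n < measure M S" for n
  proof -
    have "s - 1 / Suc n < s" by simp
    then show ?thesis unfolding s_def using less_cSup_iff[OF _ bdd] F_empty by blast
  qed
  then obtain S where S: "\<And>n. S n \<in> F" "\<And>n. s - 1 / Suc n < measure M (S n)" by metis
  define U where "U n = (\<Union>i\<le>n. S i)" for n
  have U: "U n \<in> F" for n
  proof (induction n)
    case (Suc n)
    have "U (Suc n) = U n \<union> S (Suc n)" by (auto simp: U_def atMost_Suc)
    then show ?case using Suc S F_Un by simp
  qed (simp add: U_def S)
  have U_sets: "U n \<in> sets M" "U n \<subseteq> P" for n using U by (auto simp: F_def)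
  have null: "emeasure M (P - (\<Union>n. U n)) = 0"
  proof (rule ccontr)
    assume "emeasure M (P - (\<Union>n. U n)) \<noteq> 0"
    moreover have Ps: "P - (\<Union>n. U n) \<in> sets M" using P(1) U_sets by auto
    moreover have "P \<inter> (P - (\<Union>n. U n)) = P - (\<Union>n. U n)" by blast
    ultimately have "emeasure (density M (indicator P)) (P - (\<Union>n. U n)) > 0"
      using ed[OF Ps] by (simp add: zero_less_iff_neq_zero)
    then obtain B where B: "B \<subseteq> P - (\<Union>n. U n)" "measure_atom (density M (indicator P)) B"
      using P(2) Ps unfolding purely_atomic_def by (metis sets_density)
    then have "P \<inter> B = B" by blast
    then have PB: "B \<in> F" "measure M B > 0" using F_atom[OF B(2)] B_pos[OF B(2)] by auto
    then obtain n where n: "inverse (real (Suc n)) < measure M B" using reals_Archimedean by blast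
    have "S n \<inter> B = {}" using B(1) by (auto simp: U_def)
    then have "measure M (S n \<union> B) = measure M (S n) + measure M B"
      using S(1)[of n] PB(1) by (intro finite_measure_Union) (auto simp: F_def)
    then have "measure M (S n \<union> B) > s" using S(2)[of n] n by (simp add: inverse_eq_divide)
    moreover have "measure M (S n \<union> B) \<le> s"
      unfolding s_def using F_Un[OF S(1)[of n] PB(1)] bdd by (intro cSup_upper) auto
    ultimately show False by simp
  qed
  have "(\<lambda>n. \<integral>t. indicator (P - U n) t * \<bar>k t\<bar> \<partial>M) \<longlonglongrightarrow> (\<integral>t. 0 \<partial>M)"
  proof (rule integral_dominated_convergence[where w = "\<lambda>t. \<bar>k t\<bar>"])
    have "AE t in M. t \<notin> P - (\<Union>n. U n)"
      using null P(1) U_sets by (intro AE_not_in) auto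
    then show "AE t in M. (\<lambda>n. indicator (P - U n) t * \<bar>k t\<bar>) \<longlonglongrightarrow> 0"
    proof eventually_elim
      case (elim t)
      have "\<exists>m. \<forall>n\<ge>m. t \<notin> P - U n"
      proof (cases "t \<in> P")
        case True
        then obtain m where "t \<in> U m" using elim by blast
        moreover have "U m \<subseteq> U n" if "m \<le> n" for n using that unfolding U_def by (intro UN_mono) auto
        ultimately show ?thesis by blast
      qed simp
      then have "\<forall>\<^sub>F n in sequentially. indicator (P - U n) t * \<bar>k t\<bar> = 0"
        unfolding eventually_sequentially by (auto simp: indicator_def)
      then show ?case by (rule tendsto_eventually)
    qed
  next
    show "(\<lambda>t. indicator (P - U n) t * \<bar>k t\<bar>) \<in> borel_measurable M" for n
      using P(1) U_sets k by (intro borel_measurable_times borel_measurable_indicator) auto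
  qed (use k in \<open>auto simp: indicator_def\<close>)
  then have "(\<lambda>n. \<integral>t. indicator (P - U n) t * \<bar>k t\<bar> \<partial>M) \<longlonglongrightarrow> 0" by simp
  then obtain n where n: "(\<integral>t. indicator (P - U n) t * \<bar>k t\<bar> \<partial>M) < e"
    using eventually_happens'[OF sequentially_bot order_tendstoD(2)[OF _ \<open>e > 0\<close>]] by blast
  obtain c where "c > 0" "\<And>h :: 't \<Rightarrow> real. integrable M h \<Longrightarrow> (\<And>t. 0 \<le> h t) \<Longrightarrow>
      AE t in M. t \<in> U n \<longrightarrow> c * h t \<le> (\<integral>t. h t \<partial>M)"
    using U[of n] unfolding F_def by blast
  then show ?thesis using that[OF U_sets[of n] _ n] by blast
qed

subsection \<open>Penalised selections\<close>

lemma borel_measurable_fst_snd: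
  fixes f :: "'t \<Rightarrow> 'a::euclidean_space \<times> 'b::euclidean_space"
  assumes "f \<in> borel_measurable M"
  shows "(\<lambda>t. fst (f t)) \<in> borel_measurable M" "(\<lambda>t. snd (f t)) \<in> borel_measurable M"
  by (intro measurable_compose[OF assms] borel_measurable_continuous_onI continuous_intros)+

text \<open>Here \<open>D t\<close> abstracts from a truncated graph of a subdifferential. The
  setting is instantiated twice: with that graph, and with the subset obtained by keeping
  \<open>v\<close> near \<open>y0\<close> on the atoms.\<close>

locale graph_multifunction = finite_measure M for M :: "'t measure" +
  fixes D :: "'t \<Rightarrow> ('a::euclidean_space \<times> 'a) set"
    and x0 xs ys :: 'a and y0 :: "'t \<Rightarrow> 'a" and k :: "'t \<Rightarrow> real" and r :: real
  assumes D_measurable: "measurable_multi M D"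
    and D_closed: "\<And>t. t \<in> space M \<Longrightarrow> closed (D t)"
    and D_fst: "\<And>t p. t \<in> space M \<Longrightarrow> p \<in> D t \<Longrightarrow> dist (fst p) x0 \<le> r"
    and D_snd: "\<And>t p. t \<in> space M \<Longrightarrow> p \<in> D t \<Longrightarrow> norm (snd p) \<le> k t"
    and D_base: "\<And>t. t \<in> space M \<Longrightarrow> (x0, y0 t) \<in> D t"
    and y0_measurable [measurable]: "y0 \<in> borel_measurable M"
    and k_integrable: "integrable M k"
begin

lemma k_measurable [measurable]: "k \<in> borel_measurable M"
  using k_integrable by auto

lemma k_nonneg: "t \<in> space M \<Longrightarrow> 0 \<le> k t"
  using D_snd[OF _ D_base] by (fastforce intro: order_trans[OF norm_ge_zero])

lemma norm_y0: "t \<in> space M \<Longrightarrow> norm (y0 t) \<le> k t"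
  using D_snd[OF _ D_base] by fastforce

lemma norm_diff_y0: "t \<in> space M \<Longrightarrow> p \<in> D t \<Longrightarrow> norm (snd p - y0 t) \<le> 2 * k t"
  using D_snd[of t p] norm_y0[of t] norm_triangle_ineq4[of "snd p" "y0 t"] by linarith

lemma D_compact: "t \<in> space M \<Longrightarrow> compact (D t)"
proof -
  assume t: "t \<in> space M"
  have "D t \<subseteq> cball x0 r \<times> cball 0 (k t)"
    using D_fst[OF t] D_snd[OF t] by (fastforce simp: dist_commute)
  then have "bounded (D t)"
    by (rule bounded_subset[rotated]) (intro bounded_Times bounded_cball)
  then show ?thesis using D_closed[OF t] by (simp add: compact_eq_bounded_closed)
qed

text \<open>The unsmoothed, unpenalised integrand. It is positively homogeneous in
  \<open>v - y0 t\<close>, so selections can be scaled towards \<open>y0\<close>.\<close>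

definition q :: "real \<Rightarrow> 't \<Rightarrow> 'a \<Rightarrow> real" where
  "q e t v = inner ys (v - y0 t) + e * norm (v - y0 t)"

lemma integrable_diff_y0:
  assumes [measurable]: "v \<in> borel_measurable M" and "AE t in M. (u t, v t) \<in> D t"
  shows "integrable M (\<lambda>t. v t - y0 t)"
proof (rule Bochner_Integration.integrable_bound)
  show "integrable M (\<lambda>t. 2 * k t)" using k_integrable by simp
  show "AE t in M. norm (v t - y0 t) \<le> norm (2 * k t)"
    using assms(2) AE_space by eventually_elim (use norm_diff_y0 k_nonneg in fastforce)
qed measurable

lemma integrable_q:
  assumes "v \<in> borel_measurable M" "AE t in M. (u t, v t) \<in> D t"
  shows "integrable M (\<lambda>t. q e t (v t))"
  unfolding q_def using integrable_diff_y0[OF assms] by auto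

lemma q_bound:
  assumes "t \<in> space M" "p \<in> D t"
  shows "\<bar>q e t (snd p)\<bar> \<le> (norm ys + \<bar>e\<bar>) * (2 * k t)"
proof -
  have "\<bar>q e t (snd p)\<bar> \<le> norm ys * norm (snd p - y0 t) + \<bar>e\<bar> * norm (snd p - y0 t)"
    unfolding q_def using Cauchy_Schwarz_ineq2[of ys "snd p - y0 t"]
    by (intro order_trans[OF abs_triangle_ineq] add_mono) (auto simp: abs_mult)
  also have "\<dots> = (norm ys + \<bar>e\<bar>) * norm (snd p - y0 t)" by (simp add: algebra_simps)
  also have "\<dots> \<le> (norm ys + \<bar>e\<bar>) * (2 * k t)"
    using norm_diff_y0[OF assms] by (intro mult_left_mono) auto
  finally show ?thesis .
qed

lemma subseq_limit:
  assumes t: "t \<in> space M" and D: "\<And>j::nat. (u j, v j) \<in> D t" and u: "u \<longlonglongrightarrow> x"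
  obtains y \<sigma> where "strict_mono \<sigma>" "(x, y) \<in> D t" "(v \<circ> \<sigma>) \<longlonglongrightarrow> y"
proof -
  obtain p \<sigma> where p: "p \<in> D t" "strict_mono \<sigma>" "((\<lambda>j. (u j, v j)) \<circ> \<sigma>) \<longlonglongrightarrow> p"
    using D_compact[OF t] D unfolding compact_def by (metis (no_types, lifting))
  have "(u \<circ> \<sigma>) \<longlonglongrightarrow> fst p" using tendsto_fst[OF p(3)] by (simp add: o_def)
  moreover have "(u \<circ> \<sigma>) \<longlonglongrightarrow> x" using LIMSEQ_subseq_LIMSEQ[OF u p(2)] .
  ultimately have "fst p = x" by (rule LIMSEQ_unique)
  then have "(x, snd p) \<in> D t" using p(1) by (metis prod.collapse)
  moreover have "(v \<circ> \<sigma>) \<longlonglongrightarrow> snd p" using tendsto_snd[OF p(3)] by (simp add: o_def)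
  ultimately show ?thesis using that p(2) by blast
qed

text \<open>The \<open>v j\<close> need not converge. But if the deficit stayed above some
  \<open>\<epsilon>\<close> along a subsequence, compactness of \<open>D t\<close> would give a
  limit in the fibre over \<open>x\<close> with value below \<open>m\<close>.\<close>

lemma deficit_tendsto_0:
  assumes t: "t \<in> space M" and D: "\<And>j::nat. (u j, v j) \<in> D t" and u: "u \<longlonglongrightarrow> x"
    and m: "\<And>y. (x, y) \<in> D t \<Longrightarrow> m \<le> q e t y"
  shows "(\<lambda>j. max 0 (m - q e t (v j))) \<longlonglongrightarrow> 0"
proof (rule tendstoI, rule ccontr)
  fix \<epsilon> :: real assume "\<epsilon> > 0" and ne: "\<not> (\<forall>\<^sub>F j in sequentially. dist (max 0 (m - q e t (v j))) 0 < \<epsilon>)"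
  then obtain \<sigma> :: "nat \<Rightarrow> nat" where \<sigma>: "strict_mono \<sigma>" "\<And>j. \<not> dist (max 0 (m - q e t (v (\<sigma> j)))) 0 < \<epsilon>"
    using not_eventually_sequentiallyD[OF ne] by blast
  have le: "q e t (v (\<sigma> j)) \<le> m - \<epsilon>" for j
    using \<sigma>(2)[of j] \<open>\<epsilon> > 0\<close> by (auto simp: dist_real_def max_def split: if_splits)
  obtain y \<tau> where y: "strict_mono \<tau>" "(x, y) \<in> D t" "((v \<circ> \<sigma>) \<circ> \<tau>) \<longlonglongrightarrow> y"
  proof (rule subseq_limit[OF t])
    show "((u \<circ> \<sigma>) j, (v \<circ> \<sigma>) j) \<in> D t" for j using D by simp
    show "(u \<circ> \<sigma>) \<longlonglongrightarrow> x" by (rule LIMSEQ_subseq_LIMSEQ[OF u \<sigma>(1)])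
  qed blast
  have "(\<lambda>j. q e t (((v \<circ> \<sigma>) \<circ> \<tau>) j)) \<longlonglongrightarrow> q e t y"
    unfolding q_def by (intro tendsto_intros y(3))
  then have "q e t y \<le> m - \<epsilon>"
    using le by (intro LIMSEQ_le_const2) auto
  then show False using m[OF y(2)] \<open>\<epsilon> > 0\<close> by simp
qed

text \<open>The pointwise minimisers at the limit point form an admissible
  selection, and dominated convergence controls the deficit of \<open>v j\<close> against them.\<close>

lemma eventually_integral_q_ge:
  assumes v [measurable]: "\<And>j. v j \<in> borel_measurable M"
    and D: "\<And>j::nat. AE t in M. (u j t, v j t) \<in> D t"
    and u: "AE t in M. (\<lambda>j. u j t) \<longlonglongrightarrow> x"
    and B: "\<And>w. w \<in> borel_measurable M \<Longrightarrow> (AE t in M. (x, w t) \<in> D t) \<Longrightarrow> B \<le> (\<integral>t. q e t (w t) \<partial>M)"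
    and "\<tau> > 0"
  shows "\<forall>\<^sub>F j in sequentially. B - \<tau> \<le> (\<integral>t. q e t (v j t) \<partial>M)"
proof -
  \<comment> \<open>The fibre over \<open>x\<close>. It is nonempty a.e., as it contains the
    accumulation points of \<open>v j t\<close>.\<close>
  define K where "K t = D t \<inter> ({x} \<times> UNIV)" for t
  have K: "measurable_multi M K" unfolding K_def
    by (intro measurable_multi_Int_closed D_measurable closed_Times) auto
  have K_compact: "compact (K t)" if "t \<in> space M" for t
    unfolding K_def by (intro compact_Int_closed D_compact that closed_Times) auto
  have "caratheodory M (\<lambda>t p. q e t (snd p))"
    unfolding caratheodory_def q_def by (auto intro!: continuous_intros)
  from measurable_argmin_selection[OF K K_compact this]
  obtain f where f [measurable]: "f \<in> borel_measurable M"
    and f_in: "\<And>t. t \<in> space M \<Longrightarrow> K t \<noteq> {} \<Longrightarrow> f t \<in> K t"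
    and f_le: "\<And>t p. t \<in> space M \<Longrightarrow> p \<in> K t \<Longrightarrow> q e t (snd (f t)) \<le> q e t (snd p)"
    by metis
  define w where "w t = snd (f t)" for t
  have w [measurable]: "w \<in> borel_measurable M" unfolding w_def by (rule borel_measurable_fst_snd[OF f])
  have ev: "AE t in M. \<forall>j. (u j t, v j t) \<in> D t" using D by (simp add: AE_all_countable)
  have wD: "AE t in M. (x, w t) \<in> D t"
    using ev u AE_space
  proof eventually_elim
    case (elim t)
    then obtain y where "(x, y) \<in> D t" using subseq_limit[of t "\<lambda>j. u j t" "\<lambda>j. v j t" x] by blast
    then have "f t \<in> K t" using f_in elim by (auto simp: K_def)
    then show ?case by (auto simp: K_def w_def)
  qed
  have iw: "integrable M (\<lambda>t. q e t (w t))" by (rule integrable_q[OF w wD])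
  have iv: "integrable M (\<lambda>t. q e t (v j t))" for j by (rule integrable_q[OF v D])
  have "(\<lambda>j. \<integral>t. max 0 (q e t (w t) - q e t (v j t)) \<partial>M) \<longlonglongrightarrow> (\<integral>t. 0 \<partial>M)"
  proof (rule integral_dominated_convergence)
    show "integrable M (\<lambda>t. 2 * ((norm ys + \<bar>e\<bar>) * (2 * k t)))" using k_integrable by simp
    show "AE t in M. (\<lambda>j. max 0 (q e t (w t) - q e t (v j t))) \<longlonglongrightarrow> 0"
      using ev u AE_space
    proof eventually_elim
      case (elim t)
      then show ?case
        using f_le[of t] by (intro deficit_tendsto_0[of t "\<lambda>j. u j t" _ x]) (auto simp: K_def w_def)
    qed
    show "AE t in M. norm (max 0 (q e t (w t) - q e t (v j t))) \<le> 2 * ((norm ys + \<bar>e\<bar>) * (2 * k t))" for j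
      using D[of j] wD AE_space
    proof eventually_elim
      case (elim t)
      then show ?case
        using q_bound[of t "(x, w t)" e] q_bound[of t "(u j t, v j t)" e] by (auto simp: max_def)
    qed
    show "(\<lambda>t. max 0 (q e t (w t) - q e t (v j t))) \<in> borel_measurable M" for j
      using iw iv[of j] by (intro borel_measurable_max borel_measurable_diff) auto
  qed simp
  then have "(\<lambda>j. \<integral>t. max 0 (q e t (w t) - q e t (v j t)) \<partial>M) \<longlonglongrightarrow> 0" by simp
  from order_tendstoD(2)[OF this \<open>\<tau> > 0\<close>] show ?thesis
  proof eventually_elim
    case (elim j)
    have "(\<integral>t. q e t (w t) - q e t (v j t) \<partial>M) \<le> (\<integral>t. max 0 (q e t (w t) - q e t (v j t)) \<partial>M)"
      using iw iv[of j] by (intro integral_mono integrable_max) auto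
    then have "(\<integral>t. q e t (w t) \<partial>M) - (\<integral>t. q e t (v j t) \<partial>M) < \<tau>"
      using elim iw iv[of j] by simp
    then show ?case using B[OF w wD] by simp
  qed
qed

text \<open>The gain from the first term is at most \<open>2 * norm ys * k t\<close>, so a weight
  proportional to \<open>k t\<close> is the right scale for the penalty; adding \<open>1\<close>
  keeps the weight away from zero.\<close>

definition cost :: "real \<Rightarrow> real \<Rightarrow> real \<Rightarrow> 't \<Rightarrow> 'a \<Rightarrow> 'a \<times> 'a \<Rightarrow> real" where
  "cost e d c t x p = inner ys (snd p - y0 t) + e * sqrt (d ^ 2 + norm (snd p - y0 t) ^ 2)
     + c * ((k t + 1) * norm (fst p - x) ^ 2)"

lemma integrable_penalty:
  assumes [measurable]: "f \<in> borel_measurable M" and D: "\<And>t. t \<in> space M \<Longrightarrow> f t \<in> D t"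
  shows "integrable M (\<lambda>t. (k t + 1) * norm (fst (f t) - x) ^ 2)"
proof -
  have [measurable]: "(\<lambda>t. fst (f t)) \<in> borel_measurable M" by (rule borel_measurable_fst_snd[OF assms(1)])
  show ?thesis
  proof (rule Bochner_Integration.integrable_bound)
  show "integrable M (\<lambda>t. (k t + 1) * (r + dist x x0) ^ 2)"
    using k_integrable by simp
  show "AE t in M. norm ((k t + 1) * norm (fst (f t) - x) ^ 2) \<le> norm ((k t + 1) * (r + dist x x0) ^ 2)"
  proof (rule AE_I2)
    fix t assume t: "t \<in> space M"
    have "norm (fst (f t) - x) \<le> r + dist x x0"
      using D_fst[OF t D[OF t]] dist_triangle2[of "fst (f t)" x x0] by (simp add: dist_norm)
    then have "norm (fst (f t) - x) ^ 2 \<le> (r + dist x x0) ^ 2"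
      by (intro power_mono) auto
    then show "norm ((k t + 1) * norm (fst (f t) - x) ^ 2) \<le> norm ((k t + 1) * (r + dist x x0) ^ 2)"
      using k_nonneg[OF t] by (simp add: abs_mult mult_left_mono)
  qed
qed measurable
qed

lemma integrable_sqrt:
  assumes v [measurable]: "v \<in> borel_measurable M" and "AE t in M. (u t, v t) \<in> D t"
  shows "integrable M (\<lambda>t. sqrt (d ^ 2 + norm (v t - y0 t) ^ 2))"
proof (rule Bochner_Integration.integrable_bound)
  show "integrable M (\<lambda>t. \<bar>d\<bar> + norm (v t - y0 t))"
    using integrable_diff_y0[OF assms] by auto
  show "AE t in M. norm (sqrt (d ^ 2 + norm (v t - y0 t) ^ 2)) \<le> norm (\<bar>d\<bar> + norm (v t - y0 t))"
  proof (rule AE_I2)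
    fix t
    show "norm (sqrt (d ^ 2 + norm (v t - y0 t) ^ 2)) \<le> norm (\<bar>d\<bar> + norm (v t - y0 t))"
      using sqrt_sum_squares_le_sum_abs[of d "norm (v t - y0 t)"] by simp
  qed
qed measurable

lemma integrable_cost:
  assumes [measurable]: "f \<in> borel_measurable M" and D: "\<And>t. t \<in> space M \<Longrightarrow> f t \<in> D t"
  shows "integrable M (\<lambda>t. cost e d c t x (f t))"
proof -
  have snd: "(\<lambda>t. snd (f t)) \<in> borel_measurable M" by (rule borel_measurable_fst_snd[OF assms(1)])
  have AE: "AE t in M. (fst (f t), snd (f t)) \<in> D t" using D by (intro AE_I2) simp
  show ?thesis
    unfolding cost_def
    using integrable_diff_y0[OF snd AE] integrable_sqrt[OF snd AE, of d] integrable_penalty[OF assms, of x]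
    by (intro Bochner_Integration.integrable_add integrable_mult_right integrable_inner_right) auto
qed

section \<open>Minimisers of the penalised problem and their optimality conditions\<close>

definition objective :: "real \<Rightarrow> 'a \<Rightarrow> real" where
  "objective e x = e * norm (x - x0) - inner xs (x - x0)"

text \<open>Only the penalty depends on \<open>x\<close>, and it does so in a Lipschitz way with an
  integrable constant; hence the value function \<open>J\<close> is continuous on the ball. The
  final bound compares with \<open>x0\<close> and the pairs \<open>(x0, y0 t)\<close>, of cost
  \<open>e * \<bar>d\<bar>\<close>.\<close>

lemma penalised_minimiser:
  assumes "e \<ge> 0" "c \<ge> 0" "r1 \<ge> 0"
  obtains x f where "x \<in> cball x0 r1" "f \<in> borel_measurable M" "\<And>t. t \<in> space M \<Longrightarrow> f t \<in> D t"
    "\<And>t p. t \<in> space M \<Longrightarrow> p \<in> D t \<Longrightarrow> cost e d c t x (f t) \<le> cost e d c t x p"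
    "\<And>x'. x' \<in> cball x0 r1 \<Longrightarrow>
      objective e x + (\<integral>t. cost e d c t x (f t) \<partial>M) \<le> objective e x' + (\<integral>t. cost e d c t x' (f t) \<partial>M)"
    "objective e x + (\<integral>t. cost e d c t x (f t) \<partial>M) \<le> e * \<bar>d\<bar> * measure M (space M)"
proof -
  have D_ne: "D t \<noteq> {}" if "t \<in> space M" for t using D_base[OF that] by blast
  have car: "caratheodory M (\<lambda>t p. cost e d c t x p)" for x
    unfolding caratheodory_def cost_def by (auto intro!: continuous_intros)
  have "\<exists>f\<in>borel_measurable M. \<forall>t\<in>space M. f t \<in> D t \<and> (\<forall>p\<in>D t. cost e d c t x (f t) \<le> cost e d c t x p)" for x
    using measurable_argmin_selection[OF D_measurable D_compact car[of x]] D_ne by metis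
  then obtain F where F: "\<And>x. F x \<in> borel_measurable M" "\<And>x t. t \<in> space M \<Longrightarrow> F x t \<in> D t"
    "\<And>x t p. t \<in> space M \<Longrightarrow> p \<in> D t \<Longrightarrow> cost e d c t x (F x t) \<le> cost e d c t x p"
    by metis
  define J where "J x = (\<integral>t. cost e d c t x (F x t) \<partial>M)" for x
  have int: "integrable M (\<lambda>t. cost e d c t x (F x' t))" for x x'
    using F by (intro integrable_cost)
  have J_le: "J x \<le> (\<integral>t. cost e d c t x (F x' t) \<partial>M)" for x x'
    unfolding J_def using F by (intro integral_mono int) auto
  \<comment> \<open>The Lipschitz constant of \<open>J\<close>: a difference of squares is the
    difference of the norms, at most \<open>dist x x'\<close>, times their sum, at most
    \<open>2 * (r + r1)\<close>.\<close>
  define L where "L = (\<integral>t. c * ((k t + 1) * (2 * (r + r1))) \<partial>M)"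
  have r: "0 \<le> r" if "space M \<noteq> {}" using D_fst[OF _ D_base] that by fastforce
  have L_nonneg: "0 \<le> L"
    unfolding L_def
  proof (intro integral_nonneg_AE AE_I2 mult_nonneg_nonneg)
    fix t assume t: "t \<in> space M"
    then have "space M \<noteq> {}" by blast
    then show "0 \<le> k t + 1" "0 \<le> r + r1" using k_nonneg[OF t] r assms(3) by auto
  qed (use assms in auto)
  have J_diff: "J x' \<le> J x + L * dist x x'" if x: "x \<in> cball x0 r1" "x' \<in> cball x0 r1" for x x'
  proof -
    have "cost e d c t x' (F x t) \<le> cost e d c t x (F x t) + c * ((k t + 1) * (2 * (r + r1))) * dist x x'"
      if t: "t \<in> space M" for t
    proof -
      define u where "u = fst (F x t)"
      have u: "dist u x0 \<le> r" using D_fst[OF t F(2)[OF t]] by (simp add: u_def)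
      have 1: "norm (u - x') \<le> r + r1" "norm (u - x) \<le> r + r1"
        using u x dist_triangle[of u x' x0] dist_triangle[of u x x0] by (auto simp: dist_norm)
      have 2: "norm (u - x') - norm (u - x) \<le> dist x x'"
        using norm_triangle_ineq2[of "u - x'" "u - x"] by (simp add: dist_norm)
      have "norm (u - x') ^ 2 - norm (u - x) ^ 2 = (norm (u - x') - norm (u - x)) * (norm (u - x') + norm (u - x))"
        by (simp add: power2_eq_square algebra_simps)
      also have "\<dots> \<le> dist x x' * (norm (u - x') + norm (u - x))"
        using 2 by (intro mult_right_mono) auto
      also have "\<dots> \<le> dist x x' * (2 * (r + r1))"
        using 1 by (intro mult_left_mono) auto
      finally have "c * ((k t + 1) * (norm (u - x') ^ 2 - norm (u - x) ^ 2)) \<le> c * ((k t + 1) * (dist x x' * (2 * (r + r1))))"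
        using assms k_nonneg[OF t] by (intro mult_left_mono) auto
      then show ?thesis unfolding cost_def u_def[symmetric] by (simp add: algebra_simps)
    qed
    then have "(\<integral>t. cost e d c t x' (F x t) \<partial>M) \<le>
        (\<integral>t. cost e d c t x (F x t) + c * ((k t + 1) * (2 * (r + r1))) * dist x x' \<partial>M)"
      using int k_integrable by (intro integral_mono) auto
    also have "\<dots> = J x + L * dist x x'"
      unfolding J_def L_def using int[of x x] k_integrable by simp
    finally show ?thesis using J_le[of x' x] by simp
  qed
  have "L-lipschitz_on (cball x0 r1) J"
  proof (rule lipschitz_onI)
    fix x x' assume "x \<in> cball x0 r1" "x' \<in> cball x0 r1"
    then show "dist (J x) (J x') \<le> L * dist x x'"
      using J_diff[of x x'] J_diff[of x' x] by (simp add: dist_real_def dist_commute abs_le_iff)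
  qed (rule L_nonneg)
  then have "continuous_on (cball x0 r1) (\<lambda>x. objective e x + J x)"
    unfolding objective_def by (intro continuous_intros lipschitz_on_continuous_on)
  then have "\<exists>x\<in>cball x0 r1. \<forall>x'\<in>cball x0 r1. objective e x + J x \<le> objective e x' + J x'"
    using assms(3) by (intro continuous_attains_inf) auto
  then obtain x where x: "x \<in> cball x0 r1"
    "\<And>x'. x' \<in> cball x0 r1 \<Longrightarrow> objective e x + J x \<le> objective e x' + J x'" by blast
  show ?thesis
  proof (rule that[of x "F x"])
    fix x' assume "x' \<in> cball x0 r1"
    \<comment> \<open>Keeping the selection \<open>F x\<close> at another point \<open>x'\<close>
      can only increase the value, so \<open>x\<close> also minimises the problem with frozen
      selection, whose cost is quadratic in \<open>x'\<close>.\<close>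
    then show "objective e x + (\<integral>t. cost e d c t x (F x t) \<partial>M) \<le> objective e x' + (\<integral>t. cost e d c t x' (F x t) \<partial>M)"
      using x(2)[of x'] J_le[of x' x] by (simp add: J_def)
  next
    have "J x0 \<le> (\<integral>t. e * \<bar>d\<bar> \<partial>M)"
      unfolding J_def
    proof (intro integral_mono int)
      fix t assume t: "t \<in> space M"
      show "cost e d c t x0 (F x0 t) \<le> e * \<bar>d\<bar>"
        using F(3)[OF t D_base[OF t], of x0] by (simp add: cost_def)
    qed simp
    then show "objective e x + (\<integral>t. cost e d c t x (F x t) \<partial>M) \<le> e * \<bar>d\<bar> * measure M (space M)"
      using x(2)[of x0] assms(3) by (simp add: J_def objective_def ac_simps)
  qed (use x F in auto)
qed

text \<open>Minus the gradient of the smooth cost is a proximal normal to \<open>D t\<close> at a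
  minimiser. The constant on the right collects the exact quadratic term of the penalty and the
  curvature bound \<open>e / d\<close> of the smoothed norm, halved.\<close>

lemma minimiser_normal:
  assumes t: "t \<in> space M" and p: "p \<in> D t" "p' \<in> D t" and min: "cost e d c t x p \<le> cost e d c t x p'"
    and "e \<ge> 0" "d > 0" "c \<ge> 0"
  shows "inner ((2 * c * (k t + 1)) *\<^sub>R (x - fst p)) (fst p' - fst p)
      - inner (ys + (e / sqrt (d ^ 2 + norm (snd p - y0 t) ^ 2)) *\<^sub>R (snd p - y0 t)) (snd p' - snd p)
    \<le> (c * (k t + 1) + e / (2 * d)) * norm (p' - p) ^ 2"
proof -
  define u v u' v' where "u = fst p" and "v = snd p" and "u' = fst p'" and "v' = snd p'"
  define S where "S = sqrt (d ^ 2 + norm (v - y0 t) ^ 2)"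
  define w where "w = c * (k t + 1)"
  have w: "w \<ge> 0" using assms k_nonneg[OF t] by (simp add: w_def)
  have S: "S \<ge> d" unfolding S_def using \<open>d > 0\<close> by (intro real_le_rsqrt) simp
  then have "S > 0" using \<open>d > 0\<close> by linarith
  have "sqrt (d ^ 2 + norm ((v - y0 t) + (v' - v)) ^ 2) \<le>
      S + (inner (v - y0 t) (v' - v) + norm (v' - v) ^ 2 / 2) / S"
    unfolding S_def using \<open>d > 0\<close> by (intro norm_add_le_tangent) (auto intro: add_pos_nonneg)
  then have 1: "e * sqrt (d ^ 2 + norm (v' - y0 t) ^ 2) \<le>
      e * (S + (inner (v - y0 t) (v' - v) + norm (v' - v) ^ 2 / 2) / S)"
    using \<open>e \<ge> 0\<close> by (intro mult_left_mono) auto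
  have "norm (v' - v) ^ 2 / (2 * S) \<le> norm (v' - v) ^ 2 / (2 * d)"
    using S \<open>d > 0\<close> by (intro divide_left_mono) auto
  then have 2: "e * (norm (v' - v) ^ 2 / (2 * S)) \<le> e * (norm (v' - v) ^ 2 / (2 * d))"
    using \<open>e \<ge> 0\<close> by (intro mult_left_mono) auto
  have "u' - x = (u' - u) + (u - x)" by simp
  then have "norm (u' - x) ^ 2 = norm (u - x) ^ 2 + 2 * inner (u - x) (u' - u) + norm (u' - u) ^ 2"
    by (simp only: power2_norm_eq_inner inner_add) (simp add: inner_commute)
  then have 3: "w * norm (u' - x) ^ 2 = w * norm (u - x) ^ 2 + 2 * w * inner (u - x) (u' - u) + w * norm (u' - u) ^ 2"
    by (simp add: distrib_left ac_simps)
  have 4: "inner ys (v' - y0 t) = inner ys (v - y0 t) + inner ys (v' - v)"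
    by (simp add: inner_diff_right)
  have "inner ys (v - y0 t) + e * S + w * norm (u - x) ^ 2 \<le>
      inner ys (v' - y0 t) + e * sqrt (d ^ 2 + norm (v' - y0 t) ^ 2) + w * norm (u' - x) ^ 2"
    using min by (simp add: cost_def u_def v_def u'_def v'_def S_def w_def)
  then have "inner ys (v - y0 t) + e * S + w * norm (u - x) ^ 2 \<le>
      inner ys (v - y0 t) + inner ys (v' - v)
      + (e * S + (e / S) * inner (v - y0 t) (v' - v) + e * (norm (v' - v) ^ 2 / (2 * d)))
      + (w * norm (u - x) ^ 2 + 2 * w * inner (u - x) (u' - u) + w * norm (u' - u) ^ 2)"
    using 1 2 3 4 by (simp add: add_divide_distrib distrib_left)
  then have "- (2 * w * inner (u - x) (u' - u)) - (inner ys (v' - v) + (e / S) * inner (v - y0 t) (v' - v))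
      \<le> w * norm (u' - u) ^ 2 + e / (2 * d) * norm (v' - v) ^ 2"
    by simp
  also have "\<dots> \<le> w * norm (p' - p) ^ 2 + e / (2 * d) * norm (p' - p) ^ 2"
  proof -
    have "norm (p' - p) ^ 2 = norm (u' - u) ^ 2 + norm (v' - v) ^ 2"
      by (simp add: norm_prod_def u_def u'_def v_def v'_def)
    then show ?thesis
      using w \<open>e \<ge> 0\<close> \<open>d > 0\<close> by (intro add_mono mult_left_mono) auto
  qed
  finally have "- (2 * w * inner (u - x) (u' - u)) - (inner ys (v' - v) + (e / S) * inner (v - y0 t) (v' - v))
      \<le> (w + e / (2 * d)) * norm (p' - p) ^ 2"
    by (simp only: distrib_right)
  moreover have "inner ((2 * c * (k t + 1)) *\<^sub>R (x - u)) (u' - u) = - (2 * w * inner (u - x) (u' - u))"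
    by (simp add: w_def inner_diff_left algebra_simps)
  moreover have "inner (ys + (e / S) *\<^sub>R (v - y0 t)) (v' - v) = inner ys (v' - v) + (e / S) * inner (v - y0 t) (v' - v)"
    by (simp add: inner_add_left)
  ultimately show ?thesis
    unfolding u_def v_def u'_def v'_def S_def w_def by simp
qed

text \<open>Comparison with the base point \<open>(x0, y0 t)\<close>. Since the weight
  \<open>k t + 1\<close> cancels, the bound does not depend on \<open>t\<close>; this provides the
  convergence in the essential supremum norm.\<close>

lemma minimiser_near:
  assumes t: "t \<in> space M" and p: "p \<in> D t"
    and min: "cost e d c t x p \<le> cost e d c t x (x0, y0 t)" and "e \<ge> 0" "d \<ge> 0" "c > 0"
  shows "norm (fst p - x) ^ 2 \<le> norm (x0 - x) ^ 2 + (e * d + 2 * norm ys) / c"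
proof -
  define w where "w = k t + 1"
  have w: "w \<ge> 1" using k_nonneg[OF t] by (simp add: w_def)
  have "- inner ys (snd p - y0 t) \<le> norm ys * norm (snd p - y0 t)"
    using Cauchy_Schwarz_ineq2[of ys "snd p - y0 t"] by simp
  also have "\<dots> \<le> norm ys * (2 * k t)" using norm_diff_y0[OF t p] by (intro mult_left_mono) auto
  finally have lower: "- inner ys (snd p - y0 t) \<le> norm ys * (2 * k t)" .
  have "c * (w * norm (fst p - x) ^ 2) \<le> e * d + 2 * norm ys * k t + c * (w * norm (x0 - x) ^ 2)"
  proof -
    have "0 \<le> e * sqrt (d ^ 2 + norm (snd p - y0 t) ^ 2)" using \<open>e \<ge> 0\<close> by simp
    moreover have "inner ys (snd p - y0 t) + e * sqrt (d ^ 2 + norm (snd p - y0 t) ^ 2)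
        + c * (w * norm (fst p - x) ^ 2) \<le> e * d + c * (w * norm (x0 - x) ^ 2)"
      using min \<open>d \<ge> 0\<close> by (simp add: cost_def w_def)
    ultimately show ?thesis using lower by (simp add: mult.commute mult.left_commute)
  qed
  \<comment> \<open>Both summands are absorbed by the weight: \<open>1 \<le> w\<close> handles
    \<open>e * d\<close>, and \<open>k t \<le> w\<close> the other one.\<close>
  also have "e * d + 2 * norm ys * k t \<le> (e * d + 2 * norm ys) * w"
  proof -
    have "e * d * 1 \<le> e * d * w" using w \<open>e \<ge> 0\<close> \<open>d \<ge> 0\<close> by (intro mult_left_mono) auto
    then show ?thesis by (simp add: w_def algebra_simps)
  qed
  finally have upper: "c * (w * norm (fst p - x) ^ 2) \<le> (e * d + 2 * norm ys) * w + c * (w * norm (x0 - x) ^ 2)"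
    by simp
  have "(c * w) * norm (fst p - x) ^ 2 \<le> (c * w) * (norm (x0 - x) ^ 2 + (e * d + 2 * norm ys) / c)"
  proof -
    have "(c * w) * (norm (x0 - x) ^ 2 + (e * d + 2 * norm ys) / c)
        = (e * d + 2 * norm ys) * w + c * (w * norm (x0 - x) ^ 2)"
      using \<open>c > 0\<close> by (simp add: field_simps)
    then show ?thesis using upper by (simp only: mult.assoc)
  qed
  then show ?thesis using \<open>c > 0\<close> w by (subst (asm) mult_le_cancel_left_pos) auto
qed

text \<open>With frozen selection the cost is exactly quadratic in \<open>x\<close>, and the
  integrand is its gradient, minus the gradient in \<open>u\<close>. The interior minimum leaves
  only the term \<open>e * norm (x - x0)\<close> as slack, whence the error
  \<open>e\<close>.\<close>

lemma minimiser_first_order: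
  assumes f [measurable]: "f \<in> borel_measurable M" and D: "\<And>t. t \<in> space M \<Longrightarrow> f t \<in> D t"
    and min: "\<And>x'. x' \<in> cball x0 r1 \<Longrightarrow>
      objective e x + (\<integral>t. cost e d c t x (f t) \<partial>M) \<le> objective e x' + (\<integral>t. cost e d c t x' (f t) \<partial>M)"
    and x: "dist x x0 < r1" and "c \<ge> 0" "e \<ge> 0"
  shows "integrable M (\<lambda>t. (2 * c * (k t + 1)) *\<^sub>R (x - fst (f t)))"
    and "norm ((\<integral>t. (2 * c * (k t + 1)) *\<^sub>R (x - fst (f t)) \<partial>M) - xs) \<le> e"
proof -
  define G where "G t = (2 * c * (k t + 1)) *\<^sub>R (x - fst (f t))" for t
  have [measurable]: "(\<lambda>t. fst (f t)) \<in> borel_measurable M" by (rule borel_measurable_fst_snd[OF f])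
  show G_int: "integrable M (\<lambda>t. (2 * c * (k t + 1)) *\<^sub>R (x - fst (f t)))"
  proof (rule Bochner_Integration.integrable_bound)
    show "integrable M (\<lambda>t. 2 * c * (k t + 1) * (r + dist x x0))" using k_integrable by simp
    show "AE t in M. norm ((2 * c * (k t + 1)) *\<^sub>R (x - fst (f t))) \<le> norm (2 * c * (k t + 1) * (r + dist x x0))"
    proof (rule AE_I2)
      fix t assume t: "t \<in> space M"
      have "norm (x - fst (f t)) \<le> r + dist x x0"
        using D_fst[OF t D[OF t]] dist_triangle2[of "fst (f t)" x x0] by (simp add: dist_norm norm_minus_commute)
      then have "norm (x - fst (f t)) \<le> \<bar>r + dist x x0\<bar>" by linarith
      then show "norm ((2 * c * (k t + 1)) *\<^sub>R (x - fst (f t))) \<le> norm (2 * c * (k t + 1) * (r + dist x x0))"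
        using k_nonneg[OF t] \<open>c \<ge> 0\<close> by (simp add: abs_mult mult_left_mono)
    qed
  qed measurable
  define X where "X = (\<integral>t. G t \<partial>M)"
  define W where "W = (\<integral>t. c * (k t + 1) \<partial>M)"
  have W: "W \<ge> 0" unfolding W_def using k_nonneg \<open>c \<ge> 0\<close> by (intro integral_nonneg_AE AE_I2) auto
  define z where "z = xs - X"
  have ineq: "inner z h \<le> e * norm h + W * norm h ^ 2" if h: "norm h < r1 - dist x x0" for h
  proof -
    have "dist (x + h) x0 \<le> norm h + dist x x0"
      by (simp add: dist_norm) (metis add.commute add_diff_eq norm_triangle_ineq)
    then have "x + h \<in> cball x0 r1" using h by (simp add: dist_commute)
    then have 1: "objective e x + (\<integral>t. cost e d c t x (f t) \<partial>M) \<le> objective e (x + h) + (\<integral>t. cost e d c t (x + h) (f t) \<partial>M)"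
      by (rule min)
    have cost: "cost e d c t (x + h) (f t) = cost e d c t x (f t) + (inner (G t) h + c * (k t + 1) * norm h ^ 2)" for t
    proof -
      have "norm (fst (f t) - (x + h)) ^ 2 = norm (fst (f t) - x) ^ 2 + (2 * inner (x - fst (f t)) h + norm h ^ 2)"
        by (simp add: power2_norm_eq_inner inner_diff inner_add inner_commute algebra_simps)
      then show ?thesis by (simp add: cost_def G_def distrib_left distrib_right ac_simps)
    qed
    have "(\<integral>t. cost e d c t (x + h) (f t) \<partial>M) = (\<integral>t. cost e d c t x (f t) \<partial>M) + (inner X h + W * norm h ^ 2)"
      unfolding cost using integrable_cost[OF f D, of e d c x] G_int k_integrable
      by (simp add: X_def W_def G_def[symmetric])
    moreover have "objective e (x + h) \<le> objective e x + e * norm h - inner xs h"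
    proof -
      have "norm (x + h - x0) \<le> norm (x - x0) + norm h"
        by (metis add_diff_eq add.commute diff_add_eq norm_triangle_ineq)
      then have "e * norm (x + h - x0) \<le> e * (norm (x - x0) + norm h)"
        using \<open>e \<ge> 0\<close> by (rule mult_left_mono)
      then show ?thesis by (simp add: objective_def algebra_simps)
    qed
    ultimately show ?thesis using 1 by (simp add: z_def inner_diff_left)
  qed
  have "norm z \<le> e"
  proof (rule ccontr)
    assume "\<not> norm z \<le> e"
    then have ze: "norm z > e" "norm z > 0" using \<open>e \<ge> 0\<close> by auto
    \<comment> \<open>The step \<open>s *\<^sub>R z\<close> stays within the ball, and the second
      bound makes its quadratic term contribute at most half of the assumed excess
      \<open>norm z - e\<close>.\<close>
    define s where "s = min ((r1 - dist x x0) / (2 * norm z)) ((norm z - e) / (2 * (W + 1) * norm z))"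
    have s: "s > 0" unfolding s_def using ze x W by auto
    have "s * norm z \<le> (r1 - dist x x0) / (2 * norm z) * norm z"
      unfolding s_def using ze by (intro mult_right_mono) auto
    also have "\<dots> = (r1 - dist x x0) / 2" using ze by simp
    finally have "s * norm z < r1 - dist x x0" using x by simp
    then have "inner z (s *\<^sub>R z) \<le> e * norm (s *\<^sub>R z) + W * norm (s *\<^sub>R z) ^ 2"
      using s by (intro ineq) simp
    then have "(s * norm z) * norm z \<le> (s * norm z) * (e + W * (s * norm z))"
      using s by (simp add: power2_norm_eq_inner[symmetric] power2_eq_square algebra_simps)
    then have "norm z \<le> e + W * (s * norm z)" using s ze by simp
    moreover have "(W + 1) * (s * norm z) \<le> (W + 1) * ((norm z - e) / (2 * (W + 1) * norm z) * norm z)"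
      unfolding s_def using ze W by (intro mult_left_mono mult_right_mono) auto
    moreover have "\<dots> = (norm z - e) / 2"
    proof -
      have *: "a * (b / (2 * a * n) * n) = b / 2" if "a > 0" "n > 0" for a b n :: real
        using that by simp
      show ?thesis by (rule *) (use ze W in auto)
    qed
    moreover have "W * (s * norm z) \<le> (W + 1) * (s * norm z)" using s ze by simp
    ultimately show False using ze by simp
  qed
  then show "norm ((\<integral>t. (2 * c * (k t + 1)) *\<^sub>R (x - fst (f t)) \<partial>M) - xs) \<le> e"
    by (simp add: z_def X_def G_def norm_minus_commute)
qed

lemma integral_q:
  assumes "v \<in> borel_measurable M" "AE t in M. (u t, v t) \<in> D t"
  shows "(\<integral>t. q e t (v t) \<partial>M) = inner ys (\<integral>t. v t - y0 t \<partial>M) + e * (\<integral>t. norm (v t - y0 t) \<partial>M)"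
  unfolding q_def using integrable_diff_y0[OF assms] by simp

text \<open>\<open>H\<close> gives a lower bound with \<open>e\<close>, but the problem is solved
  with \<open>2*e\<close>; the surplus \<open>e * norm (x - x0)\<close> and \<open>e\<close> times
  the \<open>L1\<close> distance are squeezed to zero. Smoothing is tied to the penalty by
  \<open>d = 1/c\<close>.\<close>

lemma penalised_sequence:
  assumes "e > 0" "r1 > 0" "s > 0"
    and H: "\<And>x v. x \<in> cball x0 r1 \<Longrightarrow> v \<in> borel_measurable M \<Longrightarrow> (AE t in M. (x, v t) \<in> D t) \<Longrightarrow>
      - objective e x \<le> (\<integral>t. q e t (v t) \<partial>M)"
  obtains x f c where "dist x x0 < r1" "dist x x0 \<le> s" "c > 0" "f \<in> borel_measurable M"
    "\<And>t. t \<in> space M \<Longrightarrow> f t \<in> D t"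
    "\<And>t p. t \<in> space M \<Longrightarrow> p \<in> D t \<Longrightarrow> cost (2*e) (1/c) c t x (f t) \<le> cost (2*e) (1/c) c t x p"
    "\<And>x'. x' \<in> cball x0 r1 \<Longrightarrow>
      objective (2*e) x + (\<integral>t. cost (2*e) (1/c) c t x (f t) \<partial>M)
        \<le> objective (2*e) x' + (\<integral>t. cost (2*e) (1/c) c t x' (f t) \<partial>M)"
    "\<And>t. t \<in> space M \<Longrightarrow> norm (fst (f t) - x0) \<le> s"
    "(\<integral>t. norm (snd (f t) - y0 t) \<partial>M) \<le> s"
    "c * (\<integral>t. (k t + 1) * norm (fst (f t) - x) ^ 2 \<partial>M) \<le> s"
proof -
  define c where "c n = real (Suc n)" for n
  have c: "c n > 0" for n by (simp add: c_def)
  define good where "good n x f \<longleftrightarrow> x \<in> cball x0 r1 \<and> f \<in> borel_measurable M \<and> (\<forall>t\<in>space M. f t \<in> D t) \<and>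
     (\<forall>t\<in>space M. \<forall>p\<in>D t. cost (2*e) (1/c n) (c n) t x (f t) \<le> cost (2*e) (1/c n) (c n) t x p) \<and>
     (\<forall>x'\<in>cball x0 r1. objective (2*e) x + (\<integral>t. cost (2*e) (1/c n) (c n) t x (f t) \<partial>M)
        \<le> objective (2*e) x' + (\<integral>t. cost (2*e) (1/c n) (c n) t x' (f t) \<partial>M)) \<and>
     objective (2*e) x + (\<integral>t. cost (2*e) (1/c n) (c n) t x (f t) \<partial>M) \<le> 2 * e * \<bar>1/c n\<bar> * measure M (space M)"
     for n x f
  have "\<exists>x f. good n x f" for n
  proof -
    have "0 \<le> 2 * e" "0 \<le> c n" "0 \<le> r1" using assms(1-3) c[of n] by auto
    then show ?thesis
      unfolding good_def by (rule penalised_minimiser[where d = "1 / c n"]) blast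
  qed
  then obtain X F where "\<And>n. good n (X n) (F n)" by metis
  then have X: "\<And>n. X n \<in> cball x0 r1"
    and F_meas: "\<And>n. F n \<in> borel_measurable M" and F: "\<And>n t. t \<in> space M \<Longrightarrow> F n t \<in> D t"
    and F_min: "\<And>n t p. t \<in> space M \<Longrightarrow> p \<in> D t \<Longrightarrow>
        cost (2*e) (1/c n) (c n) t (X n) (F n t) \<le> cost (2*e) (1/c n) (c n) t (X n) p"
    and X_min: "\<And>n x'. x' \<in> cball x0 r1 \<Longrightarrow>
        objective (2*e) (X n) + (\<integral>t. cost (2*e) (1/c n) (c n) t (X n) (F n t) \<partial>M)
        \<le> objective (2*e) x' + (\<integral>t. cost (2*e) (1/c n) (c n) t x' (F n t) \<partial>M)"
    and val: "\<And>n. objective (2*e) (X n) + (\<integral>t. cost (2*e) (1/c n) (c n) t (X n) (F n t) \<partial>M)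
        \<le> 2 * e * \<bar>1/c n\<bar> * measure M (space M)"
    unfolding good_def by blast+
  define v where "v n t = snd (F n t)" for n t
  define u where "u n t = fst (F n t)" for n t
  have v_meas: "v n \<in> borel_measurable M" and u_meas: "u n \<in> borel_measurable M" for n
    unfolding v_def u_def by (rule borel_measurable_fst_snd[OF F_meas])+
  have uv: "AE t in M. (u n t, v n t) \<in> D t" for n
    unfolding u_def v_def using F by (intro AE_I2) simp
  define Y where "Y n = (\<integral>t. norm (v n t - y0 t) \<partial>M)" for n
  define Pn where "Pn n = c n * (\<integral>t. (k t + 1) * norm (u n t - X n) ^ 2 \<partial>M)" for n
  have int_pen: "integrable M (\<lambda>t. (k t + 1) * norm (u n t - X n) ^ 2)" for n
    unfolding u_def by (rule integrable_penalty[OF F_meas F])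
  have Pn_nonneg: "Pn n \<ge> 0" for n
    unfolding Pn_def using c[of n] k_nonneg
    by (intro mult_nonneg_nonneg integral_nonneg_AE AE_I2) (auto simp: add_nonneg_nonneg)
  have Y_nonneg: "Y n \<ge> 0" for n
    unfolding Y_def by simp
  define m where "m = measure M (space M)"
  \<comment> \<open>Half of the weight \<open>2*e\<close> completes \<open>q e\<close>, the other
    half stays as \<open>e * Y n\<close>; smoothing only increases the norm, so it may be dropped on
    the left.\<close>
  have master: "objective (2*e) (X n) + (\<integral>t. q e t (v n t) \<partial>M) + e * Y n + Pn n \<le> 2 * e * (1 / c n) * m" for n
  proof -
    note i = integrable_diff_y0[OF v_meas[of n] uv[of n]]
      integrable_sqrt[OF v_meas[of n] uv[of n], where d = "1 / c n"]
    have "Y n \<le> (\<integral>t. sqrt ((1/c n) ^ 2 + norm (v n t - y0 t) ^ 2) \<partial>M)"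
      unfolding Y_def using i by (intro integral_mono integrable_norm real_le_rsqrt) auto
    then have "2 * e * Y n \<le> 2 * e * (\<integral>t. sqrt ((1/c n) ^ 2 + norm (v n t - y0 t) ^ 2) \<partial>M)"
      using \<open>e > 0\<close> by simp
    moreover have "(\<integral>t. cost (2*e) (1/c n) (c n) t (X n) (F n t) \<partial>M) =
       inner ys (\<integral>t. v n t - y0 t \<partial>M) + 2 * e * (\<integral>t. sqrt ((1/c n) ^ 2 + norm (v n t - y0 t) ^ 2) \<partial>M) + Pn n"
      unfolding cost_def Pn_def u_def[symmetric] v_def[symmetric] using i int_pen[of n] by simp
    moreover have "(\<integral>t. q e t (v n t) \<partial>M) = inner ys (\<integral>t. v n t - y0 t \<partial>M) + e * Y n"
      unfolding Y_def by (rule integral_q[OF v_meas uv])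
    ultimately show ?thesis using val[of n] c[of n] by (simp add: m_def)
  qed
  have inv_c: "(\<lambda>n. A / c n) \<longlonglongrightarrow> 0" for A
    using tendsto_mult[OF tendsto_const[of A] LIMSEQ_inverse_real_of_nat] by (simp add: c_def divide_inverse)
  \<comment> \<open>A bound for \<open>Pn n\<close> independent of \<open>n\<close>. As
    \<open>Pn n\<close> carries the factor \<open>c n\<close>, the mean square of
    \<open>u n - X n\<close> tends to zero, so a further subsequence converges a.e.\<close>
  define A where "A = 2 * e * m + norm xs * r1 + norm ys * (\<integral>t. 2 * k t \<partial>M)"
  have sq_lim: "(\<lambda>n. \<integral>t. norm (norm (u n t - X n) ^ 2) \<partial>M) \<longlonglongrightarrow> 0"
  proof (rule tendsto_sandwich[OF _ _ tendsto_const inv_c[of A]])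
    have "(\<integral>t. norm (norm (u n t - X n) ^ 2) \<partial>M) \<le> A / c n" for n
    proof -
      have "(\<integral>t. norm (norm (u n t - X n) ^ 2) \<partial>M) \<le> (\<integral>t. (k t + 1) * norm (u n t - X n) ^ 2 \<partial>M)"
      proof (rule integral_mono_AE'[OF int_pen])
        show "AE t in M. norm (norm (u n t - X n) ^ 2) \<le> (k t + 1) * norm (u n t - X n) ^ 2"
          using k_nonneg by (intro AE_I2) (simp add: distrib_right)
        show "AE t in M. 0 \<le> (k t + 1) * norm (u n t - X n) ^ 2"
          using k_nonneg by (intro AE_I2) (simp add: add_nonneg_nonneg)
      qed
      also have "\<dots> = Pn n / c n" using c[of n] by (simp add: Pn_def)
      also have "Pn n \<le> A"
      proof -
        have 1: "inner xs (X n - x0) \<le> norm xs * r1"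
          using norm_cauchy_schwarz[of xs "X n - x0"] X[of n] mult_left_mono[of "norm (X n - x0)" r1 "norm xs"]
          by (simp add: dist_norm norm_minus_commute)
        have "0 \<le> e * norm (X n - x0)" using \<open>e > 0\<close> by simp
        then have obj: "- (norm xs * r1) \<le> objective (2*e) (X n)" using 1 by (simp add: objective_def)
        have "Y n \<le> (\<integral>t. 2 * k t \<partial>M)"
          unfolding Y_def
        proof (rule integral_mono_AE)
          show "AE t in M. norm (v n t - y0 t) \<le> 2 * k t"
            unfolding v_def using norm_diff_y0[OF _ F] by (intro AE_I2) auto
        qed (use integrable_diff_y0[OF v_meas uv] k_integrable in auto)
        then have "norm ys * Y n \<le> norm ys * (\<integral>t. 2 * k t \<partial>M)" by (intro mult_left_mono) auto
        moreover have "- inner ys (\<integral>t. v n t - y0 t \<partial>M) \<le> norm ys * Y n"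
          unfolding Y_def
          using Cauchy_Schwarz_ineq2[of ys "\<integral>t. v n t - y0 t \<partial>M"]
            mult_left_mono[OF integral_norm_bound[of M "\<lambda>t. v n t - y0 t"], of "norm ys"] by simp
        moreover have "(\<integral>t. q e t (v n t) \<partial>M) = inner ys (\<integral>t. v n t - y0 t \<partial>M) + e * Y n"
          unfolding Y_def by (rule integral_q[OF v_meas uv])
        moreover have "0 \<le> e * Y n" using \<open>e > 0\<close> Y_nonneg by simp
        moreover have "2 * e * (1 / c n) * m \<le> 2 * e * 1 * m"
          using \<open>e > 0\<close> by (intro mult_right_mono mult_left_mono) (auto simp: c_def m_def)
        ultimately show ?thesis using master[of n] obj by (simp add: A_def)
      qed
      finally show ?thesis using c[of n] by (simp add: divide_right_mono)
    qed
    then show "\<forall>\<^sub>F n in sequentially. (\<integral>t. norm (norm (u n t - X n) ^ 2) \<partial>M) \<le> A / c n" by simp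
  qed simp
  have int_sq: "integrable M (\<lambda>t. norm (u n t - X n) ^ 2)" for n
  proof (rule Bochner_Integration.integrable_bound[OF int_pen[of n]])
    show "AE t in M. norm (norm (u n t - X n) ^ 2) \<le> norm ((k t + 1) * norm (u n t - X n) ^ 2)"
      using k_nonneg by (intro AE_I2) (simp add: abs_mult distrib_right)
  qed (use u_meas in measurable)
  obtain x \<sigma>1 where \<sigma>1: "strict_mono \<sigma>1" "(X \<circ> \<sigma>1) \<longlonglongrightarrow> x" and x: "x \<in> cball x0 r1"
    using compact_cball[of x0 r1] X unfolding compact_def by metis
  define Z where "Z n t = norm (u (\<sigma>1 n) t - X (\<sigma>1 n)) ^ 2" for n t
  have "(\<lambda>n. \<integral>t. norm (norm (u (\<sigma>1 n) t - X (\<sigma>1 n)) ^ 2) \<partial>M) \<longlonglongrightarrow> 0"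
    using LIMSEQ_subseq_LIMSEQ[OF sq_lim \<sigma>1(1)] by (simp add: o_def)
  then have Z: "(\<lambda>n. \<integral>t. norm (Z n t) \<partial>M) \<longlonglongrightarrow> 0" unfolding Z_def .
  have Z_int: "integrable M (Z n)" for n unfolding Z_def by (rule int_sq)
  have "\<exists>\<sigma>2. strict_mono \<sigma>2 \<and> (AE t in M. (\<lambda>n. Z (\<sigma>2 n) t) \<longlonglongrightarrow> 0)"
    by (rule tendsto_L1_AE_subseq[OF Z_int Z])
  then obtain \<sigma>2 where \<sigma>2: "strict_mono \<sigma>2" "AE t in M. (\<lambda>n. Z (\<sigma>2 n) t) \<longlonglongrightarrow> 0"
    by (elim exE conjE)
  define \<sigma> where "\<sigma> = \<sigma>1 \<circ> \<sigma>2"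
  have \<sigma>: "strict_mono \<sigma>" unfolding \<sigma>_def using \<sigma>1(1) \<sigma>2(1) by (rule strict_mono_o)
  have X_lim: "(\<lambda>n. X (\<sigma> n)) \<longlonglongrightarrow> x"
    using LIMSEQ_subseq_LIMSEQ[OF \<sigma>1(2) \<sigma>2(1)] by (simp add: \<sigma>_def o_def)
  have u_lim: "AE t in M. (\<lambda>n. u (\<sigma> n) t) \<longlonglongrightarrow> x"
    using \<sigma>2(2)
  proof eventually_elim
    case (elim t)
    have "(\<lambda>n. sqrt (norm (u (\<sigma> n) t - X (\<sigma> n)) ^ 2)) \<longlonglongrightarrow> sqrt 0"
      using elim by (intro tendsto_real_sqrt) (simp add: \<sigma>_def Z_def)
    then have "(\<lambda>n. u (\<sigma> n) t - X (\<sigma> n)) \<longlonglongrightarrow> 0" by (simp add: tendsto_norm_zero_iff)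
    from tendsto_add[OF this X_lim] show ?case by simp
  qed
  \<comment> \<open>The surplus terms will be at most \<open>3 * T\<close>: this gives at most
    \<open>e * min s r1 / 4\<close> for those weighted by \<open>e\<close>, and at most
    \<open>s\<close> for the penalty.\<close>
  define T where "T = min 1 (min (e * min s r1 / 16) (s / 4))"
  have T: "T > 0" using assms(1-3) by (simp add: T_def)
  have inv_\<sigma>: "(\<lambda>n. A' / c (\<sigma> n)) \<longlonglongrightarrow> 0" for A'
    using LIMSEQ_subseq_LIMSEQ[OF inv_c \<sigma>] by (simp add: o_def)
  \<comment> \<open>The limit \<open>x\<close> is not yet known to be \<open>x0\<close>. It lies in
    the ball, so \<open>H\<close> applies at \<open>x\<close>, and the surplus terms then force the
    iterates close to \<open>x0\<close>.\<close>
  have ev1: "\<forall>\<^sub>F n in sequentially. - objective e x - T \<le> (\<integral>t. q e t (v (\<sigma> n) t) \<partial>M)"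
  proof (rule eventually_integral_q_ge[where u = "\<lambda>n. u (\<sigma> n)" and x = x])
    show "- objective e x \<le> (\<integral>t. q e t (w t) \<partial>M)"
      if "w \<in> borel_measurable M" "AE t in M. (x, w t) \<in> D t" for w
      by (rule H[OF x that])
  qed (fact v_meas uv u_lim T)+
  have "(\<lambda>n. objective e (X (\<sigma> n))) \<longlonglongrightarrow> objective e x"
    unfolding objective_def by (intro tendsto_intros X_lim)
  then have ev2: "\<forall>\<^sub>F n in sequentially. dist (objective e (X (\<sigma> n))) (objective e x) < T"
    by (rule tendstoD[OF _ T])
  have ev3: "\<forall>\<^sub>F n in sequentially. (2 * e * m) / c (\<sigma> n) < T"
    by (rule order_tendstoD(2)[OF inv_\<sigma> T])
  have ev4: "\<forall>\<^sub>F n in sequentially. (2 * e * 1 + 2 * norm ys) / c (\<sigma> n) < s ^ 2 / 16"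
    using \<open>s > 0\<close> by (intro order_tendstoD(2)[OF inv_\<sigma>]) simp
  have "\<forall>\<^sub>F n in sequentially. - objective e x - T \<le> (\<integral>t. q e t (v (\<sigma> n) t) \<partial>M) \<and>
     dist (objective e (X (\<sigma> n))) (objective e x) < T \<and> (2 * e * m) / c (\<sigma> n) < T \<and>
     (2 * e * 1 + 2 * norm ys) / c (\<sigma> n) < s ^ 2 / 16"
    by (intro eventually_conj ev1 ev2 ev3 ev4)
  then obtain n0 where n0: "- objective e x - T \<le> (\<integral>t. q e t (v (\<sigma> n0) t) \<partial>M)"
     "dist (objective e (X (\<sigma> n0))) (objective e x) < T" "(2 * e * m) / c (\<sigma> n0) < T"
     "(2 * e * 1 + 2 * norm ys) / c (\<sigma> n0) < s ^ 2 / 16"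
    using eventually_happens'[OF sequentially_bot] by blast
  define n where "n = \<sigma> n0"
  have obj2: "objective (2*e) (X n) = objective e (X n) + e * norm (X n - x0)"
    by (simp add: objective_def)
  have sum: "e * norm (X n - x0) + e * Y n + Pn n \<le> 3 * T"
    using master[of n] n0(1,2,3) obj2 unfolding n_def[symmetric] by (simp add: dist_real_def abs_less_iff)
  have nn: "0 \<le> e * norm (X n - x0)" "0 \<le> e * Y n" using \<open>e > 0\<close> Y_nonneg by auto
  have T_le: "T \<le> e * min s r1 / 16" "T \<le> s / 4" by (auto simp: T_def)
  have "e * norm (X n - x0) \<le> e * (min s r1 / 4)"
    using sum nn Pn_nonneg[of n] T_le by linarith
  then have X_near: "norm (X n - x0) \<le> min s r1 / 4" using \<open>e > 0\<close> by simp
  have "e * Y n \<le> e * (min s r1 / 4)"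
    using sum nn Pn_nonneg[of n] T_le by linarith
  then have Y_small: "Y n \<le> min s r1 / 4" using \<open>e > 0\<close> by simp
  have dist: "dist (X n) x0 < r1" "dist (X n) x0 \<le> s"
    using X_near \<open>r1 > 0\<close> \<open>s > 0\<close> by (auto simp: dist_norm)
  have Y_s: "(\<integral>t. norm (snd (F n t) - y0 t) \<partial>M) \<le> s"
    using Y_small \<open>s > 0\<close> by (simp add: Y_def v_def min_def split: if_splits)
  have P_s: "c n * (\<integral>t. (k t + 1) * norm (fst (F n t) - X n) ^ 2 \<partial>M) \<le> s"
    using sum nn T_le \<open>s > 0\<close> by (simp add: Pn_def u_def)
  have fst_s: "norm (fst (F n t) - x0) \<le> s" if t: "t \<in> space M" for t
  proof -
    have "norm (fst (F n t) - X n) ^ 2 \<le> norm (x0 - X n) ^ 2 + (2 * e * (1 / c n) + 2 * norm ys) / c n"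
    proof (rule minimiser_near[OF t F[OF t]])
      show "cost (2 * e) (1 / c n) (c n) t (X n) (F n t) \<le> cost (2 * e) (1 / c n) (c n) t (X n) (x0, y0 t)"
        by (rule F_min[OF t D_base[OF t]])
    qed (use \<open>e > 0\<close> c[of n] in simp_all)
    also have "\<dots> \<le> (s / 4) ^ 2 + s ^ 2 / 16"
    proof (rule add_mono)
      show "norm (x0 - X n) ^ 2 \<le> (s / 4) ^ 2"
        using X_near by (intro power_mono) (auto simp: norm_minus_commute)
      have "2 * e * (1 / c n) \<le> 2 * e * 1" using \<open>e > 0\<close> by (intro mult_left_mono) (auto simp: c_def)
      then have "(2 * e * (1 / c n) + 2 * norm ys) / c n \<le> (2 * e * 1 + 2 * norm ys) / c n"
        using c[of n] by (intro divide_right_mono) auto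
      then show "(2 * e * (1 / c n) + 2 * norm ys) / c n \<le> s ^ 2 / 16"
        using n0(4) unfolding n_def[symmetric] by linarith
    qed
    also have "\<dots> \<le> (s / 2) ^ 2" by (simp add: power2_eq_square)
    finally have "norm (fst (F n t) - X n) \<le> s / 2" by (rule power2_le_imp_le) (use \<open>s > 0\<close> in simp)
    then show "norm (fst (F n t) - x0) \<le> s"
      using X_near \<open>s > 0\<close> norm_triangle_ineq[of "fst (F n t) - X n" "X n - x0"] by simp
  qed
  show ?thesis
    by (rule that[of "X n" "c n" "F n", OF dist c F_meas F F_min X_min fst_s Y_s P_s])
qed

text \<open>\<open>a\<close> is minus the \<open>u\<close>-gradient of the penalty and
  \<open>b\<close> the \<open>v\<close>-gradient of the remaining cost. Thus
  \<open>norm (a t) * norm (u t - x)\<close> is exactly twice the penalty, and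
  \<open>b t - ys\<close> is \<open>2 * e\<close> times a vector of norm at most \<open>1\<close>,
  whatever the smoothing.\<close>

lemma approximate_multipliers:
  assumes "e > 0" "r1 > 0" "s > 0"
    and H: "\<And>x v. x \<in> cball x0 r1 \<Longrightarrow> v \<in> borel_measurable M \<Longrightarrow> (AE t in M. (x, v t) \<in> D t) \<Longrightarrow>
      - objective e x \<le> (\<integral>t. q e t (v t) \<partial>M)"
  obtains x u v a b where "dist x x0 \<le> s" "u \<in> borel_measurable M" "v \<in> borel_measurable M"
    "integrable M a" "b \<in> borel_measurable M" "\<And>t. t \<in> space M \<Longrightarrow> (u t, v t) \<in> D t"
    "\<And>t. t \<in> space M \<Longrightarrow> \<exists>C. \<forall>p\<in>D t. inner (a t, - b t) (p - (u t, v t)) \<le> C * norm (p - (u t, v t)) ^ 2"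
    "\<And>t. t \<in> space M \<Longrightarrow> norm (u t - x0) \<le> s" "\<And>t. t \<in> space M \<Longrightarrow> norm (b t - ys) \<le> 2 * e"
    "(\<integral>t. norm (v t - y0 t) \<partial>M) \<le> s" "(\<integral>t. norm (a t) * norm (u t - x) \<partial>M) \<le> 2 * s"
    "norm ((\<integral>t. a t \<partial>M) - xs) \<le> 2 * e"
proof (rule penalised_sequence[OF assms(1-3)])
  show "- objective e x \<le> (\<integral>t. q e t (v t) \<partial>M)"
    if "x \<in> cball x0 r1" "v \<in> borel_measurable M" "AE t in M. (x, v t) \<in> D t" for x v
    by (rule H[OF that])
next
  fix x f c assume f: "dist x x0 < r1" "dist x x0 \<le> s" "c > 0" "f \<in> borel_measurable M"
    "\<And>t. t \<in> space M \<Longrightarrow> f t \<in> D t"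
    "\<And>t p. t \<in> space M \<Longrightarrow> p \<in> D t \<Longrightarrow> cost (2*e) (1/c) c t x (f t) \<le> cost (2*e) (1/c) c t x p"
    "\<And>x'. x' \<in> cball x0 r1 \<Longrightarrow>
      objective (2*e) x + (\<integral>t. cost (2*e) (1/c) c t x (f t) \<partial>M)
        \<le> objective (2*e) x' + (\<integral>t. cost (2*e) (1/c) c t x' (f t) \<partial>M)"
    "\<And>t. t \<in> space M \<Longrightarrow> norm (fst (f t) - x0) \<le> s"
    "(\<integral>t. norm (snd (f t) - y0 t) \<partial>M) \<le> s"
    "c * (\<integral>t. (k t + 1) * norm (fst (f t) - x) ^ 2 \<partial>M) \<le> s"
  define u v where "u t = fst (f t)" and "v t = snd (f t)" for t
  have u_meas [measurable]: "u \<in> borel_measurable M" and v_meas [measurable]: "v \<in> borel_measurable M"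
    unfolding u_def v_def by (rule borel_measurable_fst_snd[OF f(4)])+
  define a where "a t = (2 * c * (k t + 1)) *\<^sub>R (x - u t)" for t
  define b where "b t = ys + (2 * e / sqrt ((1/c) ^ 2 + norm (v t - y0 t) ^ 2)) *\<^sub>R (v t - y0 t)" for t
  show thesis
  proof (rule that[of x u v a b])
    show "integrable M a" "norm ((\<integral>t. a t \<partial>M) - xs) \<le> 2 * e"
      unfolding a_def u_def using minimiser_first_order[OF f(4,5,7,1)] \<open>c > 0\<close> \<open>e > 0\<close> by auto
    show "b \<in> borel_measurable M" unfolding b_def by measurable
    have a_eq: "norm (a t) * norm (u t - x) = 2 * (c * ((k t + 1) * norm (fst (f t) - x) ^ 2))"
      if t: "t \<in> space M" for t
      using k_nonneg[OF t] \<open>c > 0\<close>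
      by (simp add: a_def u_def abs_mult norm_minus_commute power2_eq_square)
    have "(\<integral>t. norm (a t) * norm (u t - x) \<partial>M) = (\<integral>t. 2 * (c * ((k t + 1) * norm (fst (f t) - x) ^ 2)) \<partial>M)"
      using a_eq by (intro Bochner_Integration.integral_cong) auto
    also have "\<dots> \<le> 2 * s" using f(10) by simp
    finally show "(\<integral>t. norm (a t) * norm (u t - x) \<partial>M) \<le> 2 * s" .
    fix t assume t: "t \<in> space M"
    define S where "S = sqrt ((1/c) ^ 2 + norm (v t - y0 t) ^ 2)"
    have S: "norm (v t - y0 t) \<le> S" "S > 0"
      unfolding S_def using \<open>c > 0\<close> by (auto intro!: real_le_rsqrt add_pos_nonneg)
    have "norm (b t - ys) = 2 * e * (norm (v t - y0 t) / S)"
      using \<open>e > 0\<close> S by (simp add: b_def S_def[symmetric])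
    also have "\<dots> \<le> 2 * e * 1" using S \<open>e > 0\<close> by (intro mult_left_mono) auto
    finally show "norm (b t - ys) \<le> 2 * e" by simp
    have "inner (a t, - b t) (p - (u t, v t)) \<le> (c * (k t + 1) + 2 * e / (2 * (1/c))) * norm (p - (u t, v t)) ^ 2"
      if p: "p \<in> D t" for p
    proof -
      have "(u t, v t) = f t" by (simp add: u_def v_def)
      moreover have "inner (a t, - b t) (p - f t) = inner (a t) (fst p - fst (f t)) - inner (b t) (snd p - snd (f t))"
        by (simp add: inner_prod_def)
      ultimately show ?thesis
        using minimiser_normal[OF t f(5)[OF t] p f(6)[OF t p]] \<open>e > 0\<close> \<open>c > 0\<close>
        by (simp add: a_def b_def u_def v_def)
    qed
    then show "\<exists>C. \<forall>p\<in>D t. inner (a t, - b t) (p - (u t, v t)) \<le> C * norm (p - (u t, v t)) ^ 2" by blast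
    show "(u t, v t) \<in> D t" "norm (u t - x0) \<le> s"
      using f(5,8)[OF t] by (auto simp: u_def v_def)
  qed (use f(2,9) u_meas v_meas in \<open>auto simp: v_def\<close>)
qed

text \<open>A selection far from \<open>y0\<close> has a strictly positive value for \<open>e\<close> because its value for
  \<open>e / 2\<close> is almost nonnegative, by lower semicontinuity at \<open>x0\<close>.\<close>

lemma global_bound:
  assumes "e > 0" "\<eta> > 0"
    and loc: "\<And>x v. dist x x0 \<le> \<eta> \<Longrightarrow> v \<in> borel_measurable M \<Longrightarrow> (AE t in M. (x, v t) \<in> D t) \<Longrightarrow>
      norm (\<integral>t. v t - y0 t \<partial>M) \<le> \<eta> \<Longrightarrow>
      inner xs (x - x0) - inner ys (\<integral>t. v t - y0 t \<partial>M) \<le> e / 2 * (norm (x - x0) + norm (\<integral>t. v t - y0 t \<partial>M))"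
    and base: "\<And>v. v \<in> borel_measurable M \<Longrightarrow> (AE t in M. (x0, v t) \<in> D t) \<Longrightarrow> 0 \<le> (\<integral>t. q (e / 2) t (v t) \<partial>M)"
  obtains r1 where "r1 > 0" "\<And>x v. x \<in> cball x0 r1 \<Longrightarrow> v \<in> borel_measurable M \<Longrightarrow> (AE t in M. (x, v t) \<in> D t) \<Longrightarrow>
      - objective e x \<le> (\<integral>t. q e t (v t) \<partial>M)"
proof (rule ccontr)
  assume no: "\<not> thesis"
  define bad where "bad n x v \<longleftrightarrow> x \<in> cball x0 (inverse (Suc n)) \<and> v \<in> borel_measurable M \<and>
      (AE t in M. (x, v t) \<in> D t) \<and> (\<integral>t. q e t (v t) \<partial>M) < - objective e x" for n x v
  have "\<exists>x v. bad n x v" for n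
  proof (rule ccontr)
    assume "\<not> (\<exists>x v. bad n x v)"
    then have "- objective e x \<le> (\<integral>t. q e t (v t) \<partial>M)"
      if "x \<in> cball x0 (inverse (Suc n))" "v \<in> borel_measurable M" "AE t in M. (x, v t) \<in> D t" for x v
      using that unfolding bad_def by (meson not_less)
    then show False using no that[of "inverse (Suc n)"] by simp
  qed
  then obtain x v where "\<And>n. bad n (x n) (v n)" by metis
  then have x: "\<And>n. x n \<in> cball x0 (inverse (Suc n))" and v: "\<And>n. v n \<in> borel_measurable M"
    and D: "\<And>n. AE t in M. (x n, v n t) \<in> D t"
    and lt: "\<And>n. (\<integral>t. q e t (v n t) \<partial>M) < - objective e (x n)"
    unfolding bad_def by blast+
  have x_lim: "x \<longlonglongrightarrow> x0"
    by (rule metric_tendsto_imp_tendsto[OF LIMSEQ_inverse_real_of_nat])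
      (use x in \<open>auto simp: dist_commute intro!: always_eventually\<close>)
  \<comment> \<open>For a large deviation the bounds for \<open>e\<close> and \<open>e / 2\<close>
    together give \<open>e * Y / 2 < 2 * T\<close>, that is \<open>e * \<eta> / 4\<close>,
    contradicting \<open>\<eta> < Y\<close>.\<close>
  define T where "T = e * \<eta> / 8"
  have T: "T > 0" using assms by (simp add: T_def)
  have ev1: "\<forall>\<^sub>F n in sequentially. 0 - T \<le> (\<integral>t. q (e/2) t (v n t) \<partial>M)"
  proof (rule eventually_integral_q_ge[where u = "\<lambda>n t. x n" and x = x0])
    show "AE t in M. x \<longlonglongrightarrow> x0" using x_lim by simp
  qed (fact v D T base)+
  have "(\<lambda>n. inner xs (x n - x0)) \<longlonglongrightarrow> inner xs (x0 - x0)"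
    by (intro tendsto_intros x_lim)
  then have ev2: "\<forall>\<^sub>F n in sequentially. inner xs (x n - x0) < T"
    using T by (intro order_tendstoD(2)) auto
  have ev3: "\<forall>\<^sub>F n in sequentially. dist (x n) x0 < \<eta>"
    by (rule tendstoD[OF x_lim \<open>\<eta> > 0\<close>])
  have "\<forall>\<^sub>F n in sequentially. 0 - T \<le> (\<integral>t. q (e/2) t (v n t) \<partial>M) \<and> inner xs (x n - x0) < T \<and> dist (x n) x0 < \<eta>"
    by (intro eventually_conj ev1 ev2 ev3)
  then obtain n where n: "0 - T \<le> (\<integral>t. q (e/2) t (v n t) \<partial>M)" "inner xs (x n - x0) < T" "dist (x n) x0 < \<eta>"
    using eventually_happens'[OF sequentially_bot] by blast
  define I where "I = (\<integral>t. v n t - y0 t \<partial>M)"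
  define Y where "Y = (\<integral>t. norm (v n t - y0 t) \<partial>M)"
  have IY: "norm I \<le> Y" unfolding I_def Y_def by (rule integral_norm_bound)
  have q: "(\<integral>t. q e' t (v n t) \<partial>M) = inner ys I + e' * Y" for e'
    unfolding I_def Y_def by (rule integral_q[OF v D])
  have lt': "inner ys I + e * Y + e * norm (x n - x0) < inner xs (x n - x0)"
    using lt[of n] by (simp add: q objective_def)
  show False
  proof (cases "norm I \<le> \<eta>")
    case True
    then have "inner xs (x n - x0) - inner ys I \<le> e/2 * (norm (x n - x0) + norm I)"
      unfolding I_def using n(3) by (intro loc v D) auto
    also have "\<dots> \<le> e * (norm (x n - x0) + Y)"
      using IY \<open>e > 0\<close> by (intro mult_mono) auto
    finally show False using lt' by (simp add: distrib_left)
  next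
    case False
    then have "\<eta> < Y" using IY by simp
    then have "e * \<eta> \<le> e * Y" using \<open>e > 0\<close> by simp
    moreover have "0 \<le> e * norm (x n - x0)" using \<open>e > 0\<close> by simp
    moreover have "- T \<le> inner ys I + e * Y / 2" using n(1) by (simp add: q)
    ultimately show False using lt' n(2) T unfolding T_def by linarith
  qed
qed

text \<open>\<open>loc\<close> only concerns selections with a small integral deviation. At
  \<open>x0\<close> it extends to all selections of \<open>D'\<close>: on \<open>P\<close> the
  deviation is small by construction, on \<open>N\<close> it is made small by scaling towards
  \<open>y0\<close>. Then \<open>global_bound\<close> handles the nearby points.\<close>

theorem approximate_coderivative_multipliers:
  assumes P: "P \<in> sets M" "purely_atomic (density M (indicator P))"
    and N: "N \<in> sets M" "P \<union> N = space M" "P \<inter> N = {}"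
    and conv: "\<And>t. t \<in> N \<Longrightarrow> convex {v. (x0, v) \<in> D t}"
    and loc: "\<And>e. e > 0 \<Longrightarrow> \<exists>\<eta>>0. \<forall>x v. dist x x0 \<le> \<eta> \<longrightarrow> v \<in> borel_measurable M \<longrightarrow> (AE t in M. (x, v t) \<in> D t) \<longrightarrow>
      norm (\<integral>t. v t - y0 t \<partial>M) \<le> \<eta> \<longrightarrow>
      inner xs (x - x0) - inner ys (\<integral>t. v t - y0 t \<partial>M) \<le> e * (norm (x - x0) + norm (\<integral>t. v t - y0 t \<partial>M))"
    and "e > 0"
  obtains x u v a b where "dist x x0 \<le> e" "u \<in> borel_measurable M" "v \<in> borel_measurable M"
    "integrable M a" "b \<in> borel_measurable M" "AE t in M. (u t, v t) \<in> D t"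
    "AE t in M. \<exists>C d. d > 0 \<and> (\<forall>p\<in>D t. dist p (u t, v t) < d \<longrightarrow>
      inner (a t, - b t) (p - (u t, v t)) \<le> C * norm (p - (u t, v t)) ^ 2)"
    "AE t in M. norm (u t - x0) \<le> e" "AE t in M. norm (b t - ys) \<le> e"
    "(\<integral>t. norm (v t - y0 t) \<partial>M) \<le> e" "(\<integral>t. norm (a t) * norm (u t - x) \<partial>M) \<le> e"
    "norm ((\<integral>t. a t \<partial>M) - xs) \<le> e"
proof -
  \<comment> \<open>Two halvings: \<open>global_bound\<close> halves its parameter, and
    \<open>approximate_multipliers\<close> doubles its own to reach accuracy
    \<open>e\<close>.\<close>
  have "e / 4 > 0" using \<open>e > 0\<close> by simp
  from loc[OF this] obtain \<eta> where \<eta>: "\<eta> > 0" and loc\<eta>: "\<And>x v. dist x x0 \<le> \<eta> \<Longrightarrow> v \<in> borel_measurable M \<Longrightarrow>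
      (AE t in M. (x, v t) \<in> D t) \<Longrightarrow> norm (\<integral>t. v t - y0 t \<partial>M) \<le> \<eta> \<Longrightarrow>
      inner xs (x - x0) - inner ys (\<integral>t. v t - y0 t \<partial>M) \<le> e / 4 * (norm (x - x0) + norm (\<integral>t. v t - y0 t \<partial>M))"
    by blast
  obtain S c where S: "S \<in> sets M" "S \<subseteq> P" "c > 0" "(\<integral>t. indicator (P - S) t * \<bar>k t\<bar> \<partial>M) < \<eta> / 4"
    "\<And>h :: 't \<Rightarrow> real. integrable M h \<Longrightarrow> (\<And>t. 0 \<le> h t) \<Longrightarrow> AE t in M. t \<in> S \<longrightarrow> c * h t \<le> (\<integral>t. h t \<partial>M)"
    using purely_atomic_exhaustion[OF finite_measure_axioms P k_integrable, of "\<eta> / 4"] \<eta> by auto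
  define m where "m = measure M (space M)"
  \<comment> \<open>The allowance \<open>\<eta>\<close> is shared equally: deviations on
    \<open>S\<close> integrate to at most \<open>\<eta>' * m \<le> \<eta> / 2\<close>, and those on
    \<open>P - S\<close>, bounded by \<open>2 * k\<close>, to at most
    \<open>2 * (\<eta> / 4)\<close>.\<close>
  define \<eta>' where "\<eta>' = \<eta> / (2 * (m + 1))"
  have m: "m \<ge> 0" by (simp add: m_def)
  have \<eta>': "\<eta>' > 0" "\<eta>' * m \<le> \<eta> / 2"
    using \<eta> m by (auto simp: \<eta>'_def field_simps)
  \<comment> \<open>The indicator writes a constraint imposed only on \<open>S\<close> as a sublevel
    condition of one Caratheodory function.\<close>
  define D' where "D' t = {p \<in> D t. indicator S t * (norm (snd p - y0 t) - \<eta>') \<le> (0::real)}" for t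
  have D'_iff: "p \<in> D' t \<longleftrightarrow> p \<in> D t \<and> (t \<in> S \<longrightarrow> norm (snd p - y0 t) \<le> \<eta>')" for p t
    by (auto simp: D'_def indicator_def)
  interpret R: graph_multifunction M D' x0 xs ys y0 k r
  proof
    show "measurable_multi M D'"
      unfolding D'_def
    proof (rule measurable_multi_sublevel[OF D_measurable D_compact])
      show "caratheodory M (\<lambda>t p. indicator S t * (norm (snd p - y0 t) - \<eta>'))"
        unfolding caratheodory_def using S(1) by (auto intro!: continuous_intros)
    qed
    show "closed (D' t)" if "t \<in> space M" for t
      unfolding D'_def
      by (intro compact_imp_closed compact_sublevel D_compact that continuous_intros)
    show "(x0, y0 t) \<in> D' t" if "t \<in> space M" for t
      using D_base[OF that] \<eta>' by (simp add: D'_iff)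
  qed (use D_fst D_snd k_integrable in \<open>auto simp: D'_iff\<close>)
  have base: "0 \<le> (\<integral>t. q (e / 2 / 2) t (v t) \<partial>M)"
    if v [measurable]: "v \<in> borel_measurable M" and vD': "AE t in M. (x0, v t) \<in> D' t" for v
  proof -
    have vD: "AE t in M. (x0, v t) \<in> D t" using vD' by eventually_elim (simp add: D'_iff)
    have iv: "integrable M (\<lambda>t. norm (v t - y0 t))" using integrable_diff_y0[OF v vD] by simp
    have iq: "integrable M (\<lambda>t. q (e/4) t (v t))" by (rule integrable_q[OF v vD])
    have iqA: "integrable M (\<lambda>t. indicator A t * q (e/4) t (v t))" if "A \<in> sets M" for A
      using integrable_mult_indicator[OF that iq] by simp
    \<comment> \<open>The local inequality is tested with the selection that leaves
      \<open>y0\<close> only on \<open>A\<close>, and there by the fraction \<open>l\<close>;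
      homogeneity of \<open>q\<close> then cancels \<open>l\<close>.\<close>
    have part: "0 \<le> (\<integral>t. indicator A t * q (e/4) t (v t) \<partial>M)"
      if A [measurable]: "A \<in> sets M" and l: "0 < l" "l \<le> 1"
        and w: "AE t in M. t \<in> A \<longrightarrow> (x0, y0 t + l *\<^sub>R (v t - y0 t)) \<in> D t"
        and le: "(\<integral>t. l * (indicator A t * norm (v t - y0 t)) \<partial>M) \<le> \<eta>" for A l
    proof -
      define w where "w t = y0 t + (l * indicator A t) *\<^sub>R (v t - y0 t)" for t
      have w_meas: "w \<in> borel_measurable M" unfolding w_def by measurable
      have wD: "AE t in M. (x0, w t) \<in> D t"
        using w AE_space by eventually_elim (auto simp: w_def indicator_def D_base)
      have norm_w: "norm (w t - y0 t) = l * (indicator A t * norm (v t - y0 t))" for t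
        using l by (simp add: w_def abs_mult)
      have I: "norm (\<integral>t. w t - y0 t \<partial>M) \<le> (\<integral>t. norm (w t - y0 t) \<partial>M)"
        by (rule integral_norm_bound)
      also have "\<dots> \<le> \<eta>" using le by (simp add: norm_w)
      finally have "- inner ys (\<integral>t. w t - y0 t \<partial>M) \<le> e/4 * norm (\<integral>t. w t - y0 t \<partial>M)"
        using loc\<eta>[of x0 w] w_meas wD \<eta> by simp
      also have "\<dots> \<le> e/4 * (\<integral>t. norm (w t - y0 t) \<partial>M)"
        using I \<open>e > 0\<close> by (intro mult_left_mono) auto
      finally have "0 \<le> (\<integral>t. q (e/4) t (w t) \<partial>M)"
        unfolding integral_q[OF w_meas wD] by simp
      also have "(\<integral>t. q (e/4) t (w t) \<partial>M) = (\<integral>t. l * (indicator A t * q (e/4) t (v t)) \<partial>M)"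
      proof (intro Bochner_Integration.integral_cong refl)
        fix t
        have "w t - y0 t = (l * indicator A t) *\<^sub>R (v t - y0 t)" by (simp add: w_def)
        then have "inner ys (w t - y0 t) = l * (indicator A t * inner ys (v t - y0 t))" by simp
        then show "q (e/4) t (w t) = l * (indicator A t * q (e/4) t (v t))"
          unfolding q_def norm_w by (simp add: distrib_left)
      qed
      also have "\<dots> = l * (\<integral>t. indicator A t * q (e/4) t (v t) \<partial>M)" by simp
      finally show ?thesis using l by (simp add: zero_le_mult_iff)
    qed
    have "0 \<le> (\<integral>t. indicator P t * q (e/4) t (v t) \<partial>M)"
    proof (rule part[OF P(1), of 1])
      show "AE t in M. t \<in> P \<longrightarrow> (x0, y0 t + 1 *\<^sub>R (v t - y0 t)) \<in> D t"
        using vD by eventually_elim simp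
      have iP: "integrable M (\<lambda>t. indicator (P - S) t * \<bar>k t\<bar>)"
        using integrable_mult_indicator[of "P - S" M "\<lambda>t. \<bar>k t\<bar>"] P(1) S(1) k_integrable by auto
      have "(\<integral>t. 1 * (indicator P t * norm (v t - y0 t)) \<partial>M) \<le> (\<integral>t. \<eta>' + 2 * (indicator (P - S) t * \<bar>k t\<bar>) \<partial>M)"
      proof (rule integral_mono_AE)
        show "integrable M (\<lambda>t. 1 * (indicator P t * norm (v t - y0 t)))"
          using integrable_mult_indicator[OF P(1) iv] by simp
        show "AE t in M. 1 * (indicator P t * norm (v t - y0 t)) \<le> \<eta>' + 2 * (indicator (P - S) t * \<bar>k t\<bar>)"
          using vD' AE_space
        proof eventually_elim
          case (elim t)
          then show ?case
            using norm_diff_y0[of t "(x0, v t)"] k_nonneg[of t] \<eta>'(1)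
            by (auto simp: indicator_def D'_iff)
        qed
      qed (use iP in auto)
      also have "\<dots> = \<eta>' * m + 2 * (\<integral>t. indicator (P - S) t * \<bar>k t\<bar> \<partial>M)"
        using iP by (simp add: m_def)
      also have "\<dots> \<le> \<eta>" using \<eta>'(2) S(4) by simp
      finally show "(\<integral>t. 1 * (indicator P t * norm (v t - y0 t)) \<partial>M) \<le> \<eta>" .
    qed auto
    moreover have "0 \<le> (\<integral>t. indicator N t * q (e/4) t (v t) \<partial>M)"
    proof -
      define Y where "Y = (\<integral>t. norm (v t - y0 t) \<partial>M)"
      have Y: "Y \<ge> 0" by (simp add: Y_def)
      \<comment> \<open>The fraction brings the deviation below \<open>\<eta>\<close> however far
        \<open>v\<close> is from \<open>y0\<close>; convexity of the fibres keeps the scaled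
        selection admissible.\<close>
      define l where "l = min 1 (\<eta> / (Y + 1))"
      have l: "0 < l" "l \<le> 1" using \<eta> Y by (auto simp: l_def)
      show ?thesis
      proof (rule part[OF N(1) l])
        show "AE t in M. t \<in> N \<longrightarrow> (x0, y0 t + l *\<^sub>R (v t - y0 t)) \<in> D t"
          using vD AE_space
        proof eventually_elim
          case (elim t)
          have "(1 - l) *\<^sub>R y0 t + l *\<^sub>R v t \<in> {v. (x0, v) \<in> D t}" if "t \<in> N"
            by (rule convexD[OF conv[OF that]]) (use elim D_base[OF elim(2)] l in simp_all)
          moreover have "(1 - l) *\<^sub>R y0 t + l *\<^sub>R v t = y0 t + l *\<^sub>R (v t - y0 t)"
            by (simp add: scaleR_diff_left scaleR_diff_right)
          ultimately show ?case by simp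
        qed
        have "(\<integral>t. indicator N t * norm (v t - y0 t) \<partial>M) \<le> Y"
          unfolding Y_def using integrable_mult_indicator[OF N(1) iv] iv
          by (intro integral_mono) (auto simp: indicator_def)
        then have "l * (\<integral>t. indicator N t * norm (v t - y0 t) \<partial>M) \<le> l * Y"
          using l by simp
        also have "\<dots> \<le> \<eta> / (Y + 1) * Y"
          using Y by (intro mult_right_mono) (simp_all add: l_def)
        also have "\<dots> \<le> \<eta>" using \<eta> Y by (simp add: pos_divide_le_eq)
        finally show "(\<integral>t. l * (indicator N t * norm (v t - y0 t)) \<partial>M) \<le> \<eta>" by simp
      qed
    qed
    moreover have "(\<integral>t. q (e/4) t (v t) \<partial>M) =
        (\<integral>t. indicator P t * q (e/4) t (v t) + indicator N t * q (e/4) t (v t) \<partial>M)"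
    proof (rule Bochner_Integration.integral_cong)
      fix t assume "t \<in> space M"
      then have "t \<in> P \<or> t \<in> N" "\<not> (t \<in> P \<and> t \<in> N)" using N(2,3) by blast+
      then show "q (e/4) t (v t) = indicator P t * q (e/4) t (v t) + indicator N t * q (e/4) t (v t)"
        by (auto simp: indicator_def)
    qed simp
    moreover have "\<dots> = (\<integral>t. indicator P t * q (e/4) t (v t) \<partial>M) + (\<integral>t. indicator N t * q (e/4) t (v t) \<partial>M)"
      by (intro Bochner_Integration.integral_add iqA P(1) N(1))
    ultimately have "0 \<le> (\<integral>t. q (e/4) t (v t) \<partial>M)" by linarith
    then show ?thesis by simp
  qed
  have loc': "inner xs (x - x0) - inner ys (\<integral>t. v t - y0 t \<partial>M) \<le>
      e / 2 / 2 * (norm (x - x0) + norm (\<integral>t. v t - y0 t \<partial>M))"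
    if "dist x x0 \<le> \<eta>" "v \<in> borel_measurable M" "AE t in M. (x, v t) \<in> D' t" "norm (\<integral>t. v t - y0 t \<partial>M) \<le> \<eta>" for x v
  proof -
    have "AE t in M. (x, v t) \<in> D t" using that(3) by eventually_elim (simp add: D'_iff)
    then show ?thesis using loc\<eta>[of x v] that by simp
  qed
  have "e / 2 > 0" using \<open>e > 0\<close> by simp
  have "\<exists>r1>0. \<forall>x v. x \<in> cball x0 r1 \<longrightarrow> v \<in> borel_measurable M \<longrightarrow> (AE t in M. (x, v t) \<in> D' t) \<longrightarrow>
      - objective (e/2) x \<le> (\<integral>t. q (e/2) t (v t) \<partial>M)"
    by (rule R.global_bound[OF \<open>e / 2 > 0\<close> \<eta>]) (rule loc', assumption+, rule base, assumption+, blast)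
  then obtain r1 where r1: "r1 > 0" "\<And>x v. x \<in> cball x0 r1 \<Longrightarrow> v \<in> borel_measurable M \<Longrightarrow>
      (AE t in M. (x, v t) \<in> D' t) \<Longrightarrow> - objective (e/2) x \<le> (\<integral>t. q (e/2) t (v t) \<partial>M)"
    by blast
  \<comment> \<open>On \<open>S\<close> the estimate for atoms turns the \<open>L1\<close> bound
    \<open>c * \<eta>' / 2\<close> into \<open>norm (v t - y0 t) \<le> \<eta>' / 2\<close>. The
    constraint defining \<open>D'\<close> is then inactive near \<open>(u t, v t)\<close>, so
    normals to \<open>D'\<close> there are normals to \<open>D\<close>.\<close>
  define s where "s = min (e/2) (c * \<eta>' / 2)"
  have s: "s > 0" "2 * s \<le> e" "s \<le> c * \<eta>' / 2" using \<open>e > 0\<close> S(3) \<eta>' by (auto simp: s_def)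
  show thesis
  proof (rule R.approximate_multipliers[OF \<open>e / 2 > 0\<close> r1(1) s(1)])
    show "- objective (e/2) x \<le> (\<integral>t. q (e/2) t (v t) \<partial>M)"
      if "x \<in> cball x0 r1" "v \<in> borel_measurable M" "AE t in M. (x, v t) \<in> D' t" for x v
      by (rule r1(2)[OF that])
  next
    fix x u v a b assume *: "dist x x0 \<le> s" "u \<in> borel_measurable M" "v \<in> borel_measurable M"
    "integrable M a" "b \<in> borel_measurable M" "\<And>t. t \<in> space M \<Longrightarrow> (u t, v t) \<in> D' t"
    "\<And>t. t \<in> space M \<Longrightarrow> \<exists>C. \<forall>p\<in>D' t. inner (a t, - b t) (p - (u t, v t)) \<le> C * norm (p - (u t, v t)) ^ 2"
    "\<And>t. t \<in> space M \<Longrightarrow> norm (u t - x0) \<le> s" "\<And>t. t \<in> space M \<Longrightarrow> norm (b t - ys) \<le> 2 * (e/2)"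
    "(\<integral>t. norm (v t - y0 t) \<partial>M) \<le> s" "(\<integral>t. norm (a t) * norm (u t - x) \<partial>M) \<le> 2 * s"
    "norm ((\<integral>t. a t \<partial>M) - xs) \<le> 2 * (e/2)"
  have uvD: "AE t in M. (u t, v t) \<in> D t" using *(6) by (intro AE_I2) (simp add: D'_iff)
  show thesis
  proof (rule that[of x u v a b])
    have "AE t in M. t \<in> S \<longrightarrow> c * norm (v t - y0 t) \<le> (\<integral>t. norm (v t - y0 t) \<partial>M)"
      using integrable_diff_y0[OF *(3) uvD] by (intro S(5)) auto
    then show "AE t in M. \<exists>C d. d > 0 \<and> (\<forall>p\<in>D t. dist p (u t, v t) < d \<longrightarrow>
      inner (a t, - b t) (p - (u t, v t)) \<le> C * norm (p - (u t, v t)) ^ 2)"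
      using AE_space
    proof eventually_elim
      case (elim t)
      obtain C where C: "\<And>p. p \<in> D' t \<Longrightarrow> inner (a t, - b t) (p - (u t, v t)) \<le> C * norm (p - (u t, v t)) ^ 2"
        using *(7)[OF elim(2)] by blast
      have "\<exists>d>0. \<forall>p\<in>D t. dist p (u t, v t) < d \<longrightarrow> p \<in> D' t"
      proof (cases "t \<in> S")
        case True
        then have "c * norm (v t - y0 t) \<le> c * (\<eta>' / 2)" using elim(1) *(10) s(3) by simp
        then have n: "norm (v t - y0 t) \<le> \<eta>' / 2" using S(3) by simp
        have "p \<in> D' t" if "p \<in> D t" "dist p (u t, v t) < \<eta>' / 2" for p
        proof -
          have "norm (snd p - v t) < \<eta>' / 2"
            using dist_snd_le[of p "(u t, v t)"] that(2) by (simp add: dist_norm)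
          then have "norm (snd p - y0 t) \<le> \<eta>'"
            using n norm_triangle_ineq[of "snd p - v t" "v t - y0 t"] by simp
          then show ?thesis using that(1) by (simp add: D'_iff)
        qed
        then show ?thesis using \<eta>'(1) by (intro exI[of _ "\<eta>' / 2"]) auto
      next
        case False
        then show ?thesis by (intro exI[of _ 1]) (auto simp: D'_iff)
      qed
      then show ?case using C by blast
    qed
    show "dist x x0 \<le> e" "AE t in M. norm (u t - x0) \<le> e" "(\<integral>t. norm (v t - y0 t) \<partial>M) \<le> e"
      "(\<integral>t. norm (a t) * norm (u t - x) \<partial>M) \<le> e"
      using *(1,8,10,11) s(1,2) by (force intro!: AE_I2)+
  qed (use * uvD in auto)
  qed
qed

end

subsection \<open>Coderivatives of subdifferential mappings\<close>

text \<open>A quadratic error is smaller than any multiple of the distance near the point, so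
  proximal normals are regular normals.\<close>

lemma regular_coderivativeI:
  assumes "y \<in> G x" "d > 0"
    and le: "\<And>p. p \<in> graph_of G \<Longrightarrow> dist p (x, y) < d \<Longrightarrow>
      inner (xs, - ys) (p - (x, y)) \<le> C * norm (p - (x, y)) ^ 2"
  shows "xs \<in> regular_coderivative G x y ys"
proof -
  have "\<exists>d>0. \<forall>p\<in>graph_of G. dist p (x, y) < d \<longrightarrow> inner (xs, - ys) (p - (x, y)) \<le> e * norm (p - (x, y))"
    if "e > 0" for e
  proof -
    have "inner (xs, - ys) (p - (x, y)) \<le> e * norm (p - (x, y))"
      if p: "p \<in> graph_of G" "dist p (x, y) < min d (e / (\<bar>C\<bar> + 1))" for p
    proof -
      define n where "n = norm (p - (x, y))"
      have n: "0 \<le> n" "(\<bar>C\<bar> + 1) * n \<le> e"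
        using p(2) by (auto simp: n_def dist_norm field_simps)
      have "C * n \<le> (\<bar>C\<bar> + 1) * n" using n(1) by (intro mult_right_mono) auto
      then have "C * n * n \<le> e * n" using n by (intro mult_right_mono) auto
      moreover have "inner (xs, - ys) (p - (x, y)) \<le> C * n ^ 2"
        unfolding n_def using p by (intro le) auto
      ultimately show ?thesis by (simp add: n_def power2_eq_square)
    qed
    then show ?thesis using \<open>e > 0\<close> \<open>d > 0\<close> by (intro exI[of _ "min d (e / (\<bar>C\<bar> + 1))"]) simp
  qed
  then show ?thesis
    unfolding regular_coderivative_def regular_normal_cone_iff using assms(1) by (simp add: graph_of_def)
qed

lemma Linf_norm_le:
  fixes h :: "'t \<Rightarrow> 'b::euclidean_space"
  assumes "h \<in> borel_measurable M" "AE t in M. norm (h t) \<le> e"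
  shows "Linf_norm M h \<le> ennreal e"
  unfolding Linf_norm_def
proof (rule esssup_I)
  show "(\<lambda>t. ennreal (norm (h t))) \<in> borel_measurable M" using assms(1) by measurable
  show "AE t in M. ennreal (norm (h t)) \<le> ennreal e"
    using assms(2) by eventually_elim (rule ennreal_leI)
qed

lemma LinfI:
  fixes h :: "'t \<Rightarrow> 'b::euclidean_space"
  assumes h: "h \<in> borel_measurable M" and bd: "AE t in M. norm (h t - z) \<le> e"
  shows "h \<in> Linf M"
proof -
  have "AE t in M. norm (h t) \<le> norm z + e"
    using bd
  proof eventually_elim
    case (elim t)
    then show ?case using norm_triangle_ineq[of z "h t - z"] by simp
  qed
  from Linf_norm_le[OF h this] show ?thesis
    using h by (auto simp: Linf_def intro: le_less_trans)
qed

theorem proposition7p3: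
  fixes M :: "'t measure"
    and Tpa Tna :: "'t set"
    and \<phi> :: "'t \<Rightarrow> real ^ 'n \<Rightarrow> ereal"
    and xbar ybar xsbar ysbar :: "real ^ 'n"
    and yfbar :: "'t \<Rightarrow> real ^ 'n"
    and \<rho> :: real
    and \<kappa> :: "'t \<Rightarrow> real"
  assumes complete: "complete_measure M"
    and finite: "finite_measure M"
    and decomp: "atomic_decomposition M Tpa Tna"
    and normal: "normal_integrand M \<phi>"
    and proper: "proper_integrand M \<phi>"
    and xbar: "xbar \<in> eff_dom (expectation_functional M \<phi>)"
    and ybar: "ybar \<in> limiting_subdiff (expectation_functional M \<phi>) xbar"
    and yfbar: "yfbar \<in> subgradient_selections M \<phi> xbar ybar"
    and rho: "\<rho> > 0"
    and kappa: "\<kappa> \<in> L1 M" "AE t in M. \<kappa> t > 0"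
    and a: "\<forall>x \<in> cball xbar \<rho>. limiting_subdiff (expectation_functional M \<phi>) x
              = aumann_integral M (\<lambda>t. limiting_subdiff (\<phi> t) x)"
    and b: "\<forall>t \<in> Tna. \<forall>x \<in> cball xbar \<rho>. lower_regular_at (\<phi> t) x"
    and c: "AE t in M. \<forall>x \<in> cball xbar \<rho>. limiting_subdiff (\<phi> t) x \<subseteq> cball 0 (\<kappa> t)"
    and xsbar: "xsbar \<in> combined_subdiff2 (expectation_functional M \<phi>) xbar ybar ysbar"
  shows "\<exists>(x :: nat \<Rightarrow> real ^ 'n) (xf :: nat \<Rightarrow> 't \<Rightarrow> real ^ 'n) (xsf :: nat \<Rightarrow> 't \<Rightarrow> real ^ 'n)
            (yf :: nat \<Rightarrow> 't \<Rightarrow> real ^ 'n) (ysf :: nat \<Rightarrow> 't \<Rightarrow> real ^ 'n).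
      (\<forall>k. xf k \<in> Linf M \<and> xsf k \<in> L1 M \<and> yf k \<in> L1 M \<and> ysf k \<in> Linf M) \<and>
      (\<forall>k. AE t in M. xsf k t \<in> combined_subdiff2 (\<phi> t) (xf k t) (yf k t) (ysf k t)) \<and>
      (\<lambda>k. norm (xbar - x k)) \<longlonglongrightarrow> 0 \<and>
      (\<lambda>k. Linf_norm M (\<lambda>t. xbar - xf k t)) \<longlonglongrightarrow> 0 \<and>
      (\<lambda>k. L1_norm M (\<lambda>t. yfbar t - yf k t)) \<longlonglongrightarrow> 0 \<and>
      (\<lambda>k. Linf_norm M (\<lambda>t. ysf k t - ysbar)) \<longlonglongrightarrow> 0 \<and>
      (\<lambda>k. \<integral>t. norm (xsf k t) * norm (xf k t - x k) \<partial>M) \<longlonglongrightarrow> 0 \<and>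
      (\<lambda>k. \<integral>t. xsf k t \<partial>M) \<longlonglongrightarrow> xsbar"
proof -

  \<comment> \<open>Removal of a null set and reduction to compact graphs\<close>
  interpret finite_measure M by (rule finite)
  have yfbar_int: "integrable M yfbar" and yfbar_eq: "(\<integral>t. yfbar t \<partial>M) = ybar"
    and yfbar_AE: "AE t in M. yfbar t \<in> limiting_subdiff (\<phi> t) xbar"
    using yfbar by (auto simp: subgradient_selections_def L1_def)
  have kappa_int: "integrable M \<kappa>" using kappa(1) by (simp add: L1_def)
  define Q where "Q t \<longleftrightarrow> yfbar t \<in> limiting_subdiff (\<phi> t) xbar \<and>
      (\<forall>x \<in> cball xbar \<rho>. limiting_subdiff (\<phi> t) x \<subseteq> cball 0 (\<kappa> t))" for t
  have "AE t in M. Q t"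
    using yfbar_AE c unfolding Q_def by eventually_elim blast
  then have "\<exists>N\<in>null_sets M. \<forall>t\<in>space M - N. Q t"
    by (rule AE_E3) blast
  then obtain N where N: "N \<in> null_sets M"
    and good: "\<And>t. t \<in> space M - N \<Longrightarrow> yfbar t \<in> limiting_subdiff (\<phi> t) xbar \<and>
      (\<forall>x \<in> cball xbar \<rho>. limiting_subdiff (\<phi> t) x \<subseteq> cball 0 (\<kappa> t))"
    unfolding Q_def by (elim bexE) simp
  have N_sets: "N \<in> sets M" using N by auto
  have AE_N: "AE t in M. t \<in> space M - N" using AE_not_in[OF N] AE_space by eventually_elim blast
  \<comment> \<open>The radius on which bounded subgradients guarantee finiteness and a Lipschitz
    constant.\<close>
  define R where "R = \<rho> / 4"
  have R: "R > 0" "R / 2 \<le> \<rho>" using rho by (auto simp: R_def)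
  define f where "f t = (if t \<in> N then (\<lambda>_. 0) else \<phi> t)" for t
  define g where "g t x = (if t \<in> N then 0 else real_of_ereal (\<phi> t x))" for t x
  have "\<exists>C. finite_lipschitz_on_cball (f t) (g t) xbar R C" if t: "t \<in> space M" for t
  proof (cases "t \<in> N")
    case True
    then have "finite_lipschitz_on_cball (f t) (g t) xbar R 0"
      using R by unfold_locales (simp_all add: f_def g_def zero_ereal_def)
    then show ?thesis by blast
  next
    case False
    then have gt: "yfbar t \<in> limiting_subdiff (\<phi> t) xbar"
      "\<And>x. x \<in> cball xbar \<rho> \<Longrightarrow> limiting_subdiff (\<phi> t) x \<subseteq> cball 0 (\<kappa> t)"
      using good[of t] t by auto
    have lsc: "lower_semicontinuous (\<phi> t)" and gt_minf: "\<And>x. \<phi> t x > -\<infinity>"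
      using normal proper t by (auto simp: normal_integrand_def proper_integrand_def proper_fun_def)
    have fin: "\<bar>\<phi> t xbar\<bar> \<noteq> \<infinity>" using gt(1) by (auto simp: limiting_subdiff_def split: if_splits)
    show ?thesis
    proof (rule bounded_subdiff_imp_lipschitz[OF lsc gt_minf fin rho gt(2)])
      fix C assume C: "C \<ge> 0" "\<And>x. x \<in> cball xbar (\<rho>/4) \<Longrightarrow> \<bar>\<phi> t x\<bar> \<noteq> \<infinity>"
      "\<And>x z. x \<in> cball xbar (\<rho>/4) \<Longrightarrow> z \<in> cball xbar (\<rho>/4) \<Longrightarrow>
        real_of_ereal (\<phi> t x) \<le> real_of_ereal (\<phi> t z) + C * norm (z - x)"
      have "finite_lipschitz_on_cball (f t) (g t) xbar R C"
      proof
        show "f t x = ereal (g t x)" if "x \<in> cball xbar R" for x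
          using C(2)[of x] that False by (simp add: f_def g_def R_def ereal_real)
        show "g t x \<le> g t z + C * norm (z - x)" if "x \<in> cball xbar R" "z \<in> cball xbar R" for x z
          using C(3)[of x z] that False by (simp add: g_def R_def)
      qed (use R C in auto)
      then show ?thesis by blast
    qed
  qed
  then obtain Lip where Lip: "\<And>t. t \<in> space M \<Longrightarrow> finite_lipschitz_on_cball (f t) (g t) xbar R (Lip t)"
    by metis
  have g_meas: "(\<lambda>t. g t x) \<in> borel_measurable M" for x
  proof -
    have "(\<lambda>t. case_prod \<phi> (t, x)) \<in> borel_measurable M"
      using normal by (intro measurable_compose[of "\<lambda>t. (t, x)" M "M \<Otimes>\<^sub>M borel" "case_prod \<phi>"])
        (auto simp: normal_integrand_def)
    then have "(\<lambda>t. real_of_ereal (\<phi> t x)) \<in> borel_measurable M" by simp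
    then show ?thesis unfolding g_def using N_sets by (intro measurable_If_set) auto
  qed
  \<comment> \<open>On the null set \<open>N\<close> the data are replaced by trivial ones, so that
    the assumptions hold at every \<open>t\<close>. The ball is halved because the graph is known to
    be closed and measurable only over radius \<open>R/2\<close>.\<close>
  define D where "D t = (if t \<in> N then {(xbar, 0)}
     else {(u, v). u \<in> cball xbar (R/2) \<and> v \<in> limiting_subdiff (f t) u})" for t
  have D_iff: "p \<in> D t \<longleftrightarrow> fst p \<in> cball xbar (R/2) \<and> snd p \<in> limiting_subdiff (\<phi> t) (fst p)"
    if "t \<in> space M - N" for t p
    using that by (simp add: D_def f_def case_prod_beta)
  define y0 where "y0 t = (if t \<in> N then 0 else yfbar t)" for t
  have y0_meas: "y0 \<in> borel_measurable M"
    unfolding y0_def using N_sets yfbar_int by (intro measurable_If_set) auto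
  interpret graph_multifunction M D xbar xsbar ysbar y0 "\<lambda>t. \<bar>\<kappa> t\<bar>" "R / 2"
  proof
    show "measurable_multi M D"
      unfolding D_def using Lip g_meas R(1)
      by (intro measurable_multi_if N_sets measurable_multi_const measurable_multi_limiting_subdiff)
    fix t assume t: "t \<in> space M"
    show "closed (D t)"
      using finite_lipschitz_on_cball.closed_subdiff_graph[OF Lip[OF t]] by (simp add: D_def)
    show "(xbar, y0 t) \<in> D t"
    proof (cases "t \<in> N")
      case False
      then have tN: "t \<in> space M - N" using t by simp
      show ?thesis using good[OF tN] R(1) False unfolding D_iff[OF tN] by (simp add: y0_def)
    qed (simp add: D_def y0_def)
    fix p assume p: "p \<in> D t"
    show "dist (fst p) xbar \<le> R / 2" "norm (snd p) \<le> \<bar>\<kappa> t\<bar>"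
    proof -
      have "dist (fst p) xbar \<le> R / 2 \<and> norm (snd p) \<le> \<bar>\<kappa> t\<bar>"
      proof (cases "t \<in> N")
        case True
        then show ?thesis using p R(1) by (simp add: D_def)
      next
        case False
        then have tN: "t \<in> space M - N" using t by simp
        have *: "fst p \<in> cball xbar (R/2)" "snd p \<in> limiting_subdiff (\<phi> t) (fst p)"
          using p unfolding D_iff[OF tN] by auto
        have "fst p \<in> cball xbar \<rho>" using *(1) R(2) by simp
        then have "snd p \<in> cball 0 (\<kappa> t)" using good[OF tN] *(2) by blast
        then show ?thesis using *(1) by (simp add: dist_commute)
      qed
      then show "dist (fst p) xbar \<le> R / 2" "norm (snd p) \<le> \<bar>\<kappa> t\<bar>" by auto
    qed
  qed (use y0_meas kappa_int in auto)
  have y0_AE: "AE t in M. y0 t = yfbar t" using AE_N by eventually_elim (simp add: y0_def)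
  have y0_int: "integrable M y0"
    using integrable_cong_AE[OF y0_meas borel_measurable_integrable[OF yfbar_int] y0_AE] yfbar_int by simp
  have y0_eq: "(\<integral>t. y0 t \<partial>M) = ybar"
    using integral_cong_AE[OF y0_meas borel_measurable_integrable[OF yfbar_int] y0_AE] yfbar_eq by simp
  have v_int: "integrable M v" if "v \<in> borel_measurable M" "AE t in M. (u t, v t) \<in> D t" for u v
    using Bochner_Integration.integrable_add[OF integrable_diff_y0[OF that] y0_int] by simp

  \<comment> \<open>The coderivative of the expectation functional as an inequality for
    selections\<close>
  have loc: "\<exists>\<eta>>0. \<forall>x v. dist x xbar \<le> \<eta> \<longrightarrow> v \<in> borel_measurable M \<longrightarrow> (AE t in M. (x, v t) \<in> D t) \<longrightarrow>
      norm (\<integral>t. v t - y0 t \<partial>M) \<le> \<eta> \<longrightarrow> inner xsbar (x - xbar) - inner ysbar (\<integral>t. v t - y0 t \<partial>M)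
        \<le> e * (norm (x - xbar) + norm (\<integral>t. v t - y0 t \<partial>M))" if "e > 0" for e
  proof -
    have "(xsbar, - ysbar) \<in> regular_normal_cone (xbar, ybar)
        (graph_of (limiting_subdiff (expectation_functional M \<phi>)))"
      using xsbar by (simp add: combined_subdiff2_def regular_coderivative_def)
    then obtain d where d: "d > 0"
      "\<And>w. w \<in> graph_of (limiting_subdiff (expectation_functional M \<phi>)) \<Longrightarrow> dist w (xbar, ybar) < d \<Longrightarrow>
         inner (xsbar, - ysbar) (w - (xbar, ybar)) \<le> e * norm (w - (xbar, ybar))"
      using \<open>e > 0\<close> unfolding regular_normal_cone_iff by blast
    \<comment> \<open>The distance of the pair is at most the sum of two deviations of size
      \<open>\<eta>\<close>, hence less than \<open>d\<close>; the bound \<open>\<rho>\<close> keeps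
      \<open>x\<close> where (a) applies.\<close>
    define \<eta> where "\<eta> = min \<rho> (d / 3)"
    have \<eta>: "\<eta> > 0" "\<eta> \<le> \<rho>" "2 * \<eta> < d" using rho d(1) by (auto simp: \<eta>_def)
    have "inner xsbar (x - xbar) - inner ysbar (\<integral>t. v t - y0 t \<partial>M)
        \<le> e * (norm (x - xbar) + norm (\<integral>t. v t - y0 t \<partial>M))"
      if x: "dist x xbar \<le> \<eta>" and v: "v \<in> borel_measurable M" "AE t in M. (x, v t) \<in> D t"
        and I: "norm (\<integral>t. v t - y0 t \<partial>M) \<le> \<eta>" for x v
    proof -
      define y where "y = (\<integral>t. v t \<partial>M)"
      have y: "(\<integral>t. v t - y0 t \<partial>M) = y - ybar"
        using v_int[OF v] y0_int by (simp add: y_def y0_eq)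
      have "AE t in M. v t \<in> limiting_subdiff (\<phi> t) x"
        using v(2) AE_N by eventually_elim (simp add: D_iff)
      \<comment> \<open>This is where (a) enters: the integral of any selection is a subgradient of
        the expectation functional, so the given normal can be tested with it.\<close>
      then have "y \<in> aumann_integral M (\<lambda>t. limiting_subdiff (\<phi> t) x)"
        unfolding aumann_integral_def y_def L1_def using v_int[OF v] by blast
      moreover have "x \<in> cball xbar \<rho>" using x \<eta>(2) by (simp add: dist_commute)
      ultimately have "(x, y) \<in> graph_of (limiting_subdiff (expectation_functional M \<phi>))"
        using a by (simp add: graph_of_def)
      moreover have le: "norm ((x, y) - (xbar, ybar)) \<le> norm (x - xbar) + norm (y - ybar)"
        using norm_Pair_le[of "x - xbar" "y - ybar"] by simp
      then have "dist (x, y) (xbar, ybar) < d"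
        using x I \<eta>(3) unfolding y by (simp add: dist_norm)
      ultimately have "inner (xsbar, - ysbar) ((x, y) - (xbar, ybar)) \<le> e * norm ((x, y) - (xbar, ybar))"
        by (rule d(2))
      also have "\<dots> \<le> e * (norm (x - xbar) + norm (y - ybar))"
        using le \<open>e > 0\<close> by (intro mult_left_mono) auto
      finally show ?thesis by (simp add: y)
    qed
    then show ?thesis using \<eta>(1) by blast
  qed
  have conv: "convex {v. (xbar, v) \<in> D t}" if t: "t \<in> Tna" for t
  proof (cases "t \<in> N")
    case True
    then have "{v. (xbar, v) \<in> D t} = {0}" by (auto simp: D_def)
    then show ?thesis by simp
  next
    case False
    have "Tna \<subseteq> space M" using decomp sets.sets_into_space by (auto simp: atomic_decomposition_def)
    then have tN: "t \<in> space M - N" using False t by blast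
    have "lower_regular_at (\<phi> t) xbar" using b t rho by auto
    then have "{v. (xbar, v) \<in> D t} = regular_subdiff (\<phi> t) xbar"
      using R(1) by (auto simp: D_iff[OF tN] lower_regular_at_def)
    then show ?thesis using convex_regular_subdiff by metis
  qed

  \<comment> \<open>Return to the integrand and passage to sequences\<close>
  define es where "es n = min (inverse (real (Suc n))) (R / 4)" for n
  have es: "es n > 0" "es n \<le> R / 4" "es n \<le> inverse (real (Suc n))" for n using R by (auto simp: es_def)
  define ok where "ok n x u v a b \<longleftrightarrow> dist x xbar \<le> es n \<and> u \<in> Linf M \<and> a \<in> L1 M \<and> v \<in> L1 M \<and> b \<in> Linf M \<and>
    (AE t in M. a t \<in> combined_subdiff2 (\<phi> t) (u t) (v t) (b t)) \<and>
    Linf_norm M (\<lambda>t. xbar - u t) \<le> ennreal (es n) \<and> L1_norm M (\<lambda>t. yfbar t - v t) \<le> es n \<and>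
    Linf_norm M (\<lambda>t. b t - ysbar) \<le> ennreal (es n) \<and> (\<integral>t. norm (a t) * norm (u t - x) \<partial>M) \<le> es n \<and>
    norm ((\<integral>t. a t \<partial>M) - xsbar) \<le> es n" for n x u v a b
  have P: "Tpa \<in> sets M" "purely_atomic (density M (indicator Tpa))" "Tna \<in> sets M"
    "Tpa \<union> Tna = space M" "Tpa \<inter> Tna = {}"
    using decomp by (auto simp: atomic_decomposition_def)
  have "\<exists>x u v a b. ok n x u v a b" for n
  proof (rule approximate_coderivative_multipliers[OF P conv loc es(1)[of n]])
    fix x u v a b
    assume *: "dist x xbar \<le> es n" "u \<in> borel_measurable M" "v \<in> borel_measurable M"
      "integrable M a" "b \<in> borel_measurable M" "AE t in M. (u t, v t) \<in> D t"
      "AE t in M. \<exists>C d. d > 0 \<and> (\<forall>p\<in>D t. dist p (u t, v t) < d \<longrightarrow>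
        inner (a t, - b t) (p - (u t, v t)) \<le> C * norm (p - (u t, v t)) ^ 2)"
      "AE t in M. norm (u t - xbar) \<le> es n" "AE t in M. norm (b t - ysbar) \<le> es n"
      "(\<integral>t. norm (v t - y0 t) \<partial>M) \<le> es n" "(\<integral>t. norm (a t) * norm (u t - x) \<partial>M) \<le> es n"
      "norm ((\<integral>t. a t \<partial>M) - xsbar) \<le> es n"
    have "AE t in M. a t \<in> combined_subdiff2 (\<phi> t) (u t) (v t) (b t)"
      using *(6,7,8) AE_N
    proof eventually_elim
      case (elim t)
      then obtain C d where d: "d > 0" "\<And>p. p \<in> D t \<Longrightarrow> dist p (u t, v t) < d \<Longrightarrow>
          inner (a t, - b t) (p - (u t, v t)) \<le> C * norm (p - (u t, v t)) ^ 2"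
        by blast
      \<comment> \<open>\<open>u t\<close> is within \<open>R / 4\<close> of \<open>xbar\<close>, so
        the truncation to radius \<open>R / 2\<close> is invisible near \<open>(u t, v t)\<close>
        and the coderivative is that of the full subdifferential.\<close>
      have "p \<in> D t" if "p \<in> graph_of (limiting_subdiff (\<phi> t))" "dist p (u t, v t) < R / 4" for p
      proof -
        have "dist xbar (fst p) \<le> R / 2"
          using dist_triangle[of xbar "fst p" "u t"] dist_fst_le[of p "(u t, v t)"] that(2) elim(3) es(2)[of n]
          by (simp add: dist_norm norm_minus_commute)
        then show ?thesis using that(1) by (simp add: D_iff[OF elim(4)] graph_of_def case_prod_beta)
      qed
      moreover have "v t \<in> limiting_subdiff (\<phi> t) (u t)" using elim(1) by (simp add: D_iff[OF elim(4)])
      ultimately show ?case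
        unfolding combined_subdiff2_def using d R(1)
        by (intro regular_coderivativeI[where d = "min d (R / 4)" and C = C]) simp_all
    qed
    moreover have "Linf_norm M (\<lambda>t. xbar - u t) \<le> ennreal (es n)"
      using *(2,8) by (intro Linf_norm_le) (auto simp: norm_minus_commute)
    moreover have "Linf_norm M (\<lambda>t. b t - ysbar) \<le> ennreal (es n)"
      using *(5,9) by (intro Linf_norm_le) auto
    moreover have "u \<in> Linf M" "b \<in> Linf M"
      by (rule LinfI[OF *(2,8)], rule LinfI[OF *(5,9)])
    moreover have "a \<in> L1 M" "v \<in> L1 M" using *(4) v_int[OF *(3,6)] by (auto simp: L1_def)
    moreover have "L1_norm M (\<lambda>t. yfbar t - v t) \<le> es n"
    proof -
      have "(\<integral>t. norm (yfbar t - v t) \<partial>M) = (\<integral>t. norm (v t - y0 t) \<partial>M)"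
      proof (rule integral_cong_AE)
        show "AE t in M. norm (yfbar t - v t) = norm (v t - y0 t)"
          using y0_AE by eventually_elim (simp add: norm_minus_commute)
      qed (use yfbar_int *(3) y0_meas in auto)
      then show ?thesis using *(10) by (simp add: L1_norm_def)
    qed
    ultimately show ?thesis unfolding ok_def using *(1,11,12) by blast
  qed
  then obtain x u v a b where "\<And>n. ok n (x n) (u n) (v n) (a n) (b n)" by metis
  then have ok: "\<And>n. dist (x n) xbar \<le> es n" "\<And>n. u n \<in> Linf M" "\<And>n. a n \<in> L1 M" "\<And>n. v n \<in> L1 M" "\<And>n. b n \<in> Linf M"
    "\<And>n. AE t in M. a n t \<in> combined_subdiff2 (\<phi> t) (u n t) (v n t) (b n t)"
    "\<And>n. Linf_norm M (\<lambda>t. xbar - u n t) \<le> ennreal (es n)" "\<And>n. L1_norm M (\<lambda>t. yfbar t - v n t) \<le> es n"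
    "\<And>n. Linf_norm M (\<lambda>t. b n t - ysbar) \<le> ennreal (es n)"
    "\<And>n. (\<integral>t. norm (a n t) * norm (u n t - x n) \<partial>M) \<le> es n" "\<And>n. norm ((\<integral>t. a n t \<partial>M) - xsbar) \<le> es n"
    unfolding ok_def by auto
  have es_lim: "es \<longlonglongrightarrow> 0"
  proof (rule tendsto_sandwich[OF _ _ tendsto_const LIMSEQ_inverse_real_of_nat])
    show "\<forall>\<^sub>F n in sequentially. 0 \<le> es n" using es(1) by (intro always_eventually) (auto intro: less_imp_le)
    show "\<forall>\<^sub>F n in sequentially. es n \<le> inverse (real (Suc n))" using es(3) by (intro always_eventually) auto
  qed
  have es_lim': "(\<lambda>n. ennreal (es n)) \<longlonglongrightarrow> 0" using tendsto_ennrealI[OF es_lim] by simp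
  have lim: "h \<longlonglongrightarrow> 0" if "\<And>n. 0 \<le> h n" "\<And>n. h n \<le> es n" for h :: "nat \<Rightarrow> real"
    by (rule tendsto_sandwich[OF _ _ tendsto_const es_lim]) (use that in simp_all)
  have lim': "h \<longlonglongrightarrow> 0" if "\<And>n. h n \<le> ennreal (es n)" for h :: "nat \<Rightarrow> ennreal"
    by (rule tendsto_sandwich[OF _ _ tendsto_const es_lim']) (use that in simp_all)
  have "(\<lambda>n. norm (xbar - x n)) \<longlonglongrightarrow> 0"
    using ok(1) by (intro lim) (auto simp: dist_norm norm_minus_commute)
  moreover have "(\<lambda>n. Linf_norm M (\<lambda>t. xbar - u n t)) \<longlonglongrightarrow> 0" by (intro lim' ok)
  moreover have "(\<lambda>n. L1_norm M (\<lambda>t. yfbar t - v n t)) \<longlonglongrightarrow> 0"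
    by (intro lim ok) (simp add: L1_norm_def)
  moreover have "(\<lambda>n. Linf_norm M (\<lambda>t. b n t - ysbar)) \<longlonglongrightarrow> 0" by (intro lim' ok)
  moreover have "(\<lambda>n. \<integral>t. norm (a n t) * norm (u n t - x n) \<partial>M) \<longlonglongrightarrow> 0"
    by (intro lim ok) simp
  moreover have "(\<lambda>n. norm ((\<integral>t. a n t \<partial>M) - xsbar)) \<longlonglongrightarrow> 0" by (intro lim ok) simp
  then have "(\<lambda>n. \<integral>t. a n t \<partial>M) \<longlonglongrightarrow> xsbar"
    using Lim_null tendsto_norm_zero_iff by metis
  ultimately show ?thesis
    using ok(2-6) by (intro exI[of _ x] exI[of _ u] exI[of _ a] exI[of _ v] exI[of _ b]) simp
qed

end
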